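(* Let $n\ge 2$ be an integer, let $T_n$ be the Bruhat--Tits tree in which every vertex is incident to $n+1$ edges, let $\mathrm{Aut}(T_n)$ be its automorphism group, and let $\mathrm{Hier}(T_n)$ be the group of hierarchomorphisms of $T_n$, with the group topology in which $\mathrm{Aut}(T_n)$ is an open subgroup. Then $\mathrm{Aut}(T_n)$ is a spherical subgroup of $\mathrm{Hier}(T_n)$.
   Context: A subgroup $K$ of a topological group $G$ is called spherical in $G$ if for every irreducible unitary representation of $G$ (continuous, in a complex Hilbert space) the space of $K$-invariant vectors has dimension $\le 1$. $T_n$ is the infinite tree each of whose vertices is incident to exactly $n+1$ edges; $\mathrm{Vert}(T_n)$ is its set of vertices, and $\mathrm{Abs}(T_n)$ is its boundary (the space of ends, i.e. equivalence classes of infinite rays, with the usual topology). $\mathrm{Aut}(T_n)$ is the group of all automorphisms of the graph $T_n$, a locally compact group in which the pointwise stabilizers of finite subtrees form a base of open-closed neighborhoods of the unit; it acts faithfully on $\mathrm{Abs}(T_n)$ by homeomorphisms. Consider bijections $\theta:\mathrm{Vert}(T_n)\to\mathrm{Vert}(T_n)$ such that for all but finitely many pairs of adjacent vertices $(a,b)$ the vertices $\theta(a),\theta(b)$ are adjacent. Each such $\theta$ induces a homeomorphism of $\mathrm{Abs}(T_n)$ (the tail of a ray is sent to a ray). A hierarchomorphism of $T_n$ is a homeomorphism of $\mathrm{Abs}(T_n)$ induced by such a $\theta$. $\mathrm{Hier}(T_n)$ is the group of all hierarchomorphisms; it contains $\mathrm{Aut}(T_n)$, and it is topologized by requiring that $\mathrm{Aut}(T_n)$,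 with its topology above, be an open subgroup. *)

theory Defs
  imports "HOL-Analysis.Analysis" "HOL-Algebra.Bij" "HOL-Algebra.Coset"
begin

section \<open>Complex Hilbert spaces\<close>

text \<open>
  The real part of the Hermitian product is the real inner product of \<^class>\<open>real_inner\<close>, so that
  positive definiteness, the norm and the topology are inherited from there. The product is
  antilinear in the first argument.
\<close>

class chilbert_space = real_inner + complete_space +
  fixes scaleC :: "complex \<Rightarrow> 'a \<Rightarrow> 'a"  (infixr \<open>*\<^sub>C\<close> 75)
    and cinner :: "'a \<Rightarrow> 'a \<Rightarrow> complex"
  assumes scaleC_add_right: "c *\<^sub>C (x + y) = c *\<^sub>C x + c *\<^sub>C y"
    and scaleC_add_left: "(c + d) *\<^sub>C x = c *\<^sub>C x + d *\<^sub>C x"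
    and scaleC_scaleC: "c *\<^sub>C d *\<^sub>C x = (c * d) *\<^sub>C x"
    and scaleC_one: "1 *\<^sub>C x = x"
    and scaleR_scaleC: "scaleR r x = complex_of_real r *\<^sub>C x"
    and cinner_commute: "cinner x y = cnj (cinner y x)"
    and cinner_add_left: "cinner (x + y) z = cinner x z + cinner y z"
    and cinner_scaleC_left: "cinner (c *\<^sub>C x) y = cnj c * cinner x y"
    and Re_cinner: "Re (cinner x y) = inner x y"

global_interpretation complex_vector:
  vector_space "scaleC :: complex \<Rightarrow> 'a \<Rightarrow> 'a :: chilbert_space"
  by unfold_locales (simp_all add: scaleC_add_right scaleC_add_left scaleC_scaleC scaleC_one)


section \<open>Unitary representations and spherical subgroups\<close>

definition topological_group :: "('g, 'r) monoid_scheme \<Rightarrow> 'g topology \<Rightarrow> bool" where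
  "topological_group G T \<longleftrightarrow>
     group G \<and> topspace T = carrier G \<and>
     continuous_map (prod_topology T T) T (\<lambda>(x, y). x \<otimes>\<^bsub>G\<^esub> y) \<and>
     continuous_map T T (\<lambda>x. inv\<^bsub>G\<^esub> x)"

definition unitary :: "('h::chilbert_space \<Rightarrow> 'h) \<Rightarrow> bool" where
  "unitary U \<longleftrightarrow> Vector_Spaces.linear scaleC scaleC U \<and> surj U \<and>
     (\<forall>x y. cinner (U x) (U y) = cinner x y)"

definition unitary_rep ::
    "('g, 'r) monoid_scheme \<Rightarrow> 'g topology \<Rightarrow> ('g \<Rightarrow> 'h::chilbert_space \<Rightarrow> 'h) \<Rightarrow> bool" where
  "unitary_rep G T \<pi> \<longleftrightarrow>
     (\<forall>g\<in>carrier G. unitary (\<pi> g)) \<and>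
     (\<forall>g\<in>carrier G. \<forall>h\<in>carrier G. \<pi> (g \<otimes>\<^bsub>G\<^esub> h) = \<pi> g \<circ> \<pi> h) \<and>
     (\<forall>v. continuous_map T euclidean (\<lambda>g. \<pi> g v))"

definition irreducible_rep ::
    "('g, 'r) monoid_scheme \<Rightarrow> ('g \<Rightarrow> 'h::chilbert_space \<Rightarrow> 'h) \<Rightarrow> bool" where
  "irreducible_rep G \<pi> \<longleftrightarrow>
     (\<exists>v::'h. v \<noteq> 0) \<and>
     (\<forall>W. complex_vector.subspace W \<and> closed W \<and> (\<forall>g\<in>carrier G. \<pi> g ` W \<subseteq> W) \<longrightarrow>
          W = {0} \<or> W = UNIV)"

definition invariants :: "'g set \<Rightarrow> ('g \<Rightarrow> 'h \<Rightarrow> 'h) \<Rightarrow> 'h set" where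
  "invariants K \<pi> = {v. \<forall>k\<in>K. \<pi> k v = v}"

text \<open>
  A definition cannot quantify over all Hilbert spaces, so sphericity is relative to a type of
  vectors; a theorem in which this type is a variable covers all of them.
  The finiteness clause is needed because \<^term>\<open>complex_vector.dim\<close> is \<open>0\<close> on
  infinite-dimensional spaces.
\<close>

definition spherical ::
    "'h::chilbert_space itself \<Rightarrow> ('g, 'r) monoid_scheme \<Rightarrow> 'g topology \<Rightarrow> 'g set \<Rightarrow> bool" where
  "spherical _ G T K \<longleftrightarrow>
     topological_group G T \<and> subgroup K G \<and>
     (\<forall>\<pi> :: 'g \<Rightarrow> 'h \<Rightarrow> 'h. unitary_rep G T \<pi> \<and> irreducible_rep G \<pi> \<longrightarrow>
        (\<exists>B. finite B \<and> invariants K \<pi> \<subseteq> complex_vector.span B) \<and>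
        complex_vector.dim (invariants K \<pi>) \<le> 1)"


section \<open>Regular trees and their boundary\<close>

text \<open>Graphs are adjacency relations whose vertex set is the whole type \<^typ>\<open>'v\<close>.\<close>

definition regular_tree :: "nat \<Rightarrow> ('v \<Rightarrow> 'v \<Rightarrow> bool) \<Rightarrow> bool" where
  "regular_tree n E \<longleftrightarrow>
     symp E \<and> irreflp E \<and>
     (\<forall>a b. E\<^sup>*\<^sup>* a b) \<and>
     (\<nexists>c. length c \<ge> 3 \<and> distinct c \<and> successively E c \<and> E (last c) (hd c)) \<and>
     (\<forall>a. finite {b. E a b} \<and> card {b. E a b} = n + 1)"

definition ray :: "('v \<Rightarrow> 'v \<Rightarrow> bool) \<Rightarrow> (nat \<Rightarrow> 'v) \<Rightarrow> bool" where
  "ray E r \<longleftrightarrow> inj r \<and> (\<forall>k. E (r k) (r (Suc k)))"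

definition end_rel :: "('v \<Rightarrow> 'v \<Rightarrow> bool) \<Rightarrow> ((nat \<Rightarrow> 'v) \<times> (nat \<Rightarrow> 'v)) set" where
  "end_rel E = {(r, s). ray E r \<and> ray E s \<and> (\<exists>i j. \<forall>k. r (i + k) = s (j + k))}"

definition end_of :: "('v \<Rightarrow> 'v \<Rightarrow> bool) \<Rightarrow> (nat \<Rightarrow> 'v) \<Rightarrow> (nat \<Rightarrow> 'v) set" where
  "end_of E r = end_rel E `` {r}"

definition ends :: "('v \<Rightarrow> 'v \<Rightarrow> bool) \<Rightarrow> (nat \<Rightarrow> 'v) set set" where
  "ends E = Collect (ray E) // end_rel E"

text \<open>
  \<open>shadow E a b\<close> is the set of ends of the component containing \<open>b\<close> that remains after
  removing the edge \<open>ab\<close> from the tree.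
\<close>

definition shadow :: "('v \<Rightarrow> 'v \<Rightarrow> bool) \<Rightarrow> 'v \<Rightarrow> 'v \<Rightarrow> (nat \<Rightarrow> 'v) set set" where
  "shadow E a b = {end_of E r | r. ray E r \<and> r 0 = a \<and> r 1 = b}"

definition end_topology :: "('v \<Rightarrow> 'v \<Rightarrow> bool) \<Rightarrow> (nat \<Rightarrow> 'v) set topology" where
  "end_topology E = topology_generated_by {shadow E a b | a b. E a b}"

definition finite_subtree :: "('v \<Rightarrow> 'v \<Rightarrow> bool) \<Rightarrow> 'v set \<Rightarrow> bool" where
  "finite_subtree E S \<longleftrightarrow>
     finite S \<and> S \<noteq> {} \<and> (\<forall>a\<in>S. \<forall>b\<in>S. (\<lambda>x y. x \<in> S \<and> y \<in> S \<and> E x y)\<^sup>*\<^sup>* a b)"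


section \<open>Automorphisms and hierarchomorphisms\<close>

definition tree_aut :: "('v \<Rightarrow> 'v \<Rightarrow> bool) \<Rightarrow> ('v \<Rightarrow> 'v) set" where
  "tree_aut E = {f. bij f \<and> (\<forall>a b. E (f a) (f b) \<longleftrightarrow> E a b)}"

definition almost_aut :: "('v \<Rightarrow> 'v \<Rightarrow> bool) \<Rightarrow> ('v \<Rightarrow> 'v) set" where
  "almost_aut E = {\<theta>. bij \<theta> \<and> finite {(a, b). E a b \<and> \<not> E (\<theta> a) (\<theta> b)}}"

definition induces ::
    "('v \<Rightarrow> 'v \<Rightarrow> bool) \<Rightarrow> ('v \<Rightarrow> 'v) \<Rightarrow> ((nat \<Rightarrow> 'v) set \<Rightarrow> (nat \<Rightarrow> 'v) set) \<Rightarrow> bool" where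
  "induces E \<theta> h \<longleftrightarrow>
     h \<in> extensional (ends E) \<and>
     (\<forall>r. ray E r \<longrightarrow> (\<exists>N. ray E (\<lambda>k. \<theta> (r (N + k))) \<and>
        h (end_of E r) = end_of E (\<lambda>k. \<theta> (r (N + k)))))"

definition hier :: "('v \<Rightarrow> 'v \<Rightarrow> bool) \<Rightarrow> ((nat \<Rightarrow> 'v) set \<Rightarrow> (nat \<Rightarrow> 'v) set) set" where
  "hier E = {h. homeomorphic_map (end_topology E) (end_topology E) h \<and>
                (\<exists>\<theta>\<in>almost_aut E. induces E \<theta> h)}"

definition hier_group ::
    "('v \<Rightarrow> 'v \<Rightarrow> bool) \<Rightarrow> ((nat \<Rightarrow> 'v) set \<Rightarrow> (nat \<Rightarrow> 'v) set) monoid" where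
  "hier_group E = BijGroup (ends E) \<lparr>carrier := hier E\<rparr>"

text \<open>
  The automorphism group and its subgroups are identified with their images under the action
  on the boundary, which is faithful for \<open>n \<ge> 2\<close>.
\<close>

definition aut :: "('v \<Rightarrow> 'v \<Rightarrow> bool) \<Rightarrow> ((nat \<Rightarrow> 'v) set \<Rightarrow> (nat \<Rightarrow> 'v) set) set" where
  "aut E = {h. \<exists>f\<in>tree_aut E. induces E f h}"

definition aut_fixing ::
    "('v \<Rightarrow> 'v \<Rightarrow> bool) \<Rightarrow> 'v set \<Rightarrow> ((nat \<Rightarrow> 'v) set \<Rightarrow> (nat \<Rightarrow> 'v) set) set" where
  "aut_fixing E S = {h. \<exists>f\<in>tree_aut E. (\<forall>v\<in>S. f v = v) \<and> induces E f h}"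

definition aut_topology ::
    "('v \<Rightarrow> 'v \<Rightarrow> bool) \<Rightarrow> ((nat \<Rightarrow> 'v) set \<Rightarrow> (nat \<Rightarrow> 'v) set) topology" where
  "aut_topology E = topology_generated_by
     {g <#\<^bsub>hier_group E\<^esub> aut_fixing E S | g S. g \<in> aut E \<and> finite_subtree E S}"

definition is_hier_topology ::
    "('v \<Rightarrow> 'v \<Rightarrow> bool) \<Rightarrow> ((nat \<Rightarrow> 'v) set \<Rightarrow> (nat \<Rightarrow> 'v) set) topology \<Rightarrow> bool" where
  "is_hier_topology E T \<longleftrightarrow>
     topological_group (hier_group E) T \<and>
     openin T (aut E) \<and> subtopology T (aut E) = aut_topology E"

text \<open>Such a topology exists and is unique, see \<open>ex1_hier_topology\<close> below.\<close>

definition hier_topology ::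
    "('v \<Rightarrow> 'v \<Rightarrow> bool) \<Rightarrow> ((nat \<Rightarrow> 'v) set \<Rightarrow> (nat \<Rightarrow> 'v) set) topology" where
  "hier_topology E = (THE T. is_hier_topology E T)"


section \<open>The topology of the hierarchomorphism group is well defined\<close>

subsection \<open>Group topologies given by families of open subgroups\<close>

context group begin

definition coset_topology :: "'a set set \<Rightarrow> 'a topology" where
  "coset_topology F = topology (\<lambda>U. U \<subseteq> carrier G \<and> (\<forall>g\<in>U. \<exists>H\<in>F. g <# H \<subseteq> U))"

lemma mem_l_coset_self: "subgroup H G \<Longrightarrow> g \<in> carrier G \<Longrightarrow> g \<in> g <# H"
  unfolding l_coset_def using subgroup.one_closed by force

lemma openin_coset_topology:
  assumes dir: "\<forall>H\<in>F. \<forall>K\<in>F. \<exists>L\<in>F. L \<subseteq> H \<inter> K"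
  shows "openin (coset_topology F) U \<longleftrightarrow> U \<subseteq> carrier G \<and> (\<forall>g\<in>U. \<exists>H\<in>F. g <# H \<subseteq> U)"
proof -
  let ?P = "\<lambda>U. U \<subseteq> carrier G \<and> (\<forall>g\<in>U. \<exists>H\<in>F. g <# H \<subseteq> U)"
  have "?P (S \<inter> T)" if S: "?P S" and T: "?P T" for S T
  proof (intro conjI ballI)
    show "S \<inter> T \<subseteq> carrier G" using S by blast
    fix g assume "g \<in> S \<inter> T"
    then obtain H K where "H \<in> F" "K \<in> F" and sub: "g <# H \<subseteq> S" "g <# K \<subseteq> T"
      using S T by blast
    then obtain L where "L \<in> F" "L \<subseteq> H \<inter> K" using dir by blast
    then have "g <# L \<subseteq> S \<inter> T" using sub unfolding l_coset_def by blast
    then show "\<exists>H\<in>F. g <# H \<subseteq> S \<inter> T" using \<open>L \<in> F\<close> by blast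
  qed
  moreover have "?P (\<Union>\<K>)" if "\<forall>K\<in>\<K>. ?P K" for \<K>
    using that by (meson Sup_least Union_iff Union_upper subset_trans)
  ultimately have "istopology ?P"
    unfolding istopology_def by presburger
  then show ?thesis
    unfolding coset_topology_def by (simp add: topology_inverse')
qed

lemma openin_l_coset:
  assumes dir: "\<forall>H\<in>F. \<forall>K\<in>F. \<exists>L\<in>F. L \<subseteq> H \<inter> K"
    and sg: "\<forall>H\<in>F. subgroup H G" and H: "H \<in> F" and g: "g \<in> carrier G"
  shows "openin (coset_topology F) (g <# H)"
proof -
  interpret H: subgroup H G using sg H by blast
  show ?thesis
    unfolding openin_coset_topology[of F, OF dir]
  proof (intro conjI ballI)
    show "g <# H \<subseteq> carrier G" using g by (auto simp: l_coset_def)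
    fix x assume "x \<in> g <# H"
    then have "x <# H \<subseteq> g <# H" using g by (force simp: l_coset_def m_assoc)
    then show "\<exists>K\<in>F. x <# K \<subseteq> g <# H" using H by blast
  qed
qed

lemma topological_group_coset_topology:
  assumes ne: "F \<noteq> {}"
    and dir: "\<forall>H\<in>F. \<forall>K\<in>F. \<exists>L\<in>F. L \<subseteq> H \<inter> K"
    and sg: "\<forall>H\<in>F. subgroup H G"
    and conj: "\<And>g H. g \<in> carrier G \<Longrightarrow> H \<in> F \<Longrightarrow>
                 \<exists>K\<in>F. \<forall>k\<in>K. inv g \<otimes> k \<otimes> g \<in> H"
  shows "topological_group G (coset_topology F)"
proof -
  let ?T = "coset_topology F"
  note op = openin_coset_topology[of F, OF dir]
  note opc = openin_l_coset[of F, OF dir sg]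
  have car: "H \<subseteq> carrier G" if "H \<in> F" for H
    using sg that subgroup.subset by blast
  obtain H0 where H0: "H0 \<in> F" using ne by blast
  have "openin ?T (carrier G)"
    unfolding op using H0 car[OF H0] by (auto simp: l_coset_def intro!: bexI[of _ H0])
  then have ts: "topspace ?T = carrier G"
    by (metis op openin_subset openin_topspace subset_antisym)
  have "continuous_map (prod_topology ?T ?T) ?T (\<lambda>(x, y). x \<otimes> y)"
    unfolding continuous_map_def
  proof (intro conjI allI impI)
    show "(\<lambda>(x, y). x \<otimes> y) \<in> topspace (prod_topology ?T ?T) \<rightarrow> topspace ?T"
      by (auto simp: ts)
    fix U assume U: "openin ?T U"
    show "openin (prod_topology ?T ?T)
            {p \<in> topspace (prod_topology ?T ?T). (case p of (x, y) \<Rightarrow> x \<otimes> y) \<in> U}"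
      unfolding openin_prod_topology_alt
    proof (intro allI impI)
      fix x y
      assume "(x, y) \<in> {p \<in> topspace (prod_topology ?T ?T). (case p of (x, y) \<Rightarrow> x \<otimes> y) \<in> U}"
      then have xy: "x \<in> carrier G" "y \<in> carrier G" "x \<otimes> y \<in> U" by (auto simp: ts)
      then obtain H where H: "H \<in> F" "(x \<otimes> y) <# H \<subseteq> U" using U op by blast
      obtain K where K: "K \<in> F" "\<forall>k\<in>K. inv y \<otimes> k \<otimes> y \<in> H" using conj xy H by blast
      have "a \<otimes> b \<in> U" if ab: "a \<in> x <# K" "b \<in> y <# H" for a b
      proof -
        obtain k h where kh: "k \<in> K" "h \<in> H" "a = x \<otimes> k" "b = y \<otimes> h"
          using ab unfolding l_coset_def by blast
        have c: "k \<in> carrier G" "h \<in> carrier G" using kh car K H by blast+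
        have "a \<otimes> b = x \<otimes> (k \<otimes> (y \<otimes> h))" using c xy kh by (simp add: m_assoc)
        also have "\<dots> = x \<otimes> (y \<otimes> (inv y \<otimes> (k \<otimes> (y \<otimes> h))))"
          using c xy by (simp add: m_assoc[symmetric])
        also have "\<dots> = (x \<otimes> y) \<otimes> ((inv y \<otimes> k \<otimes> y) \<otimes> h)"
          using c xy by (simp add: m_assoc)
        finally have "a \<otimes> b = (x \<otimes> y) \<otimes> ((inv y \<otimes> k \<otimes> y) \<otimes> h)" .
        moreover have "(inv y \<otimes> k \<otimes> y) \<otimes> h \<in> H"
          using K kh sg H(1) subgroup.m_closed by metis
        ultimately have "a \<otimes> b \<in> (x \<otimes> y) <# H" by (auto simp: l_coset_def)
        then show ?thesis using H by blast
      qed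
      moreover have "x \<in> x <# K" "y \<in> y <# H" using mem_l_coset_self sg K H xy by blast+
      moreover have "openin ?T (x <# K)" "openin ?T (y <# H)" using opc K H xy by blast+
      moreover have "x <# K \<subseteq> carrier G" "y <# H \<subseteq> carrier G"
        using calculation(4,5) op by blast+
      ultimately show "\<exists>V W. openin ?T V \<and> openin ?T W \<and> x \<in> V \<and> y \<in> W \<and>
          V \<times> W \<subseteq> {p \<in> topspace (prod_topology ?T ?T). (case p of (x, y) \<Rightarrow> x \<otimes> y) \<in> U}"
        by (intro exI[of _ "x <# K"] exI[of _ "y <# H"]) (auto simp: ts)
    qed
  qed
  moreover have "continuous_map ?T ?T (\<lambda>x. inv x)"
    unfolding continuous_map_def
  proof (intro conjI allI impI)
    show "(\<lambda>x. inv x) \<in> topspace ?T \<rightarrow> topspace ?T" by (auto simp: ts)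
    fix U assume U: "openin ?T U"
    show "openin ?T {x \<in> topspace ?T. inv x \<in> U}"
      unfolding op
    proof (intro conjI ballI)
      show "{x \<in> topspace ?T. inv x \<in> U} \<subseteq> carrier G" by (auto simp: ts)
      fix x assume "x \<in> {x \<in> topspace ?T. inv x \<in> U}"
      then have x: "x \<in> carrier G" "inv x \<in> U" by (auto simp: ts)
      then obtain H where H: "H \<in> F" "(inv x) <# H \<subseteq> U" using U op by blast
      obtain K where K: "K \<in> F" "\<forall>k\<in>K. inv (inv x) \<otimes> k \<otimes> inv x \<in> H"
        using conj[of "inv x"] x H by blast
      have "inv (x \<otimes> k) \<in> U" if k: "k \<in> K" for k
      proof -
        have k': "inv k \<in> K" "k \<in> carrier G"
          using subgroup.m_inv_closed[OF bspec[OF sg K(1)] k] car[OF K(1)] k by auto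
        have "inv x \<otimes> (x \<otimes> inv k \<otimes> inv x) = inv x \<otimes> (x \<otimes> (inv k \<otimes> inv x))"
          using x k' by (simp add: m_assoc)
        also have "\<dots> = inv k \<otimes> inv x"
          using x k' by (simp add: m_assoc[symmetric])
        also have "\<dots> = inv (x \<otimes> k)"
          using x k' by (simp add: inv_mult_group)
        finally have "inv (x \<otimes> k) = inv x \<otimes> (x \<otimes> inv k \<otimes> inv x)" by simp
        moreover have "x \<otimes> inv k \<otimes> inv x \<in> H" using K(2) k' x by auto
        ultimately show ?thesis using H by (auto simp: l_coset_def)
      qed
      then show "\<exists>H\<in>F. x <# H \<subseteq> {x \<in> topspace ?T. inv x \<in> U}"
        using K(1) car[OF K(1)] x by (intro bexI[of _ K]) (auto simp: l_coset_def ts)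
    qed
  qed
  ultimately show ?thesis
    unfolding topological_group_def using ts is_group by blast
qed

lemma subtopology_coset_topology:
  assumes dir: "\<forall>H\<in>F. \<forall>K\<in>F. \<exists>L\<in>F. L \<subseteq> H \<inter> K"
    and sg: "\<forall>H\<in>F. subgroup H G" and ne: "F \<noteq> {}"
    and A: "subgroup A G" and sub: "\<And>H. H \<in> F \<Longrightarrow> H \<subseteq> A"
  shows "openin (coset_topology F) A"
    and "subtopology (coset_topology F) A = topology_generated_by {g <# H |g H. g \<in> A \<and> H \<in> F}"
      (is "_ = ?R")
proof -
  note op = openin_coset_topology[of F, OF dir]
  note opc = openin_l_coset[of F, OF dir sg]
  have AG: "A \<subseteq> carrier G" using A subgroup.subset by blast
  have cA: "g <# H \<subseteq> A" if "g \<in> A" "H \<in> F" for g H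
    using that sub subgroup.m_closed[OF A] by (auto simp: l_coset_def)
  show oA: "openin (coset_topology F) A"
    unfolding op using AG cA ne by blast
  show "subtopology (coset_topology F) A = ?R"
    unfolding topology_eq openin_open_subtopology[OF oA]
  proof (intro allI iffI)
    fix U assume U: "openin (coset_topology F) U \<and> U \<subseteq> A"
    show "openin ?R U"
    proof (subst openin_subopen, intro ballI)
      fix g assume g: "g \<in> U"
      then obtain H where H: "H \<in> F" "g <# H \<subseteq> U" using U op by blast
      then have "openin ?R (g <# H)" using g U by (intro topology_generated_by_Basis) blast
      moreover have "g \<in> g <# H" using mem_l_coset_self sg H g U AG by blast
      ultimately show "\<exists>T. openin ?R T \<and> g \<in> T \<and> T \<subseteq> U" using H by blast
    qed
  next
    fix U assume "openin ?R U"
    then have "generate_topology_on {g <# H |g H. g \<in> A \<and> H \<in> F} U"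
      by (rule openin_topology_generated_by)
    then show "openin (coset_topology F) U \<and> U \<subseteq> A"
    proof induction
      case (Basis s)
      then show ?case using opc AG cA by blast
    qed auto
  qed
qed

lemma topological_group_eqI:
  assumes 1: "topological_group G T1" "openin T1 A" and 2: "topological_group G T2" "openin T2 A"
    and eq: "subtopology T1 A = subtopology T2 A" and A: "\<one> \<in> A"
  shows "T1 = T2"
proof -
  have cont: "continuous_map T T (\<lambda>y. x \<otimes> y)" if T: "topological_group G T" and x: "x \<in> carrier G" for T x
  proof -
    have "continuous_map T (prod_topology T T) (\<lambda>y. (x, y))"
      using T x by (auto simp: topological_group_def intro!: continuous_map_pairedI)
    then have "continuous_map T T ((\<lambda>(x, y). x \<otimes> y) \<circ> (\<lambda>y. (x, y)))"
      using T by (auto simp: topological_group_def intro: continuous_map_compose)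
    then show ?thesis by (simp add: o_def)
  qed
  have main: "openin T' U"
    if T: "topological_group G T" "openin T A" and T': "topological_group G T'" "openin T' A"
      and eq: "subtopology T A = subtopology T' A" and U: "openin T U" for T T' U
  proof (subst openin_subopen, intro ballI)
    fix g assume "g \<in> U"
    have tsp: "topspace T = carrier G" "topspace T' = carrier G"
      using T T' by (auto simp: topological_group_def)
    have UG: "U \<subseteq> carrier G" using openin_subset[OF U] tsp by simp
    have g: "g \<in> carrier G" using UG \<open>g \<in> U\<close> by blast
    let ?V = "{y \<in> carrier G. g \<otimes> y \<in> U} \<inter> A"
    have "openin T {y \<in> carrier G. g \<otimes> y \<in> U}"
      using openin_continuous_map_preimage[OF cont[OF T(1) g] U] tsp by simp
    then have "openin T ?V" using T by blast
    then have "openin (subtopology T A) ?V" using openin_open_subtopology[OF T(2)] by blast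
    then have V: "openin T' ?V" using eq openin_open_subtopology[OF T'(2)] by metis
    let ?W = "{y \<in> carrier G. inv g \<otimes> y \<in> ?V}"
    have "openin T' ?W"
      using openin_continuous_map_preimage[OF cont[OF T'(1), of "inv g"] V] tsp g by simp
    moreover have "g \<in> ?W" using g \<open>g \<in> U\<close> A by simp
    moreover have "?W \<subseteq> U"
      using g by (auto simp: m_assoc[symmetric])
    ultimately show "\<exists>W. openin T' W \<and> g \<in> W \<and> W \<subseteq> U" by blast
  qed
  show ?thesis
    unfolding topology_eq using main[OF 1 2 eq] main[OF 2 1 eq[symmetric]] by blast
qed

end


subsection \<open>Maps induced on the boundary\<close>

lemma end_rel_equiv: "equiv (Collect (ray E)) (end_rel E)"
proof (rule equivI)
  show "refl_on (Collect (ray E)) (end_rel E)"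
    by (auto simp: refl_on_def end_rel_def)
  show "sym (end_rel E)"
    unfolding sym_def end_rel_def by (auto; metis)
  show "trans (end_rel E)"
  proof (rule transI)
    fix r s t assume "(r, s) \<in> end_rel E" "(s, t) \<in> end_rel E"
    then obtain i j i' j' where rays: "ray E r" "ray E t"
      and e: "\<forall>k. r (i + k) = s (j + k)" "\<forall>k. s (i' + k) = t (j' + k)"
      by (auto simp: end_rel_def)
    have "r ((i + i') + k) = t ((j' + j) + k)" for k
      using e(1)[rule_format, of "i' + k"] e(2)[rule_format, of "j + k"]
      by (simp add: add.assoc add.left_commute)
    then show "(r, t) \<in> end_rel E" using rays unfolding end_rel_def by blast
  qed
qed (auto simp: end_rel_def)

lemma end_of_eq: "ray E r \<Longrightarrow> ray E s \<Longrightarrow>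
    end_of E r = end_of E s \<longleftrightarrow> (\<exists>i j. \<forall>k. r (i + k) = s (j + k))"
  using eq_equiv_class_iff[OF end_rel_equiv, of r E s] by (auto simp: end_of_def end_rel_def)

lemma ends_eq: "ends E = {end_of E r |r. ray E r}"
  unfolding ends_def end_of_def quotient_def by auto

lemma end_of_in: "ray E r \<Longrightarrow> end_of E r \<in> ends E"
  using ends_eq by blast

lemma ray_shift: "ray E r \<Longrightarrow> ray E (\<lambda>k. r (N + k))"
  unfolding ray_def inj_def by (metis add_Suc_right add_left_cancel)

lemma end_of_shift: "ray E r \<Longrightarrow> end_of E (\<lambda>k. r (N + k)) = end_of E r"
proof -
  assume r: "ray E r"
  have "\<exists>i j. \<forall>k. r (N + (i + k)) = r (j + k)"
    by (rule exI[of _ 0], rule exI[of _ N]) simp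
  then show ?thesis by (subst end_of_eq[OF ray_shift[OF r] r])
qed

lemma topspace_end_topology: "topspace (end_topology E) = ends E"
proof -
  have "end_of E r \<in> shadow E (r 0) (r 1) \<and> E (r 0) (r 1)" if "ray E r" for r
    using that by (auto simp: shadow_def ray_def)
  then show ?thesis
    unfolding end_topology_def topology_generated_by_topspace ends_eq
    by (auto simp: shadow_def)
qed

lemma inducesD:
  assumes h: "induces E \<theta> h" and r: "ray E r" and M: "ray E (\<lambda>k. \<theta> (r (M + k)))"
  shows "h (end_of E r) = end_of E (\<lambda>k. \<theta> (r (M + k)))"
proof -
  obtain N where N: "ray E (\<lambda>k. \<theta> (r (N + k)))" "h (end_of E r) = end_of E (\<lambda>k. \<theta> (r (N + k)))"
    using h r unfolding induces_def by blast
  have "end_of E (\<lambda>k. \<theta> (r (N + k))) = end_of E (\<lambda>k. \<theta> (r (M + k)))"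
    unfolding end_of_eq[OF N(1) M]
    by (intro exI[of _ M] exI[of _ N]) (simp add: add.left_commute)
  then show ?thesis using N by simp
qed

lemma induces_unique: "induces E \<theta> h \<Longrightarrow> induces E \<theta> h' \<Longrightarrow> h = h'"
proof (rule extensionalityI[of _ "ends E"])
  assume h: "induces E \<theta> h" and h': "induces E \<theta> h'"
  show "h \<in> extensional (ends E)" "h' \<in> extensional (ends E)"
    using h h' by (auto simp: induces_def)
  fix e assume "e \<in> ends E"
  then obtain r where r: "ray E r" "e = end_of E r" by (auto simp: ends_eq)
  then obtain N where "ray E (\<lambda>k. \<theta> (r (N + k)))" using h unfolding induces_def by blast
  then show "h e = h' e" using inducesD[OF h] inducesD[OF h'] r by metis
qed

lemma induces_compose:
  assumes h: "induces E \<theta> h" and g: "induces E \<eta> g"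
  shows "induces E (\<theta> \<circ> \<eta>) (compose (ends E) h g)"
  unfolding induces_def
proof (intro conjI allI impI)
  fix r assume r: "ray E r"
  obtain N where N: "ray E (\<lambda>k. \<eta> (r (N + k)))" "g (end_of E r) = end_of E (\<lambda>k. \<eta> (r (N + k)))"
    using g r unfolding induces_def by blast
  obtain M where M: "ray E (\<lambda>k. \<theta> (\<eta> (r (N + (M + k)))))"
     "h (end_of E (\<lambda>k. \<eta> (r (N + k)))) = end_of E (\<lambda>k. \<theta> (\<eta> (r (N + (M + k)))))"
    using h N(1) unfolding induces_def by blast
  show "\<exists>N. ray E (\<lambda>k. (\<theta> \<circ> \<eta>) (r (N + k))) \<and>
      compose (ends E) h g (end_of E r) = end_of E (\<lambda>k. (\<theta> \<circ> \<eta>) (r (N + k)))"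
    using M N end_of_in[OF r]
    by (intro exI[of _ "N + M"]) (simp add: compose_def add.assoc)
qed (simp add: compose_def)

lemma induces_id: "induces E id (\<lambda>e\<in>ends E. e)"
  unfolding induces_def by (auto simp: end_of_in intro!: exI[of _ 0])

lemma induces_in_ends: "induces E \<theta> h \<Longrightarrow> e \<in> ends E \<Longrightarrow> h e \<in> ends E"
  unfolding induces_def ends_eq by (smt (verit) mem_Collect_eq)

lemma almost_aut_tail:
  assumes \<theta>: "\<theta> \<in> almost_aut E" and r: "ray E r"
  shows "\<exists>N. ray E (\<lambda>k. \<theta> (r (N + k)))"
proof -
  let ?B = "{(a, b). E a b \<and> \<not> E (\<theta> a) (\<theta> b)}"
  have \<theta>: "inj \<theta>" and "finite ?B" using \<theta> by (auto simp: almost_aut_def bij_def)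
  have "inj (\<lambda>k. (r k, r (Suc k)))" using r by (auto simp: ray_def inj_on_def)
  with \<open>finite ?B\<close> have "finite ((\<lambda>k. (r k, r (Suc k))) -` ?B)" by (rule finite_vimageI)
  then obtain N where N: "\<forall>k. (r k, r (Suc k)) \<in> ?B \<longrightarrow> k < N"
    unfolding finite_nat_iff_bounded by blast
  have "E (r k) (r (Suc k))" for k using r by (simp add: ray_def)
  then have "E (\<theta> (r (N + k))) (\<theta> (r (N + Suc k)))" for k using N[rule_format, of "N + k"] by auto
  moreover have "inj (\<lambda>k. \<theta> (r (N + k)))"
    using r \<theta> unfolding ray_def inj_def by (metis add_left_cancel)
  ultimately show ?thesis unfolding ray_def by blast
qed

lemma almost_aut_comp:
  assumes "\<theta> \<in> almost_aut E" "\<eta> \<in> almost_aut E"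
  shows "\<theta> \<circ> \<eta> \<in> almost_aut E"
proof -
  let ?B = "\<lambda>\<theta>. {(a, b). E a b \<and> \<not> E (\<theta> a) (\<theta> b)}"
  have b: "bij \<theta>" "bij \<eta>" "finite (?B \<theta>)" "finite (?B \<eta>)" using assms by (auto simp: almost_aut_def)
  have "finite (map_prod \<eta> \<eta> -` ?B \<theta>)"
    using b by (intro finite_vimageI) (auto simp: bij_def prod.inj_map)
  moreover have "?B (\<theta> \<circ> \<eta>) \<subseteq> ?B \<eta> \<union> map_prod \<eta> \<eta> -` ?B \<theta>" by auto
  ultimately have "finite (?B (\<theta> \<circ> \<eta>))" using b by (meson finite_Un finite_subset)
  then show ?thesis using b by (simp add: almost_aut_def bij_comp)
qed

lemma tree_aut_almost: "f \<in> tree_aut E \<Longrightarrow> f \<in> almost_aut E"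
  by (auto simp: tree_aut_def almost_aut_def)

lemma tree_aut_comp: "f \<in> tree_aut E \<Longrightarrow> g \<in> tree_aut E \<Longrightarrow> f \<circ> g \<in> tree_aut E"
  by (auto simp: tree_aut_def bij_comp)

lemma tree_aut_inv: "f \<in> tree_aut E \<Longrightarrow> inv_into UNIV f \<in> tree_aut E"
  unfolding tree_aut_def by (auto simp: bij_imp_bij_inv) (metis bij_inv_eq_iff)+

lemma tree_aut_ray: "f \<in> tree_aut E \<Longrightarrow> ray E r \<Longrightarrow> ray E (\<lambda>k. f (r k))"
  by (auto simp: tree_aut_def ray_def bij_def inj_on_def)

lemma tree_aut_induces_ray:
  "f \<in> tree_aut E \<Longrightarrow> induces E f h \<Longrightarrow> ray E r \<Longrightarrow> h (end_of E r) = end_of E (\<lambda>k. f (r k))"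
  using inducesD[of E f h r 0] tree_aut_ray[of f E r] by simp

lemma almost_aut_inv:
  assumes t: "regular_tree n E" and \<theta>: "\<theta> \<in> almost_aut E"
  shows "inv_into UNIV \<theta> \<in> almost_aut E"
proof -
  let ?B = "{(a, b). E a b \<and> \<not> E (\<theta> a) (\<theta> b)}"
  let ?N = "\<lambda>a. {b. E a b}"
  have b: "bij \<theta>" "finite ?B" using \<theta> by (auto simp: almost_aut_def)
  have fin: "finite (?N a)" and crd: "card (?N a) = n + 1" for a
    using t by (auto simp: regular_tree_def)
  have "{(c, d). E c d \<and> \<not> E (inv_into UNIV \<theta> c) (inv_into UNIV \<theta> d)} \<subseteq> Sigma (\<theta> ` fst ` ?B) ?N"
  proof (rule subrelI)
    fix c d assume "(c, d) \<in> {(c, d). E c d \<and> \<not> E (inv_into UNIV \<theta> c) (inv_into UNIV \<theta> d)}"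
    then have cd: "E c d" "\<not> E (inv_into UNIV \<theta> c) (inv_into UNIV \<theta> d)" by auto
    have "c \<in> \<theta> ` fst ` ?B"
    proof (rule ccontr)
      assume nc: "c \<notin> \<theta> ` fst ` ?B"
      define a where "a = inv_into UNIV \<theta> c"
      have a: "\<theta> a = c" using b by (simp add: a_def bij_is_surj surj_f_inv_f)
      have "\<theta> ` ?N a \<subseteq> ?N c"
        using nc a by (force simp: image_iff)
      moreover have "card (\<theta> ` ?N a) = card (?N c)"
        using b by (subst card_image) (auto simp: crd bij_def inj_on_def)
      ultimately have "\<theta> ` ?N a = ?N c" using fin card_subset_eq by blast
      then obtain x where "E a x" "d = \<theta> x" using cd by blast
      then show False using cd b by (simp add: a_def bij_is_inj)
    qed
    then show "(c, d) \<in> Sigma (\<theta> ` fst ` ?B) ?N" using cd by simp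
  qed
  moreover have "finite (Sigma (\<theta> ` fst ` ?B) ?N)" using b fin by blast
  ultimately show ?thesis using b by (simp add: almost_aut_def bij_imp_bij_inv finite_subset)
qed

lemma induces_tree_aut_bij:
  assumes f: "f \<in> tree_aut E" and h: "induces E f h"
  shows "bij_betw h (ends E) (ends E)"
  unfolding bij_betw_def
proof (rule conjI, rule inj_onI)
  have inj: "f x = f y \<longleftrightarrow> x = y" for x y using f by (auto simp: tree_aut_def bij_def inj_eq)
  fix d e assume "d \<in> ends E" "e \<in> ends E" and eq: "h d = h e"
  then obtain r s where rs: "ray E r" "ray E s" "d = end_of E r" "e = end_of E s"
    by (auto simp: ends_eq)
  then have "end_of E (\<lambda>k. f (r k)) = end_of E (\<lambda>k. f (s k))"
    using tree_aut_induces_ray[OF f h] eq by metis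
  then show "d = e" using rs by (simp add: end_of_eq tree_aut_ray[OF f] inj)
next
  have "e \<in> h ` ends E" if "e \<in> ends E" for e
  proof -
  from that obtain s where s: "ray E s" "e = end_of E s" by (auto simp: ends_eq)
  have r: "ray E (\<lambda>k. inv_into UNIV f (s k))" using tree_aut_ray[OF tree_aut_inv[OF f] s(1)] .
  have "h (end_of E (\<lambda>k. inv_into UNIV f (s k))) = e"
    unfolding tree_aut_induces_ray[OF f h r]
    using f s by (simp add: tree_aut_def bij_is_surj surj_f_inv_f)
  then show "e \<in> h ` ends E" using end_of_in[OF r] by blast
  qed
  then show "h ` ends E = ends E" using induces_in_ends[OF h] by blast
qed

lemma tree_aut_inv_induces:
  assumes f: "f \<in> tree_aut E" and h: "induces E f h"
  shows "induces E (inv_into UNIV f) (\<lambda>e\<in>ends E. inv_into (ends E) h e)"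
  unfolding induces_def
proof (intro conjI allI impI exI[of _ 0])
  fix s assume s: "ray E s"
  have r: "ray E (\<lambda>k. inv_into UNIV f (s k))" using tree_aut_ray[OF tree_aut_inv[OF f] s(1)] .
  then show "ray E (\<lambda>k. inv_into UNIV f (s (0 + k)))" by simp
  have "h (end_of E (\<lambda>k. inv_into UNIV f (s k))) = end_of E s"
    unfolding tree_aut_induces_ray[OF f h r]
    using f s by (simp add: tree_aut_def bij_is_surj surj_f_inv_f)
  then show "(\<lambda>e\<in>ends E. inv_into (ends E) h e) (end_of E s) = end_of E (\<lambda>k. inv_into UNIV f (s (0 + k)))"
    using bij_betw_inv_into_left[OF induces_tree_aut_bij[OF f h] end_of_in[OF r]] end_of_in[OF s]
    by simp
qed simp

lemma tree_aut_image_shadow: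
  assumes f: "f \<in> tree_aut E" and h: "induces E f h"
  shows "h ` shadow E a b = shadow E (f a) (f b)"
proof (intro subset_antisym subsetI)
  fix e assume "e \<in> h ` shadow E a b"
  then obtain r where r: "ray E r" "r 0 = a" "r 1 = b" "e = h (end_of E r)"
    by (auto simp: shadow_def)
  then show "e \<in> shadow E (f a) (f b)"
    using tree_aut_induces_ray[OF f h r(1)] tree_aut_ray[OF f r(1)]
    by (auto simp: shadow_def intro!: exI[of _ "\<lambda>k. f (r k)"])
next
  fix e assume "e \<in> shadow E (f a) (f b)"
  then obtain s where s: "ray E s" "s 0 = f a" "s 1 = f b" "e = end_of E s"
    by (auto simp: shadow_def)
  have r: "ray E (\<lambda>k. inv_into UNIV f (s k))" using tree_aut_ray[OF tree_aut_inv[OF f] s(1)] .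
  have "h (end_of E (\<lambda>k. inv_into UNIV f (s k))) = e"
    unfolding tree_aut_induces_ray[OF f h r]
    using f s by (simp add: tree_aut_def bij_is_surj surj_f_inv_f)
  moreover have "end_of E (\<lambda>k. inv_into UNIV f (s k)) \<in> shadow E a b"
    using r s f unfolding shadow_def tree_aut_def
    by (auto simp: bij_is_inj intro!: exI[of _ "\<lambda>k. inv_into UNIV f (s k)"])
  ultimately show "e \<in> h ` shadow E a b" by blast
qed

lemma tree_aut_homeomorphic:
  assumes f: "f \<in> tree_aut E" and h: "induces E f h"
  shows "homeomorphic_map (end_topology E) (end_topology E) h"
proof -
  let ?T = "end_topology E" and ?g = "\<lambda>e\<in>ends E. inv_into (ends E) h e"
  have cont: "continuous_map ?T ?T k'"
    if f: "f \<in> tree_aut E" and k: "induces E f k"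
      and inv: "\<And>e. e \<in> ends E \<Longrightarrow> k (k' e) = e" "\<And>e. e \<in> ends E \<Longrightarrow> k' (k e) = e"
      and k': "\<And>e. e \<in> ends E \<Longrightarrow> k' e \<in> ends E" for f k k'
  proof -
    have "openin ?T (k' -` shadow E a b \<inter> ends E)" if "E a b" for a b
    proof -
      have sub: "shadow E a b \<subseteq> ends E" by (auto simp: shadow_def end_of_in)
      have "k' -` shadow E a b \<inter> ends E = k ` shadow E a b"
      proof (intro subset_antisym subsetI)
        fix e assume "e \<in> k' -` shadow E a b \<inter> ends E"
        then show "e \<in> k ` shadow E a b" using inv(1)[of e] by (metis IntD1 IntD2 image_eqI vimageD)
      next
        fix e assume "e \<in> k ` shadow E a b"
        then obtain d where "d \<in> shadow E a b" "e = k d" by blast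
        then show "e \<in> k' -` shadow E a b \<inter> ends E"
          using inv(2)[of d] sub induces_in_ends[OF k, of d] by auto
      qed
      moreover have "openin ?T (shadow E (f a) (f b))"
        unfolding end_topology_def using f that
        by (intro topology_generated_by_Basis) (auto simp: tree_aut_def)
      ultimately show ?thesis using tree_aut_image_shadow[OF f k] by simp
    qed
    then have o: "openin ?T (k' -` U \<inter> topspace ?T)" if "U \<in> {shadow E a b | a b. E a b}" for U
      using that unfolding topspace_end_topology by force
    have "\<Union>{shadow E a b | a b. E a b} = ends E"
      using topspace_end_topology[of E]
      unfolding end_topology_def topology_generated_by_topspace .
    then have "k' ` topspace ?T \<subseteq> \<Union>{shadow E a b | a b. E a b}"
      unfolding topspace_end_topology using k' by (simp add: image_subset_iff)
    with o have "continuous_map ?T (topology_generated_by {shadow E a b | a b. E a b}) k'"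
      by (rule continuous_on_generated_topo)
    then show ?thesis by (simp only: end_topology_def)
  qed
  have b: "bij_betw h (ends E) (ends E)" using induces_tree_aut_bij[OF f h] .
  have i: "h (?g e) = e" "?g (h e) = e" "?g e \<in> ends E" "h e \<in> ends E" if e: "e \<in> ends E" for e
  proof -
    show he: "h e \<in> ends E" using induces_in_ends[OF h e] .
    show "h (?g e) = e" using bij_betw_inv_into_right[OF b e] e by simp
    show "?g (h e) = e" using bij_betw_inv_into_left[OF b e] he by simp
    show "?g e \<in> ends E" using bij_betwE[OF bij_betw_inv_into[OF b]] e by simp
  qed
  have "continuous_map ?T ?T ?g"
    by (rule cont[OF f h]) (fact i)+
  moreover have "continuous_map ?T ?T h"
    by (rule cont[OF tree_aut_inv[OF f] tree_aut_inv_induces[OF f h]]) (fact i)+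
  ultimately have "homeomorphic_maps ?T ?T h ?g"
    unfolding homeomorphic_maps_def topspace_end_topology using i by blast
  then show ?thesis by (metis homeomorphic_maps_map)
qed


subsection \<open>Existence and uniqueness\<close>

lemma finite_subtree_path:
  assumes "E\<^sup>*\<^sup>* a x"
  shows "\<exists>P. finite P \<and> a \<in> P \<and> x \<in> P \<and> (\<forall>y\<in>P. (\<lambda>u v. u \<in> P \<and> v \<in> P \<and> E u v)\<^sup>*\<^sup>* a y)"
  using assms
proof (induction rule: rtranclp_induct)
  case base
  show ?case by (rule exI[of _ "{a}"]) simp
next
  case (step y z)
  then obtain P where P: "finite P" "a \<in> P" "y \<in> P"
    "\<forall>y\<in>P. (\<lambda>u v. u \<in> P \<and> v \<in> P \<and> E u v)\<^sup>*\<^sup>* a y" by blast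
  let ?P = "insert z P"
  let ?R = "\<lambda>u v. u \<in> ?P \<and> v \<in> ?P \<and> E u v"
  have "(\<lambda>u v. u \<in> P \<and> v \<in> P \<and> E u v)\<^sup>*\<^sup>* \<le> ?R\<^sup>*\<^sup>*" by (rule rtranclp_mono) auto
  then have *: "?R\<^sup>*\<^sup>* a w" if "w \<in> P" for w using P(4) that by blast
  moreover have "?R\<^sup>*\<^sup>* a z"
    using *[OF P(3)] step(2) P(3) by (simp add: rtranclp.rtrancl_into_rtrancl)
  ultimately show ?case using P by (intro exI[of _ ?P]) auto
qed

lemma finite_subtree_hull:
  assumes t: "regular_tree n E" and S: "finite S"
  shows "\<exists>S'. finite_subtree E S' \<and> S \<subseteq> S'"
proof -
  define R where "R A = (\<lambda>u v. u \<in> A \<and> v \<in> A \<and> E u v)\<^sup>*\<^sup>*" for A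
  have R_mono: "R A x y \<Longrightarrow> R B x y" if "A \<subseteq> B" for A B x y
    unfolding R_def by (erule rtranclp_mono[THEN predicate2D, rotated]) (use that in auto)
  fix a :: 'a
  have "\<forall>x. \<exists>P. finite P \<and> a \<in> P \<and> x \<in> P \<and> (\<forall>y\<in>P. R P a y)"
    unfolding R_def
  proof
    fix x
    have "E\<^sup>*\<^sup>* a x" using t by (simp add: regular_tree_def)
    then show "\<exists>P. finite P \<and> a \<in> P \<and> x \<in> P \<and> (\<forall>y\<in>P. (\<lambda>u v. u \<in> P \<and> v \<in> P \<and> E u v)\<^sup>*\<^sup>* a y)"
      by (rule finite_subtree_path)
  qed
  from choice[OF this] obtain P where
    "\<forall>x. finite (P x) \<and> a \<in> P x \<and> x \<in> P x \<and> (\<forall>y\<in>P x. R (P x) a y)" ..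
  then have P: "finite (P x)" "a \<in> P x" "x \<in> P x" "\<forall>y\<in>P x. R (P x) a y" for x
    by blast+
  let ?S = "\<Union>x\<in>insert a S. P x"
  have to: "R ?S a y" if y: "y \<in> ?S" for y
  proof -
    obtain x where x: "x \<in> insert a S" "y \<in> P x" using y by blast
    then have "P x \<subseteq> ?S" by blast
    then show ?thesis using R_mono bspec[OF P(4) x(2)] by blast
  qed
  have "symp (\<lambda>u v. u \<in> ?S \<and> v \<in> ?S \<and> E u v)"
    using t unfolding regular_tree_def symp_def by blast
  then have "symp (R ?S)" unfolding R_def by (rule symp_rtranclp)
  moreover have "transp (R ?S)" unfolding R_def by (rule transp_rtranclp)
  ultimately have "R ?S x y" if "x \<in> ?S" "y \<in> ?S" for x y
    using to[OF that(1)] to[OF that(2)] by (meson sympD transpD)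
  moreover have "finite ?S" using P(1) S by blast
  moreover have "?S \<noteq> {}" using P(2) by blast
  ultimately have "finite_subtree E ?S"
    unfolding finite_subtree_def R_def by blast
  moreover have "S \<subseteq> ?S" using P(3) by blast
  ultimately show ?thesis by blast
qed

lemma almost_aut_conj:
  assumes t: "regular_tree n E" and \<theta>: "\<theta> \<in> almost_aut E" and S: "finite S"
  shows "\<exists>S'. finite S' \<and> (\<forall>k\<in>tree_aut E. (\<forall>v\<in>S'. k v = v) \<longrightarrow>
           inv_into UNIV \<theta> \<circ> k \<circ> \<theta> \<in> tree_aut E \<and> (\<forall>v\<in>S. (inv_into UNIV \<theta> \<circ> k \<circ> \<theta>) v = v))"
proof -
  let ?i = "inv_into UNIV \<theta>"
  define B where "B = {(a, b). E a b \<and> \<not> E (\<theta> a) (\<theta> b)}"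
  define B' where "B' = {(a, b). E a b \<and> \<not> E (?i a) (?i b)}"
  have fin: "finite B" "finite B'"
    using \<theta> almost_aut_inv[OF t \<theta>] by (auto simp: almost_aut_def B_def B'_def)
  have b: "bij \<theta>" using \<theta> by (simp add: almost_aut_def)
  have i: "?i (\<theta> x) = x" "\<theta> (?i x) = x" for x
    using b by (simp_all add: bij_is_inj bij_is_surj surj_f_inv_f)
  define Q where "Q = S \<union> fst ` B \<union> snd ` B \<union> ?i ` fst ` B' \<union> ?i ` snd ` B'"
  have step: "E (?i (k (\<theta> a))) (?i (k (\<theta> b)))"
    if k: "k \<in> tree_aut E" "\<forall>v\<in>\<theta> ` Q. k v = v" and ab: "E a b" for k a b
  proof (cases "a \<in> Q \<and> b \<in> Q")
    case True
    then show ?thesis using k ab i by simp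
  next
    case False
    have kinj: "k x = k y \<longleftrightarrow> x = y" for x y
      using k by (auto simp: tree_aut_def bij_def inj_eq)
    have bck: "x \<in> Q" if "?i (k (\<theta> x)) \<in> Q" for x
    proof -
      have "k (\<theta> x) \<in> \<theta> ` Q" using that i(2) by (metis imageI)
      then have "k (k (\<theta> x)) = k (\<theta> x)" using k by blast
      then have "\<theta> x \<in> \<theta> ` Q" using kinj \<open>k (\<theta> x) \<in> \<theta> ` Q\<close> by metis
      then show ?thesis using i(1) by (metis imageE)
    qed
    have "(a, b) \<notin> B"
    proof
      assume "(a, b) \<in> B"
      from imageI[OF this, of fst] imageI[OF this, of snd] show False using False by (simp add: Q_def)
    qed
    then have "E (k (\<theta> a)) (k (\<theta> b))" using ab k by (auto simp: B_def tree_aut_def)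
    moreover have "(k (\<theta> a), k (\<theta> b)) \<notin> B'"
    proof
      assume "(k (\<theta> a), k (\<theta> b)) \<in> B'"
      from imageI[OF this, of fst] imageI[OF this, of snd]
      have "?i (k (\<theta> a)) \<in> Q \<and> ?i (k (\<theta> b)) \<in> Q" by (simp add: Q_def)
      then show False using bck False by blast
    qed
    ultimately show ?thesis by (auto simp: B'_def)
  qed
  have "?i \<circ> k \<circ> \<theta> \<in> tree_aut E \<and> (\<forall>v\<in>S. (?i \<circ> k \<circ> \<theta>) v = v)"
    if k: "k \<in> tree_aut E" "\<forall>v\<in>\<theta> ` Q. k v = v" for k
  proof
    let ?k = "inv_into UNIV k"
    have bk: "bij k" using k by (simp add: tree_aut_def)
    have ik: "?k (k x) = x" for x using bk by (simp add: bij_is_inj)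
    have fix': "\<forall>v\<in>\<theta> ` Q. ?k v = v" using k(2) ik by metis
    have "E a b" if "E (?i (k (\<theta> a))) (?i (k (\<theta> b)))" for a b
      using step[OF tree_aut_inv[OF k(1)] fix' that] by (simp only: i ik)
    then have iff: "E ((?i \<circ> k \<circ> \<theta>) a) ((?i \<circ> k \<circ> \<theta>) b) \<longleftrightarrow> E a b" for a b
      using step[OF k, of a b] by (simp only: comp_apply) blast
    have "bij (?i \<circ> k \<circ> \<theta>)" using b bk by (intro bij_comp bij_imp_bij_inv)
    with iff show "?i \<circ> k \<circ> \<theta> \<in> tree_aut E" unfolding tree_aut_def by blast
    show "\<forall>v\<in>S. (?i \<circ> k \<circ> \<theta>) v = v" using k(2) i by (simp add: Q_def)
  qed
  moreover have "finite (\<theta> ` Q)" using fin S by (simp add: Q_def)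
  ultimately show ?thesis by blast
qed

lemma hier_subset_Bij: "hier E \<subseteq> Bij (ends E)"
proof
  fix h assume "h \<in> hier E"
  then have h: "homeomorphic_map (end_topology E) (end_topology E) h" and "h \<in> extensional (ends E)"
    by (auto simp: hier_def induces_def)
  moreover have "bij_betw h (ends E) (ends E)"
    using homeomorphic_imp_surjective_map[OF h] homeomorphic_imp_injective_map[OF h]
    by (simp add: bij_betw_def topspace_end_topology)
  ultimately show "h \<in> Bij (ends E)" by (simp add: Bij_def)
qed

lemma hier_inv_induces:
  assumes t: "regular_tree n E" and h: "h \<in> hier E" and \<theta>: "\<theta> \<in> almost_aut E" "induces E \<theta> h"
  shows "induces E (inv_into UNIV \<theta>) (\<lambda>e\<in>ends E. inv_into (ends E) h e)"
  unfolding induces_def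
proof (intro conjI allI impI)
  fix r assume r: "ray E r"
  let ?i = "inv_into UNIV \<theta>"
  obtain N where N: "ray E (\<lambda>k. ?i (r (N + k)))"
    using almost_aut_tail[OF almost_aut_inv[OF t \<theta>(1)] r] by blast
  have "\<theta> (?i x) = x" for x
    using \<theta> by (simp add: almost_aut_def bij_is_surj surj_f_inv_f)
  then have "h (end_of E (\<lambda>k. ?i (r (N + k)))) = end_of E (\<lambda>k. r (N + k))"
    using inducesD[OF \<theta>(2) N, of 0] ray_shift[OF r, of N] by simp
  then have "h (end_of E (\<lambda>k. ?i (r (N + k)))) = end_of E r" using end_of_shift[OF r] by simp
  moreover have "bij_betw h (ends E) (ends E)" using h hier_subset_Bij by (auto simp: Bij_def)
  ultimately have "inv_into (ends E) h (end_of E r) = end_of E (\<lambda>k. ?i (r (N + k)))"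
    using bij_betw_inv_into_left end_of_in[OF N] by fastforce
  then show "\<exists>N. ray E (\<lambda>k. ?i (r (N + k))) \<and>
       (\<lambda>e\<in>ends E. inv_into (ends E) h e) (end_of E r) = end_of E (\<lambda>k. ?i (r (N + k)))"
    using N end_of_in[OF r] by auto
qed simp

lemma subgroup_hier:
  assumes t: "regular_tree n E"
  shows "subgroup (hier E) (BijGroup (ends E))"
proof (rule subgroup.intro)
  let ?T = "end_topology E"
  show "hier E \<subseteq> carrier (BijGroup (ends E))" using hier_subset_Bij by (simp add: BijGroup_def)
  have "homeomorphic_map ?T ?T (\<lambda>e\<in>ends E. e)"
    by (rule homeomorphic_map_eq[OF homeomorphic_map_id[THEN iffD2, OF refl]])
       (simp add: topspace_end_topology)
  then show "\<one>\<^bsub>BijGroup (ends E)\<^esub> \<in> hier E"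
    using induces_id[of E] by (auto simp: BijGroup_def hier_def almost_aut_def intro!: bexI[of _ id])
  fix g assume g: "g \<in> hier E"
  then obtain \<eta> where \<eta>: "\<eta> \<in> almost_aut E" "induces E \<eta> g" by (auto simp: hier_def)
  have bg: "bij_betw g (ends E) (ends E)" using g hier_subset_Bij by (auto simp: Bij_def)
  obtain g' where g': "homeomorphic_maps ?T ?T g g'"
    using g by (auto simp: hier_def homeomorphic_map_maps)
  have "homeomorphic_map ?T ?T (\<lambda>e\<in>ends E. inv_into (ends E) g e)"
  proof (rule homeomorphic_map_eq)
    show "homeomorphic_map ?T ?T g'" using g' homeomorphic_maps_map homeomorphic_maps_sym by blast
    fix e assume "e \<in> topspace ?T"
    then have e: "e \<in> ends E" "g' e \<in> ends E" "g (g' e) = e"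
      using g' by (auto simp: homeomorphic_maps_def topspace_end_topology continuous_map_def)
    then show "g' e = (\<lambda>e\<in>ends E. inv_into (ends E) g e) e"
      using bij_betw_inv_into_left[OF bg e(2)] by simp
  qed
  then have "(\<lambda>e\<in>ends E. inv_into (ends E) g e) \<in> hier E"
    using hier_inv_induces[OF t g \<eta>] almost_aut_inv[OF t \<eta>(1)] by (auto simp: hier_def)
  then show "inv\<^bsub>BijGroup (ends E)\<^esub> g \<in> hier E"
    using inv_BijGroup[OF subsetD[OF hier_subset_Bij g]] by simp
  fix h assume h: "h \<in> hier E"
  then obtain \<theta> where \<theta>: "\<theta> \<in> almost_aut E" "induces E \<theta> h" by (auto simp: hier_def)
  have "homeomorphic_map ?T ?T (compose (ends E) g h)"
  proof (rule homeomorphic_map_eq)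
    show "homeomorphic_map ?T ?T (g \<circ> h)"
      using g h by (auto simp: hier_def intro: homeomorphic_map_compose)
  qed (simp add: topspace_end_topology compose_def)
  then have "compose (ends E) g h \<in> hier E"
    using induces_compose[OF \<eta>(2) \<theta>(2)] almost_aut_comp[OF \<eta>(1) \<theta>(1)] by (auto simp: hier_def)
  moreover have "g \<in> Bij (ends E)" "h \<in> Bij (ends E)" using g h hier_subset_Bij by blast+
  ultimately show "g \<otimes>\<^bsub>BijGroup (ends E)\<^esub> h \<in> hier E"
    by (simp add: BijGroup_def)
qed

lemma group_hier: "regular_tree n E \<Longrightarrow> group (hier_group E)"
  unfolding hier_group_def
  by (rule group.subgroup_imp_group[OF group_BijGroup subgroup_hier])

lemma mult_hier_group:
  "g \<in> hier E \<Longrightarrow> h \<in> hier E \<Longrightarrow> g \<otimes>\<^bsub>hier_group E\<^esub> h = compose (ends E) g h"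
  using hier_subset_Bij[of E] by (auto simp: hier_group_def BijGroup_def)

lemma one_hier_group: "\<one>\<^bsub>hier_group E\<^esub> = (\<lambda>e\<in>ends E. e)"
  by (simp add: hier_group_def BijGroup_def)

lemma carrier_hier_group: "carrier (hier_group E) = hier E"
  by (simp add: hier_group_def)

lemma inv_hier_group:
  assumes "regular_tree n E" and "g \<in> hier E"
  shows "inv\<^bsub>hier_group E\<^esub> g = (\<lambda>e\<in>ends E. inv_into (ends E) g e)"
  unfolding hier_group_def
  using group.m_inv_consistent[OF group_BijGroup subgroup_hier[OF assms(1)] assms(2)]
    inv_BijGroup[OF subsetD[OF hier_subset_Bij assms(2)]] by simp

lemma aut_fixing_subset_hier: "aut_fixing E S \<subseteq> hier E"
  using tree_aut_homeomorphic tree_aut_almost by (fastforce simp: aut_fixing_def hier_def)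

lemma subgroup_aut_fixing:
  assumes t: "regular_tree n E"
  shows "subgroup (aut_fixing E S) (hier_group E)"
proof (rule subgroup.intro)
  show sub: "aut_fixing E S \<subseteq> carrier (hier_group E)"
    by (simp add: aut_fixing_subset_hier carrier_hier_group)
  have "id \<in> tree_aut E" by (simp add: tree_aut_def)
  then show "\<one>\<^bsub>hier_group E\<^esub> \<in> aut_fixing E S"
    unfolding one_hier_group aut_fixing_def 
    using induces_id[of E] by (auto intro!: bexI[of _ id])
  fix g assume g: "g \<in> aut_fixing E S"
  then obtain p where p: "p \<in> tree_aut E" "\<forall>v\<in>S. p v = v" "induces E p g"
    by (auto simp: aut_fixing_def)
  have "inj p" using p by (simp add: tree_aut_def bij_def)
  then have "\<forall>v\<in>S. inv_into UNIV p v = v" using p(2) by (metis inv_f_f)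
  then have "(\<lambda>e\<in>ends E. inv_into (ends E) g e) \<in> aut_fixing E S"
    using tree_aut_inv[OF p(1)] tree_aut_inv_induces[OF p(1,3)] unfolding aut_fixing_def by blast
  moreover have "g \<in> hier E" using g aut_fixing_subset_hier by blast
  ultimately show "inv\<^bsub>hier_group E\<^esub> g \<in> aut_fixing E S"
    using inv_hier_group[OF t] by simp
  fix h assume h: "h \<in> aut_fixing E S"
  then obtain q where q: "q \<in> tree_aut E" "\<forall>v\<in>S. q v = v" "induces E q h"
    by (auto simp: aut_fixing_def)
  have "\<forall>v\<in>S. (p \<circ> q) v = v" using p q by simp
  then have "compose (ends E) g h \<in> aut_fixing E S"
    unfolding aut_fixing_def
    using tree_aut_comp[OF p(1) q(1)] induces_compose[OF p(3) q(3)] by blast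
  then show "g \<otimes>\<^bsub>hier_group E\<^esub> h \<in> aut_fixing E S"
    using mult_hier_group g h aut_fixing_subset_hier by (metis subsetD)
qed

lemma aut_fixing_conj:
  assumes t: "regular_tree n E" and g: "g \<in> hier E" and S: "finite_subtree E S"
  shows "\<exists>S'. finite_subtree E S' \<and>
    (\<forall>k\<in>aut_fixing E S'. inv\<^bsub>hier_group E\<^esub> g \<otimes>\<^bsub>hier_group E\<^esub> k \<otimes>\<^bsub>hier_group E\<^esub> g \<in> aut_fixing E S)"
proof -
  obtain \<theta> where \<theta>: "\<theta> \<in> almost_aut E" "induces E \<theta> g" using g by (auto simp: hier_def)
  let ?i = "inv_into UNIV \<theta>"
  have "finite S" using S by (simp add: finite_subtree_def)
  then obtain R where R: "finite R" "\<And>k. k \<in> tree_aut E \<Longrightarrow> \<forall>v\<in>R. k v = v \<Longrightarrow>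
      ?i \<circ> k \<circ> \<theta> \<in> tree_aut E \<and> (\<forall>v\<in>S. (?i \<circ> k \<circ> \<theta>) v = v)"
    using almost_aut_conj[OF t \<theta>(1)] by metis
  obtain S' where S': "finite_subtree E S'" "R \<subseteq> S'" using finite_subtree_hull[OF t R(1)] by blast
  have "inv\<^bsub>hier_group E\<^esub> g \<otimes>\<^bsub>hier_group E\<^esub> k \<otimes>\<^bsub>hier_group E\<^esub> g \<in> aut_fixing E S"
    if k: "k \<in> aut_fixing E S'" for k
  proof -
    interpret group "hier_group E" using group_hier[OF t] .
    let ?g = "\<lambda>e\<in>ends E. inv_into (ends E) g e"
    obtain p where p: "p \<in> tree_aut E" "\<forall>v\<in>S'. p v = v" "induces E p k"
      using k by (auto simp: aut_fixing_def)
    have kh: "k \<in> hier E" using k aut_fixing_subset_hier by blast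
    have ig: "inv\<^bsub>hier_group E\<^esub> g = ?g" using inv_hier_group[OF t g] .
    have gh: "?g \<in> hier E" using inv_closed[of g] g ig by (simp add: carrier_hier_group)
    have "?g \<otimes>\<^bsub>hier_group E\<^esub> k \<in> hier E"
      using m_closed[of ?g k] gh kh by (simp add: carrier_hier_group)
    then have eq: "?g \<otimes>\<^bsub>hier_group E\<^esub> k \<otimes>\<^bsub>hier_group E\<^esub> g
        = compose (ends E) (compose (ends E) ?g k) g"
      using mult_hier_group gh kh g by metis
    have "induces E (?i \<circ> p \<circ> \<theta>) (compose (ends E) (compose (ends E) ?g k) g)"
      by (intro induces_compose hier_inv_induces[OF t g] \<theta> p)
    then show ?thesis
      unfolding ig eq aut_fixing_def using R(2)[OF p(1)] p(2) S'(2) by blast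
  qed
  then show ?thesis using S' by blast
qed

lemma ex1_hier_topology:
  fixes E :: "'v \<Rightarrow> 'v \<Rightarrow> bool"
  assumes t: "regular_tree n E"
  shows "\<exists>!T. is_hier_topology E T"
proof -
  interpret group "hier_group E" using group_hier[OF t] .
  define F where "F = {aut_fixing E S |S. finite_subtree E S}"
  have "finite_subtree E {v}" for v by (simp add: finite_subtree_def)
  then have ne: "F \<noteq> {}" by (auto simp: F_def)
  have sg: "\<forall>H\<in>F. subgroup H (hier_group E)" using subgroup_aut_fixing[OF t] by (auto simp: F_def)
  have dir: "\<forall>H\<in>F. \<forall>K\<in>F. \<exists>L\<in>F. L \<subseteq> H \<inter> K"
  proof (intro ballI)
    fix H K assume "H \<in> F" "K \<in> F"
    then obtain S1 S2 where S: "finite_subtree E S1" "finite_subtree E S2"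
      "H = aut_fixing E S1" "K = aut_fixing E S2" by (auto simp: F_def)
    then obtain S where "finite_subtree E S" "S1 \<union> S2 \<subseteq> S"
      using finite_subtree_hull[OF t, of "S1 \<union> S2"] by (auto simp: finite_subtree_def)
    moreover from this have "aut_fixing E S \<subseteq> H \<inter> K" unfolding S aut_fixing_def by blast
    ultimately show "\<exists>L\<in>F. L \<subseteq> H \<inter> K" by (auto simp: F_def)
  qed
  have aut: "aut E = aut_fixing E {}" by (simp add: aut_def aut_fixing_def)
  have A: "subgroup (aut E) (hier_group E)" unfolding aut by (rule subgroup_aut_fixing[OF t])
  have sub: "H \<subseteq> aut E" if "H \<in> F" for H using that by (auto simp: F_def aut_fixing_def aut_def)
  have conj: "\<exists>K\<in>F. \<forall>k\<in>K. inv\<^bsub>hier_group E\<^esub> g \<otimes>\<^bsub>hier_group E\<^esub> k \<otimes>\<^bsub>hier_group E\<^esub> g \<in> H"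
    if gH: "g \<in> carrier (hier_group E)" "H \<in> F" for g H
  proof -
    obtain S where "finite_subtree E S" "H = aut_fixing E S" using gH(2) by (auto simp: F_def)
    then show ?thesis
      using aut_fixing_conj[OF t, of g S] gH(1) unfolding F_def carrier_hier_group by blast
  qed
  let ?T = "coset_topology F"
  have "{g <#\<^bsub>hier_group E\<^esub> H |g H. g \<in> aut E \<and> H \<in> F}
      = {g <#\<^bsub>hier_group E\<^esub> aut_fixing E S |g S. g \<in> aut E \<and> finite_subtree E S}"
    by (auto simp: F_def)
  then have "is_hier_topology E ?T"
    unfolding is_hier_topology_def aut_topology_def
    using topological_group_coset_topology[OF ne dir sg conj]
      subtopology_coset_topology[OF dir sg ne A sub] by simp
  moreover have "T1 = T2" if "is_hier_topology E T1" "is_hier_topology E T2" for T1 T2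
    using that topological_group_eqI[of T1 "aut E" T2] subgroup.one_closed[OF A]
    by (simp add: is_hier_topology_def)
  ultimately show ?thesis by blast
qed

corollary is_hier_topology_hier_topology:
  "regular_tree n E \<Longrightarrow> is_hier_topology E (hier_topology E)"
  unfolding hier_topology_def by (rule theI') (rule ex1_hier_topology)

end

theory Submission
  imports Defs
begin

text \<open>
  Write \<open>G\<close> for the hierarchomorphism group, \<open>K\<close> for the automorphism group of the tree and \<open>P\<close> for
  the orthogonal projection onto the \<open>K\<close>-invariant vectors of a unitary representation \<open>\<pi>\<close> of \<open>G\<close>.
  The theorem comes from the commutativity of the operators \<open>P \<pi>(g) P\<close>, \<open>g \<in> G\<close>. If \<open>\<pi>\<close> is
  irreducible, these operators preserve no closed subspace of the space of invariants other than
  \<open>{0}\<close> and the whole space. They form a commuting family that is closed under adjoints, so by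
  Schur's lemma they act on the invariants as scalars, and the invariants have dimension at most
  one. This implication is \<open>spherical_criterion\<close>.

  The group \<open>K\<close> is not compact, so \<open>P\<close> is not an average over \<open>K\<close>. It is a limit of averages
  nevertheless. Let \<open>s \<in> K\<close> move a vertex \<open>a\<close> to a neighbour \<open>b\<close> and \<open>b\<close> to a neighbour \<open>c \<noteq> a\<close>.
  Then \<open>s\<close> is a translation by one along an infinite line. A vector fixed by \<open>\<pi>(s)\<close> is \<open>K\<close>-invariant:
  if \<open>u \<in> K\<close> fixes a half-tree on the attracting side, then the conjugates of \<open>u\<close> by the powers of \<open>s\<close>
  tend to the identity, hence \<open>\<pi>(u)\<close> fixes the vector too (the Mautner phenomenon), and such \<open>u\<close>, for
  both directions of the line, together with \<open>s\<close> generate \<open>K\<close>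
  (\<open>translation_invariant_imp_aut_invariant\<close>). By von Neumann's mean ergodic theorem the Cesaro means
  of \<open>\<pi>(s\<^sup>L)\<close> and those of \<open>\<pi>(s\<^sup>-\<^sup>L)\<close> converge strongly to \<open>P\<close>.

  So it is enough to compare \<open>g s\<^sup>-\<^sup>L h\<close> with \<open>h s\<^sup>L g\<close>. Outside a finite subtree a
  hierarchomorphism looks like an isomorphism of half-trees, and an isomorphism between half-trees
  extends to an automorphism of the tree. Hence \<open>g\<close> may be multiplied by elements of \<open>K\<close> on both
  sides so that it becomes the identity on the ends behind any prescribed edge. Let \<open>g\<close> be the
  identity on the ends behind \<open>b a\<close>, and \<open>h\<close> on the ends behind \<open>a b\<close>. The translation \<open>s\<close> maps the
  latter set into itself, so \<open>s\<^sup>-\<^sup>L h s\<^sup>L\<close> is the identity there as well and commutes with \<open>g\<close>: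
  \<open>g s\<^sup>-\<^sup>L h s\<^sup>L = s\<^sup>-\<^sup>L h s\<^sup>L g\<close> for all \<open>L\<close> (\<open>hier_disjoint_supports\<close>). Between \<open>K\<close>-invariant vectors
  the outer powers of \<open>s\<close> disappear, and averaging over \<open>L\<close> gives
  \<open>P \<pi>(g) P \<pi>(h) P = P \<pi>(h) P \<pi>(g) P\<close>.
\<close>

section \<open>Orthogonal projections and the mean ergodic theorem\<close>

instance chilbert_space \<subseteq> banach ..

text \<open>
  A minimizing sequence for the distance to \<open>W\<close> is Cauchy by the parallelogram law, and its limit is
  the foot of the perpendicular.
\<close>

lemma ex_orthogonal_projection:
  fixes W :: "'a::{real_inner,banach} set"
  assumes W: "subspace W" "closed W"
  shows "\<exists>p\<in>W. \<forall>w\<in>W. inner (x - p) w = 0"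
proof -
  define D where "D = (\<lambda>w. (norm (x - w))\<^sup>2) ` W"
  have bdd: "bdd_below D" unfolding D_def by (rule bdd_belowI[of _ 0]) auto
  have ne: "D \<noteq> {}" using subspace_0[OF W(1)] by (auto simp: D_def)
  have lower: "Inf D \<le> (norm (x - w))\<^sup>2" if "w \<in> W" for w
    using that bdd by (intro cInf_lower) (auto simp: D_def)
  have "\<exists>w\<in>W. (norm (x - w))\<^sup>2 < Inf D + 1 / real (Suc k)" for k
    using cInf_lessD[OF ne, of "Inf D + 1 / real (Suc k)"] by (auto simp: D_def)
  then obtain q where q: "\<And>k. q k \<in> W" "\<And>k. (norm (x - q k))\<^sup>2 < Inf D + 1 / real (Suc k)"
    by metis
  have par: "(norm (q i - q j))\<^sup>2 \<le> 2 / real (Suc i) + 2 / real (Suc j)" for i j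
  proof -
    let ?m = "(1/2) *\<^sub>R (q i + q j)"
    have "?m \<in> W" using q(1) W(1) by (intro subspace_scale subspace_add)
    then have "Inf D \<le> (norm (x - ?m))\<^sup>2" by (rule lower)
    moreover have "(norm (q i - q j))\<^sup>2 + 4 * (norm (x - ?m))\<^sup>2
        = 2 * (norm (x - q i))\<^sup>2 + 2 * (norm (x - q j))\<^sup>2"
      by (simp add: power2_norm_eq_inner inner_diff inner_add inner_commute algebra_simps)
    moreover have "2 / real (Suc k) = 2 * (1 / real (Suc k))" for k by simp
    ultimately show ?thesis using q(2)[of i] q(2)[of j] by linarith
  qed
  have "Cauchy q"
    unfolding Cauchy_altdef
  proof (intro allI impI)
    fix e :: real assume e: "e > 0"
    obtain M where M: "1 / real (Suc M) < e\<^sup>2 / 4"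
      using reals_Archimedean[of "e\<^sup>2 / 4"] e by (auto simp: inverse_eq_divide)
    show "\<exists>M. \<forall>m\<ge>M. \<forall>k>m. dist (q m) (q k) < e"
    proof (intro exI allI impI)
      fix m k assume mk: "m \<ge> M" "k > m"
      have "1 / real (Suc m) \<le> 1 / real (Suc M)" "1 / real (Suc k) \<le> 1 / real (Suc M)"
        using mk by (auto simp: frac_le)
      then have "(norm (q m - q k))\<^sup>2 < e\<^sup>2" using par[of m k] M by simp
      then show "dist (q m) (q k) < e" using e by (simp add: dist_norm power2_less_imp_less)
    qed
  qed
  then obtain p where p: "q \<longlonglongrightarrow> p" using Cauchy_convergent convergent_def by blast
  have pW: "p \<in> W" using closed_sequentially[OF W(2) q(1) p] .
  have bound: "(\<lambda>k. Inf D + 1 / real (Suc k)) \<longlonglongrightarrow> Inf D + 0"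
    by (intro tendsto_intros LIMSEQ_Suc lim_1_over_n)
  have "(\<lambda>k. (norm (x - q k))\<^sup>2) \<longlonglongrightarrow> (norm (x - p))\<^sup>2" by (intro tendsto_intros p)
  then have "(norm (x - p))\<^sup>2 \<le> Inf D + 0"
    by (rule LIMSEQ_le[OF _ bound]) (use q(2) in \<open>blast intro: less_imp_le\<close>)
  then have min: "(norm (x - p))\<^sup>2 \<le> Inf D" by simp
  have expand: "(norm (u - t *\<^sub>R w))\<^sup>2 = (norm u)\<^sup>2 - 2 * t * inner u w + t * t * (norm w)\<^sup>2"
    for u w :: 'a and t
    by (simp add: power2_norm_eq_inner inner_diff_left inner_diff_right inner_commute[of w u]
        algebra_simps)
  have "inner (x - p) w = 0" if w: "w \<in> W" for w
  proof (cases "w = 0")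
    case False
    let ?t = "inner (x - p) w / (norm w)\<^sup>2"
    have "p + ?t *\<^sub>R w \<in> W" using pW w W(1) by (intro subspace_add subspace_scale)
    then have "(norm (x - p))\<^sup>2 \<le> (norm (x - p - ?t *\<^sub>R w))\<^sup>2"
      using lower min by (metis diff_diff_eq order_trans)
    also have "\<dots> = (norm (x - p))\<^sup>2 - 2 * ?t * inner (x - p) w + ?t * ?t * (norm w)\<^sup>2"
      by (rule expand)
    also have "\<dots> = (norm (x - p))\<^sup>2 - (inner (x - p) w)\<^sup>2 / (norm w)\<^sup>2"
      using False by (simp add: field_simps power2_eq_square)
    finally have "(inner (x - p) w)\<^sup>2 / (norm w)\<^sup>2 \<le> 0" by simp
    then show ?thesis using False by (simp add: divide_le_0_iff)
  qed simp
  then show ?thesis using pW by blast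
qed

lemma subspace_closure:
  fixes S :: "'a::real_normed_vector set"
  assumes "subspace S" shows "subspace (closure S)"
  unfolding subspace_def
proof (intro conjI ballI allI)
  show "0 \<in> closure S" using subspace_0[OF assms] closure_subset by blast
  fix x y c assume "x \<in> closure S" "y \<in> closure S"
  then obtain f g where fg: "\<And>k. f k \<in> S" "f \<longlonglongrightarrow> x" "\<And>k. g k \<in> S" "g \<longlonglongrightarrow> y"
    unfolding closure_sequential by blast
  have "(\<lambda>k. f k + g k) \<longlonglongrightarrow> x + y" by (intro tendsto_intros fg)
  then show "x + y \<in> closure S"
    unfolding closure_sequential using subspace_add[OF assms fg(1,3)]
    by (intro exI[of _ "\<lambda>k. f k + g k"]) auto
  have "(\<lambda>k. c *\<^sub>R f k) \<longlonglongrightarrow> c *\<^sub>R x" by (intro tendsto_intros fg)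
  then show "c *\<^sub>R x \<in> closure S"
    unfolding closure_sequential using subspace_scale[OF assms fg(1)]
    by (intro exI[of _ "\<lambda>k. c *\<^sub>R f k"]) auto
qed

lemma linear_funpow: "linear f \<Longrightarrow> linear (f ^^ k)"
  for f :: "'a::real_vector \<Rightarrow> 'a"
proof (induction k)
  case (Suc k)
  then show ?case using linear_compose[of "f ^^ k" f] by (simp add: o_def)
qed (simp add: linear_id[unfolded id_def] id_def)

text \<open>
  The hypotheses on \<open>p\<close> say that \<open>p\<close> is the projection of \<open>x\<close> onto the fixed vectors of \<open>U\<close>. For an
  isometry the fixed vectors are the orthogonal complement of the vectors \<open>U y - y\<close>, and the means of
  the latter tend to \<open>0\<close> because the sum telescopes.
\<close>

lemma mean_ergodic:
  fixes U :: "'a::{real_inner,banach} \<Rightarrow> 'a"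
  assumes lin: "linear U" and iso: "\<And>x y. inner (U x) (U y) = inner x y"
    and p: "U p = p" "\<And>w. U w = w \<Longrightarrow> inner (x - p) w = 0"
  shows "(\<lambda>N. (1 / real N) *\<^sub>R (\<Sum>L<N. (U ^^ L) x)) \<longlonglongrightarrow> p"
proof -
  interpret U: linear U by fact
  \<comment> \<open>\<open>x\<close> splits into its projection \<open>r\<close> onto the closure of this range and a vector fixed by \<open>U\<close>.\<close>
  let ?R = "range (\<lambda>y. U y - y)"
  have "linear (\<lambda>y. U y - y)" by (intro linear_compose_sub lin linear_id[unfolded id_def])
  then have sub: "subspace (closure ?R)"
    by (intro subspace_closure linear_subspace_image subspace_UNIV)
  obtain r where r: "r \<in> closure ?R" and orth: "\<And>w. w \<in> closure ?R \<Longrightarrow> inner (x - r) w = 0"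
    using ex_orthogonal_projection[OF sub closed_closure] by blast
  have norm_U: "norm (U y) = norm y" for y using iso by (simp add: norm_eq_sqrt_inner)
  have "inner (x - r) (U (x - r) - (x - r)) = 0"
    by (intro orth subsetD[OF closure_subset] rangeI)
  then have eq: "inner (x - r) (U (x - r)) = inner (x - r) (x - r)" by (simp only: inner_diff_right[of "x - r"] right_minus_eq)
  have "(norm (U s - s))\<^sup>2 = 2 * inner s s - 2 * inner s (U s)" for s
    by (simp add: power2_norm_eq_inner inner_diff_left inner_diff_right iso inner_commute)
  then have "(norm (U (x - r) - (x - r)))\<^sup>2 = 0" using eq by simp
  then have fixed: "U (x - r) = x - r" by simp
  have r_fix: "inner r w = 0" if w: "U w = w" for w
  proof -
    have "inner (U y - y) w = 0" for y using iso[of y w] w by (simp add: inner_diff_left)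
    then have "?R \<subseteq> {y. inner y w = 0}" by blast
    moreover have "closed {y. inner y w = 0}" by (intro closed_Collect_eq continuous_intros)
    ultimately have "closure ?R \<subseteq> {y. inner y w = 0}" by (rule closure_minimal)
    then show ?thesis using r by blast
  qed
  \<comment> \<open>The two orthogonal decompositions of \<open>x\<close> agree.\<close>
  have "U (x - r - p) = x - r - p" using fixed p(1) by (simp add: U.diff)
  then have "inner (x - p) (x - r - p) = 0" "inner r (x - r - p) = 0" using p(2) r_fix by blast+
  then have "inner (x - r - p) (x - r - p) = 0"
    by (simp add: inner_diff_left inner_diff_right)
  then have pr: "p = x - r" by simp
  define A where "A N y = (1 / real N) *\<^sub>R (\<Sum>L<N. (U ^^ L) y)" for N y
  note linp = linear_funpow[OF lin]
  have norm_pow: "norm ((U ^^ L) y) = norm y" for L y by (induction L) (simp_all add: norm_U)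
  have A_diff: "A N (y - z) = A N y - A N z" for N y z
    by (simp add: A_def linear_diff[OF linp] sum_subtractf scaleR_diff_right)
  have A_norm: "norm (A N y) \<le> norm y" for N y
  proof -
    have "norm (\<Sum>L<N. (U ^^ L) y) \<le> real N * norm y"
      using norm_sum[of "\<lambda>L. (U ^^ L) y" "{..<N}"] by (simp add: norm_pow)
    then show ?thesis by (cases "N = 0") (simp_all add: A_def field_simps)
  qed
  have A_fix: "A N p = p" if "N > 0" for N
  proof -
    have "(U ^^ L) p = p" for L by (induction L) (simp_all add: p(1))
    then show ?thesis using that by (simp add: A_def sum_constant_scaleR del: sum_constant)
  qed
  have tel: "(\<Sum>L<N. (U ^^ L) (U y - y)) = (U ^^ N) y - y" for N y
    by (induction N) (simp_all add: linear_diff[OF linp] funpow_swap1)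
  have A_r: "(\<lambda>N. A N r) \<longlonglongrightarrow> 0"
  proof (rule LIMSEQ_I)
    fix e :: real assume "e > 0"
    then obtain y where y: "dist (U y - y) r < e / 2"
      using r unfolding closure_approachable by (auto dest!: spec[of _ "e / 2"])
    obtain M where M: "real M > 4 * norm y / e" using reals_Archimedean2 by blast
    have "norm (A N r - 0) < e" if N: "N \<ge> Suc M" for N
    proof -
      have "A N r = A N (U y - y) + A N (r - (U y - y))" using A_diff[of N r "U y - y"] by simp
      then have "norm (A N r) \<le> norm (A N (U y - y)) + norm (A N (r - (U y - y)))"
        by (metis norm_triangle_ineq)
      moreover have "norm (A N (r - (U y - y))) < e / 2"
        using A_norm[of N "r - (U y - y)"] y by (simp add: dist_norm norm_minus_commute)
      moreover have "norm (A N (U y - y)) \<le> 2 * norm y / real N"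
        using norm_triangle_ineq4[of "(U ^^ N) y" y] N
        by (simp add: A_def tel norm_pow divide_right_mono)
      moreover have "2 * norm y / real N < e / 2"
      proof -
        have "4 * norm y / e < real N" using M N by linarith
        then show ?thesis using \<open>e > 0\<close> N by (simp add: field_simps)
      qed
      ultimately show ?thesis by simp
    qed
    then show "\<exists>M. \<forall>N\<ge>M. norm (A N r - 0) < e" by blast
  qed
  have "(\<lambda>N. A N r + p) \<longlonglongrightarrow> 0 + p" by (intro tendsto_intros A_r)
  moreover have "eventually (\<lambda>N. A N r + p = A N x) sequentially"
    using eventually_gt_at_top[of 0]
  proof eventually_elim
    case (elim N)
    have "r = x - p" using pr by simp
    then have "A N r = A N x - p" using A_diff[of N x p] A_fix[OF elim] by simp
    then show ?case by simp
  qed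
  ultimately have "(\<lambda>N. A N x) \<longlonglongrightarrow> 0 + p" by (rule Lim_transform_eventually)
  then show ?thesis by (simp add: A_def)
qed

section \<open>Square roots by power series\<close>

text \<open>
  The Taylor coefficients of \<open>\<surd>(1 - z)\<close> at \<open>0\<close>.
\<close>

definition sqrt_coeff :: "nat \<Rightarrow> real" where
  "sqrt_coeff k = ((1/2) gchoose k) * (-1) ^ k"

lemma sqrt_coeff_0: "sqrt_coeff 0 = 1"
  by (simp add: sqrt_coeff_def)

lemma sqrt_coeff_Suc: "sqrt_coeff (Suc k) = sqrt_coeff k * ((real k - 1/2) / (real k + 1))"
proof -
  have "((1/2) gchoose Suc k) = ((1/2::real) gchoose k) * ((1/2 - real k) / (real k + 1))"
    using gbinomial_mult_1[of "1/2::real" k] by (simp add: field_simps)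
  moreover have "(1/2 - real k) / (real k + 1) = - ((real k - 1/2) / (real k + 1))"
    by (metis minus_diff_eq minus_divide_left)
  ultimately show ?thesis unfolding sqrt_coeff_def power_Suc by simp
qed

lemma sqrt_coeff_neg: "sqrt_coeff (Suc k) \<le> 0"
proof (induction k)
  case 0
  then show ?case using sqrt_coeff_Suc[of 0] by (simp add: sqrt_coeff_0)
next
  case (Suc k)
  then show ?case
    by (subst sqrt_coeff_Suc) (intro mult_nonpos_nonneg, auto)
qed

text \<open>
  The partial sums at \<open>z = 1\<close> are, up to sign, the binomial coefficients of \<open>-1/2\<close>. As all
  coefficients except the first are at most \<open>0\<close>, this bound also gives absolute convergence at \<open>z = 1\<close>.
\<close>

lemma sum_sqrt_coeff_nonneg: "(\<Sum>k\<le>N. sqrt_coeff k) \<ge> 0"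
proof -
  have "(-1) ^ N * ((1/2 - 1 :: real) gchoose N) \<ge> 0"
  proof (induction N)
    case (Suc N)
    have "((1/2 - 1) gchoose Suc N) = ((1/2 - 1 ::real) gchoose N) * (- ((real N + 1/2) / (real N + 1)))"
      using gbinomial_mult_1[of "1/2 - 1 ::real" N] by (simp add: field_simps)
    then have "(-1) ^ Suc N * ((1/2 - 1 ::real) gchoose Suc N)
       = ((-1) ^ N * ((1/2 - 1 ::real) gchoose N)) * ((real N + 1/2) / (real N + 1))"
      by simp
    also have "\<dots> \<ge> 0" by (rule mult_nonneg_nonneg[OF Suc]) simp
    finally show ?case .
  qed simp
  then show ?thesis unfolding sqrt_coeff_def gbinomial_sum_lower_neg .
qed

lemma summable_abs_sqrt_coeff: "summable (\<lambda>k. \<bar>sqrt_coeff k\<bar>)"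
proof (rule summableI_nonneg_bounded)
  have eq: "\<bar>sqrt_coeff (Suc k)\<bar> = - sqrt_coeff (Suc k)" for k using sqrt_coeff_neg[of k] by simp
  have "(\<Sum>k<Suc N. \<bar>sqrt_coeff k\<bar>) = 2 - (\<Sum>k\<le>N. sqrt_coeff k)" for N
    by (induction N) (simp_all add: eq sqrt_coeff_0)
  then have *: "(\<Sum>k<Suc N. \<bar>sqrt_coeff k\<bar>) \<le> 2" for N using sum_sqrt_coeff_nonneg[of N] by simp
  show "(\<Sum>k<N. \<bar>sqrt_coeff k\<bar>) \<le> 2" for N
    by (cases N) (use * in auto)
qed simp

lemma suminf_sqrt_coeff_nonneg: "(\<Sum>k. sqrt_coeff k) \<ge> 0"
proof -
  have "summable sqrt_coeff" using summable_abs_sqrt_coeff by (rule summable_rabs_cancel)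
  then have "(\<lambda>N. \<Sum>k\<le>N. sqrt_coeff k) \<longlonglongrightarrow> (\<Sum>k. sqrt_coeff k)" by (rule summable_LIMSEQ')
  then show ?thesis by (rule LIMSEQ_le_const) (use sum_sqrt_coeff_nonneg in blast)
qed

text \<open>
  The coefficients of the square of the series are those of \<open>1 - z\<close>, by Vandermonde's identity.
\<close>

lemma sqrt_coeff_convolution:
  "(\<Sum>i\<le>k. sqrt_coeff i * sqrt_coeff (k - i)) = (if k = 0 then 1 else if k = 1 then -1 else 0)"
proof -
  have "(\<Sum>i\<le>k. sqrt_coeff i * sqrt_coeff (k - i))
      = (\<Sum>i\<le>k. ((1/2) gchoose i) * ((1/2) gchoose (k - i)) * (-1) ^ k)"
  proof (rule sum.cong)
    fix i assume "i \<in> {..k}"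
    then have "(-1 :: real) ^ i * (-1) ^ (k - i) = (-1) ^ k" by (simp flip: power_add)
    moreover have "sqrt_coeff i * sqrt_coeff (k - i)
        = ((1/2) gchoose i) * ((1/2) gchoose (k - i)) * ((-1) ^ i * (-1) ^ (k - i))"
      by (simp only: sqrt_coeff_def mult_ac)
    ultimately show "sqrt_coeff i * sqrt_coeff (k - i) = ((1/2) gchoose i) * ((1/2) gchoose (k - i)) * (-1) ^ k"
      by simp
  qed simp
  also have "\<dots> = ((1/2 + 1/2) gchoose k) * (-1) ^ k"
    using gbinomial_Vandermonde[of "1/2::real" "1/2" k]
    by (simp flip: sum_distrib_right add: atMost_atLeast0)
  also have "\<dots> = real (1 choose k) * (-1) ^ k" using binomial_gbinomial[of 1 k, where ?'a = real] by simp
  also have "\<dots> = (if k = 0 then 1 else if k = 1 then -1 else 0)"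
    by (simp add: binomial_eq_0)
  finally show ?thesis .
qed

text \<open>
  A power series in \<open>T\<close> provides a positive square root of \<open>1 - T\<close> without any spectral theory. Being
  a limit of polynomials in \<open>T\<close>, it inherits the commutation relations and the closed invariant
  subspaces of \<open>T\<close>.
\<close>

lemma ex_sqrt_one_minus:
  fixes T :: "'a::{real_inner,banach} \<Rightarrow> 'a"
  assumes T: "linear T" and contr: "\<And>x. norm (T x) \<le> norm x"
  shows "\<exists>B. bounded_linear B \<and> (\<forall>x. B (B x) = x - T x) \<and> (\<forall>x. inner (B x) x \<ge> 0) \<and>
    (\<forall>m. bounded_linear m \<longrightarrow> (\<forall>x. m (T x) = T (m x)) \<longrightarrow> (\<forall>x. m (B x) = B (m x))) \<and>
    (\<forall>W. subspace W \<longrightarrow> closed W \<longrightarrow> T ` W \<subseteq> W \<longrightarrow> B ` W \<subseteq> W)"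
proof -
  let ?c = sqrt_coeff
  note lin = linear_funpow[OF T]
  have norm_pow: "norm ((T ^^ k) x) \<le> norm x" for k x
    by (induction k) (auto intro: order_trans[OF contr])
  have abs: "summable (\<lambda>k. norm (?c k *\<^sub>R (T ^^ k) x))" for x
  proof (rule summable_comparison_test')
    show "summable (\<lambda>k. \<bar>?c k\<bar> * norm x)" by (rule summable_mult2[OF summable_abs_sqrt_coeff])
    show "norm (norm (?c k *\<^sub>R (T ^^ k) x)) \<le> \<bar>?c k\<bar> * norm x" if "k \<ge> 0" for k
      using norm_pow by (simp add: mult_left_mono)
  qed
  have sm: "summable (\<lambda>k. ?c k *\<^sub>R (T ^^ k) x)" for x using abs by (rule summable_norm_cancel)
  define B where "B x = (\<Sum>k. ?c k *\<^sub>R (T ^^ k) x)" for x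
  have bl: "bounded_linear B"
  proof (rule bounded_linear_intro)
    show "B (x + y) = B x + B y" for x y
      unfolding B_def suminf_add[OF sm sm] by (simp add: linear_add[OF lin] scaleR_add_right)
    show "B (r *\<^sub>R x) = r *\<^sub>R B x" for r x
      using bounded_linear.suminf[OF bounded_linear_scaleR_right sm, of r x]
      by (simp add: B_def linear_cmul[OF lin] mult.commute)
    show "norm (B x) \<le> norm x * (\<Sum>k. \<bar>?c k\<bar>)" for x
    proof -
      have "norm (B x) \<le> (\<Sum>k. norm (?c k *\<^sub>R (T ^^ k) x))" unfolding B_def by (rule summable_norm[OF abs])
      also have "\<dots> \<le> (\<Sum>k. \<bar>?c k\<bar> * norm x)"
        by (rule suminf_le[OF _ abs summable_mult2[OF summable_abs_sqrt_coeff]])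
           (simp add: mult_left_mono norm_pow)
      also have "\<dots> = norm x * (\<Sum>k. \<bar>?c k\<bar>)"
        using suminf_mult2[OF summable_abs_sqrt_coeff, of "norm x"] by (simp add: mult.commute)
      finally show ?thesis .
    qed
  qed
  interpret B: bounded_linear B by fact
  have comm: "m (B x) = B (m x)" if m: "bounded_linear m" "\<And>x. m (T x) = T (m x)" for m x
  proof -
    interpret m: bounded_linear m by fact
    have "m ((T ^^ k) x) = (T ^^ k) (m x)" for k by (induction k) (simp_all add: m(2))
    then show ?thesis unfolding B_def by (simp add: m.suminf[OF sm] m.scaleR)
  qed
  have inv: "B x \<in> W" if W: "subspace W" "closed W" "T ` W \<subseteq> W" and x: "x \<in> W" for W x
  proof -
    have "(T ^^ k) x \<in> W" for k using W(3) x by (induction k) auto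
    then have "(\<Sum>k<N. ?c k *\<^sub>R (T ^^ k) x) \<in> W" for N
      by (intro subspace_sum[OF W(1)] subspace_scale[OF W(1)])
    from closed_sequentially[OF W(2) this summable_LIMSEQ[OF sm]] show ?thesis by (simp add: B_def)
  qed
  have pos: "inner (B x) x \<ge> 0" for x
  proof -
    have "0 \<le> (\<Sum>k. ?c k) * (norm x)\<^sup>2" using suminf_sqrt_coeff_nonneg by simp
    also have "\<dots> = (\<Sum>k. ?c k * (norm x)\<^sup>2)"
      by (rule suminf_mult2[OF summable_rabs_cancel[OF summable_abs_sqrt_coeff]])
    also have "\<dots> \<le> (\<Sum>k. inner (?c k *\<^sub>R (T ^^ k) x) x)"
    proof (rule suminf_le)
      fix k
      have "inner ((T ^^ k) x) x \<le> norm x * norm x"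
        using norm_cauchy_schwarz[of "(T ^^ k) x" x] mult_right_mono[OF norm_pow[of k x], of "norm x"] by simp
      then show "?c k * (norm x)\<^sup>2 \<le> inner (?c k *\<^sub>R (T ^^ k) x) x"
        by (cases k) (use sqrt_coeff_neg in \<open>auto simp: sqrt_coeff_0 power2_norm_eq_inner
              power2_eq_square norm_eq_sqrt_inner intro!: mult_left_mono_neg\<close>)
    qed (intro summable_mult2 summable_rabs_cancel[OF summable_abs_sqrt_coeff]
          bounded_linear.summable[OF bounded_linear_inner_left sm])+
    also have "\<dots> = inner (B x) x"
      unfolding B_def by (rule bounded_linear.suminf[OF bounded_linear_inner_left sm, symmetric])
    finally show ?thesis .
  qed
  have square: "B (B x) = x - T x" for x
  proof -
    \<comment> \<open>The double series for \<open>B (B x)\<close> converges absolutely and is summed along the diagonals \<open>i + j = k\<close>.\<close>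
    let ?f = "\<lambda>i j. (?c i * ?c j) *\<^sub>R (T ^^ (i + j)) x"
    have "(\<lambda>(i, j). norm (?f i j)) summable_on UNIV \<times> UNIV"
    proof (rule summable_on_comparison_test)
      have s: "(\<lambda>k. \<bar>?c k\<bar>) summable_on UNIV"
        using summable_abs_sqrt_coeff by (intro norm_summable_imp_summable_on) simp
      show "(\<lambda>(i, j). \<bar>?c i\<bar> * \<bar>?c j\<bar> * norm x) summable_on UNIV \<times> UNIV"
      proof (rule summable_on_SigmaI)
        fix i
        show "((\<lambda>j. case (i, j) of (i, j) \<Rightarrow> \<bar>?c i\<bar> * \<bar>?c j\<bar> * norm x) has_sum
            \<bar>?c i\<bar> * (\<Sum>\<^sub>\<infinity>j. \<bar>?c j\<bar>) * norm x) UNIV"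
          unfolding prod.case
          by (intro has_sum_cmult_left has_sum_cmult_right has_sum_infsum s)
      next
        show "(\<lambda>i. \<bar>?c i\<bar> * (\<Sum>\<^sub>\<infinity>j. \<bar>?c j\<bar>) * norm x) summable_on UNIV"
          by (intro summable_on_cmult_left s)
      qed auto
      show "(case p of (i, j) \<Rightarrow> norm (?f i j)) \<le> (case p of (i, j) \<Rightarrow> \<bar>?c i\<bar> * \<bar>?c j\<bar> * norm x)" for p
        by (auto simp: abs_mult norm_pow mult_left_mono split: prod.split)
    qed auto
    then have "(\<lambda>p. norm (case p of (i, j) \<Rightarrow> ?f i j)) summable_on UNIV \<times> UNIV"
      unfolding case_prod_unfold .
    then have sf: "(\<lambda>(i, j). ?f i j) summable_on UNIV \<times> UNIV"
      by (rule Infinite_Sum.abs_summable_summable)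
    have sumk: "B y = (\<Sum>\<^sub>\<infinity>k. ?c k *\<^sub>R (T ^^ k) y)" for y
      unfolding B_def
      using infsumI[OF norm_summable_imp_has_sum[OF abs summable_sums[OF sm]]] by simp
    have "bounded_linear T"
      using contr by (intro bounded_linear_intro[of _ 1]) (auto simp: linear_add[OF T] linear_cmul[OF T])
    then have "T (B y) = B (T y)" for y by (rule comm) simp
    then have TB: "(T ^^ k) (B y) = B ((T ^^ k) y)" for k y by (induction k) simp_all
    have "B (B x) = (\<Sum>\<^sub>\<infinity>i. ?c i *\<^sub>R B ((T ^^ i) x))" using sumk[of "B x"] by (simp add: TB)
    also have "\<dots> = (\<Sum>\<^sub>\<infinity>i. \<Sum>\<^sub>\<infinity>j. ?f i j)"
    proof (rule infsum_cong)
      fix i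
      have "(T ^^ j) ((T ^^ i) x) = (T ^^ (i + j)) x" for j by (simp add: funpow_add add.commute[of i])
      then show "?c i *\<^sub>R B ((T ^^ i) x) = (\<Sum>\<^sub>\<infinity>j. ?f i j)"
        unfolding sumk by (simp flip: scaleR_scaleR infsum_scaleR_right)
    qed
    also have "\<dots> = (\<Sum>\<^sub>\<infinity>(i, j)\<in>UNIV \<times> UNIV. ?f i j)" by (rule infsum_Sigma'_banach[OF sf])
    also have "\<dots> = (\<Sum>\<^sub>\<infinity>(k, i)\<in>Sigma UNIV (\<lambda>k. {..k}). ?f i (k - i))"
    proof -
      have "bij_betw (\<lambda>(k, i). (i, k - i)) (Sigma UNIV (\<lambda>k::nat. {..k})) (UNIV \<times> UNIV)"
        by (rule bij_betwI[where g = "\<lambda>(i, j). (i + j, i)"]) auto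
      from infsum_reindex_bij_betw[OF this, of "\<lambda>(i, j). ?f i j"]
      show ?thesis by (simp add: case_prod_unfold)
    qed
    also have "\<dots> = (\<Sum>\<^sub>\<infinity>k. \<Sum>\<^sub>\<infinity>i\<in>{..k}. ?f i (k - i))"
    proof (rule infsum_Sigma'_banach[symmetric])
      have "bij_betw (\<lambda>(k, i). (i, k - i)) (Sigma UNIV (\<lambda>k::nat. {..k})) (UNIV \<times> UNIV)"
        by (rule bij_betwI[where g = "\<lambda>(i, j). (i + j, i)"]) auto
      from summable_on_reindex_bij_betw[OF this, of "\<lambda>(i, j). ?f i j"] sf
      show "(\<lambda>(k, i). ?f i (k - i)) summable_on Sigma UNIV (\<lambda>k. {..k})"
        by (simp add: case_prod_unfold)
    qed
    also have "\<dots> = (\<Sum>\<^sub>\<infinity>k. (if k = 0 then 1 else if k = 1 then -1 else 0 :: real) *\<^sub>R (T ^^ k) x)"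
      by (rule infsum_cong) (simp add: sqrt_coeff_convolution flip: scaleR_sum_left)
    also have "\<dots> = (\<Sum>\<^sub>\<infinity>k\<in>{0, 1::nat}. (if k = 0 then 1 else -1 :: real) *\<^sub>R (T ^^ k) x)"
      by (rule infsum_cong_neutral) auto
    also have "\<dots> = x - T x" by simp
    finally show ?thesis .
  qed
  show ?thesis using bl square pos comm inv by (intro exI[of _ B]) blast
qed

section \<open>Schur's lemma for a self-adjoint operator\<close>

text \<open>
  For every real \<open>\<mu>\<close> put \<open>A' = A - \<mu>\<close>, suitably scaled, and let \<open>B = \<surd>(A'\<^sup>2)\<close>. Then
  \<open>(B + A') (B - A') = 0\<close>, so the kernel of \<open>B + A'\<close> in \<open>W\<close> contains the image of \<open>B - A'\<close>. This kernel
  is invariant under \<open>M\<close>, so it is trivial or all of \<open>W\<close>, that is, \<open>A' = B \<ge> 0\<close> or \<open>A' = -B \<le> 0\<close> on \<open>W\<close>.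
  An operator that is comparable with every real number is a real number. The elements of \<open>M\<close> are
  real-linear only, so that multiplication by the imaginary unit can be one of them.
\<close>

lemma selfadjoint_scalar:
  fixes A :: "'a::{real_inner,banach} \<Rightarrow> 'a"
  assumes A: "bounded_linear A" "\<And>x y. inner (A x) y = inner x (A y)"
    and W: "subspace W" "closed W" "A ` W \<subseteq> W"
    and M: "\<And>m. m \<in> M \<Longrightarrow> bounded_linear m" "\<And>m. m \<in> M \<Longrightarrow> m ` W \<subseteq> W"
      "\<And>m x. m \<in> M \<Longrightarrow> m (A x) = A (m x)"
    and irr: "\<And>Z. subspace Z \<Longrightarrow> closed Z \<Longrightarrow> Z \<subseteq> W \<Longrightarrow> (\<And>m. m \<in> M \<Longrightarrow> m ` Z \<subseteq> Z) \<Longrightarrow> Z = {0} \<or> Z = W"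
  shows "\<exists>\<mu>. \<forall>w\<in>W. A w = \<mu> *\<^sub>R w"
proof -
  interpret A: bounded_linear A by fact
  have dich: "(\<forall>w\<in>W. inner (A w) w \<ge> \<mu> * inner w w) \<or> (\<forall>w\<in>W. inner (A w) w \<le> \<mu> * inner w w)" for \<mu>
  proof -
    define A0 where "A0 x = A x - \<mu> *\<^sub>R x" for x
    have A0: "bounded_linear A0" unfolding A0_def
      by (intro bounded_linear_sub A(1) bounded_linear_scaleR_right)
    obtain b where b: "b > 0" "\<And>x. norm (A0 x) \<le> norm x * b"
      using bounded_linear.pos_bounded[OF A0] by blast
    define A' where "A' x = (1 / b) *\<^sub>R A0 x" for x
    have A': "bounded_linear A'" unfolding A'_def by (intro bounded_linear_const_scaleR A0)
    interpret A': bounded_linear A' by fact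
    have contr: "norm (A' x) \<le> norm x" for x using b by (simp add: A'_def field_simps)
    have sa: "inner (A' x) y = inner x (A' y)" for x y
      by (simp add: A'_def A0_def inner_diff A(2))
    have AW: "A' w \<in> W" if "w \<in> W" for w
      using that W unfolding A'_def A0_def by (intro subspace_scale subspace_diff) auto
    have Am: "m (A' x) = A' (m x)" if "m \<in> M" for m x
    proof -
      interpret m: bounded_linear m using M that by blast
      show ?thesis by (simp add: A'_def A0_def m.scaleR m.diff M(3)[OF that])
    qed
    define T where "T x = x - A' (A' x)" for x
    have T: "linear T" unfolding T_def
      by (intro linear_compose_sub linear_id[unfolded id_def]
          linear_compose[OF A'.linear_axioms A'.linear_axioms, unfolded o_def])
    have "norm (T x) \<le> norm x" for x
    proof -
      have "(norm (T x))\<^sup>2 = (norm x)\<^sup>2 - 2 * (norm (A' x))\<^sup>2 + (norm (A' (A' x)))\<^sup>2"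
        using sa[of x "A' x"] inner_commute[of "A' (A' x)" x]
        by (simp add: power2_norm_eq_inner T_def inner_diff_left inner_diff_right)
      moreover have "(norm (A' (A' x)))\<^sup>2 \<le> (norm (A' x))\<^sup>2" using contr by (intro power_mono) auto
      ultimately have "(norm (T x))\<^sup>2 \<le> (norm x)\<^sup>2" using zero_le_power2[of "norm (A' x)"] by linarith
      then show ?thesis by (rule power2_le_imp_le) simp
    qed
    from ex_sqrt_one_minus[OF T this] obtain B where
      B: "bounded_linear B" "\<And>x. B (B x) = x - T x" "\<And>x. inner (B x) x \<ge> 0"
      and Bm: "\<And>m x. bounded_linear m \<Longrightarrow> (\<And>x. m (T x) = T (m x)) \<Longrightarrow> m (B x) = B (m x)"
      and BW: "\<And>W. subspace W \<Longrightarrow> closed W \<Longrightarrow> T ` W \<subseteq> W \<Longrightarrow> B ` W \<subseteq> W"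
      by metis
    interpret B: bounded_linear B by fact
    have BA: "A' (B x) = B (A' x)" for x
      by (rule Bm[OF A']) (simp add: T_def A'.diff)
    have TW: "T ` W \<subseteq> W" using AW W(1) by (auto simp: T_def intro: subspace_diff)
    define C where "C x = B x + A' x" for x
    have C: "bounded_linear C" unfolding C_def by (intro bounded_linear_add B(1) A')
    interpret C: bounded_linear C by fact
    let ?Z = "{w \<in> W. C w = 0}"
    have "subspace ?Z" using W(1) by (auto simp: subspace_def C.zero C.add C.scaleR)
    moreover have "closed ?Z"
    proof -
      have "closed {w. C w = 0}" by (intro closed_Collect_eq continuous_intros linear_continuous_on C)
      then have "closed (W \<inter> {w. C w = 0})" using W(2) by blast
      then show ?thesis by (simp add: Int_def)
    qed
    moreover have "m ` ?Z \<subseteq> ?Z" if m: "m \<in> M" for m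
    proof -
      interpret m: bounded_linear m using M m by blast
      have "m (B x) = B (m x)" for x
        by (rule Bm[OF m.bounded_linear_axioms]) (simp add: T_def m.diff Am[OF m])
      then have "m (C x) = C (m x)" for x by (simp add: C_def m.add Am[OF m])
      then have "C (m w) = 0" if "C w = 0" for w using that m.zero by metis
      then show ?thesis using M(2)[OF m] by blast
    qed
    ultimately have "?Z = {0} \<or> ?Z = W" using irr by blast
    then show ?thesis
    proof
      assume Z: "?Z = {0}"
      have "inner (A' w) w \<ge> 0" if w: "w \<in> W" for w
      proof -
        have "C (B w - A' w) = 0" unfolding C_def by (simp add: B.diff A'.diff BA B(2) T_def)
        moreover have "B w - A' w \<in> W" using BW[OF W(1,2) TW] AW w W(1) by (auto intro: subspace_diff)
        ultimately have "B w - A' w \<in> ?Z" by blast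
        then have "B w = A' w" unfolding Z by simp
        then show ?thesis using B(3)[of w] by simp
      qed
      then have "inner (A0 w) w \<ge> 0" if "w \<in> W" for w using that b by (force simp: A'_def zero_le_divide_iff)
      then show ?thesis by (auto simp: A0_def inner_diff_left)
    next
      assume Z: "?Z = W"
      have "inner (A' w) w \<le> 0" if "w \<in> W" for w
      proof -
        have "A' w = - B w" using Z that by (auto simp: C_def eq_neg_iff_add_eq_0 add.commute)
        then show ?thesis using B(3)[of w] by simp
      qed
      then have "inner (A0 w) w \<le> 0" if "w \<in> W" for w using that b by (force simp: A'_def divide_le_0_iff)
      then show ?thesis by (auto simp: A0_def inner_diff_left)
    qed
  qed
  have const: "inner (A v) v / inner v v = inner (A w) w / inner w w"
    if "v \<in> W" "w \<in> W" "v \<noteq> 0" "w \<noteq> 0" for v w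
  proof -
    have "inner (A v) v / inner v v \<le> inner (A w) w / inner w w"
      if vw: "v \<in> W" "w \<in> W" "v \<noteq> 0" "w \<noteq> 0" for v w
    proof (rule ccontr)
      assume "\<not> ?thesis"
      then obtain \<mu> where "inner (A w) w / inner w w < \<mu>" "\<mu> < inner (A v) v / inner v v"
        using dense not_le by metis
      then have "inner (A w) w < \<mu> * inner w w" "\<mu> * inner v v < inner (A v) v"
        using vw by (simp_all add: field_simps)
      then show False using dich[of \<mu>] vw by fastforce
    qed
    then show ?thesis using that by (meson antisym)
  qed
  obtain \<mu> where \<mu>: "\<And>w. w \<in> W \<Longrightarrow> inner (A w) w = \<mu> * inner w w"
  proof (cases "W = {0}")
    case True
    then show ?thesis using that[of 0] by auto
  next
    case False
    then obtain v where v: "v \<in> W" "v \<noteq> 0" using subspace_0[OF W(1)] by blast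
    have "inner (A w) w = (inner (A v) v / inner v v) * inner w w" if w: "w \<in> W" for w
    proof (cases "w = 0")
      case False
      then show ?thesis using const[OF v(1) w v(2) False] by (simp add: field_simps)
    qed (simp add: A.zero)
    then show ?thesis using that by blast
  qed
  have "A w = \<mu> *\<^sub>R w" if w: "w \<in> W" for w
  proof -
    let ?u = "A w - \<mu> *\<^sub>R w"
    have u: "?u \<in> W" using w W by (intro subspace_diff subspace_scale) auto
    \<comment> \<open>Polarization: the quadratic form of \<open>A\<close> on \<open>W\<close> determines \<open>A\<close>.\<close>
    have "inner (A w) u + inner (A u) w = 2 * \<mu> * inner w u" if u: "u \<in> W" for u
      using \<mu>[OF subspace_add[OF W(1) w u]] \<mu>[OF w] \<mu>[OF u]
      by (simp add: A.add inner_add_left inner_add_right inner_commute[of u w] algebra_simps)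
    from this[OF u]
    have "inner (A w) ?u = \<mu> * inner w ?u"
      using A(2)[of ?u w] by (simp add: inner_commute)
    then have "inner ?u ?u = 0" by (simp add: inner_diff_left)
    then show ?thesis by simp
  qed
  then show ?thesis by blast
qed

section \<open>A criterion for one-dimensional invariants\<close>

lemma inner_scaleC_i: "inner (\<i> *\<^sub>C x) (y :: 'h::chilbert_space) = - inner x (\<i> *\<^sub>C y)"
  using cinner_scaleC_left[of \<i> x y] cinner_scaleC_left[of \<i> y x] cinner_commute[of x "\<i> *\<^sub>C y"]
    cinner_commute[of x y]
  by (simp flip: Re_cinner)

lemma scaleC_i_i: "\<i> *\<^sub>C \<i> *\<^sub>C x = - (x :: 'h::chilbert_space)"
  using scaleR_scaleC[of "-1" x] by (simp add: scaleC_scaleC)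

lemma scaleC_conv_scaleR: "c *\<^sub>C x = Re c *\<^sub>R x + Im c *\<^sub>R (\<i> *\<^sub>C (x :: 'h::chilbert_space))"
proof -
  have "c = complex_of_real (Re c) + complex_of_real (Im c) * \<i>" by (simp add: complex_eq mult.commute)
  then show ?thesis by (metis scaleC_add_left scaleC_scaleC scaleR_scaleC)
qed

text \<open>
  Complex subspaces and operators are treated below as real ones that are compatible with
  multiplication by \<open>\<i>\<close>.
\<close>

lemma bounded_linear_scaleC_i: "bounded_linear (\<lambda>x :: 'h::chilbert_space. \<i> *\<^sub>C x)"
proof (rule bounded_linear_intro[of _ 1])
  show "\<i> *\<^sub>C (x + y) = \<i> *\<^sub>C x + \<i> *\<^sub>C y" for x y :: 'h by (rule scaleC_add_right)
  show "\<i> *\<^sub>C (r *\<^sub>R x) = r *\<^sub>R (\<i> *\<^sub>C x)" for r and x :: 'h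
    by (simp add: scaleR_scaleC scaleC_scaleC mult.commute)
  show "norm (\<i> *\<^sub>C x) \<le> norm x * 1" for x :: 'h
    using inner_scaleC_i[of x "\<i> *\<^sub>C x"] by (simp add: scaleC_i_i norm_eq_sqrt_inner)
qed

text \<open>
  The last hypothesis makes the operators \<open>P \<pi>(g) P\<close> commute, as the mean ergodic theorem for \<open>s\<close> and
  \<open>inv s\<close> turns the identity for all \<open>L\<close> into an identity for \<open>P\<close>; replacing \<open>g\<close> by \<open>k1 g k2\<close> does not
  change \<open>P \<pi>(g) P\<close>. Irreducibility passes from \<open>\<pi>\<close> to these operators: if a closed subspace \<open>Z\<close> of the
  invariants is invariant under them, the vectors \<open>x\<close> with \<open>P \<pi>(g) x \<in> Z\<close> for all \<open>g\<close> form a closed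
  \<open>\<pi>\<close>-invariant subspace.
\<close>

lemma spherical_criterion:
  fixes G (structure) and \<pi> :: "'g \<Rightarrow> 'h::chilbert_space \<Rightarrow> 'h"
  assumes G: "group G" and K: "subgroup K G"
    and unit: "\<And>g. g \<in> carrier G \<Longrightarrow> unitary (\<pi> g)"
    and hom: "\<And>g h. g \<in> carrier G \<Longrightarrow> h \<in> carrier G \<Longrightarrow> \<pi> (g \<otimes> h) = \<pi> g \<circ> \<pi> h"
    and irr: "irreducible_rep G \<pi>"
    and s: "s \<in> K" "\<And>v. \<pi> s v = v \<Longrightarrow> v \<in> invariants K \<pi>"
    and disjoint: "\<And>g h. g \<in> carrier G \<Longrightarrow> h \<in> carrier G \<Longrightarrow>
      \<exists>k1\<in>K. \<exists>k2\<in>K. \<exists>k3\<in>K. \<exists>k4\<in>K. \<forall>L::nat.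
        (k1 \<otimes> g \<otimes> k2) \<otimes> (inv (s [^] L) \<otimes> (k3 \<otimes> h \<otimes> k4) \<otimes> s [^] L)
        = (inv (s [^] L) \<otimes> (k3 \<otimes> h \<otimes> k4) \<otimes> s [^] L) \<otimes> (k1 \<otimes> g \<otimes> k2)"
  shows "\<exists>v. invariants K \<pi> \<subseteq> complex_vector.span {v}"
proof -
  interpret group G by fact
  interpret K: subgroup K G by fact
  let ?J = "\<lambda>x :: 'h. \<i> *\<^sub>C x" and ?W = "invariants K \<pi>"
  interpret J: bounded_linear ?J by (rule bounded_linear_scaleC_i)
  note KG = K.subset[THEN subsetD]
  have add: "\<pi> g (x + y) = \<pi> g x + \<pi> g y" and scaleC: "\<pi> g (c *\<^sub>C x) = c *\<^sub>C \<pi> g x"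
    if "g \<in> carrier G" for g x y c
    using unit[OF that] by (simp_all add: unitary_def linear_iff_module_hom module_hom_iff)
  have iso: "inner (\<pi> g x) (\<pi> g y) = inner x y" if "g \<in> carrier G" for g x y
    using unit[OF that] by (simp add: unitary_def flip: Re_cinner)
  have bl: "bounded_linear (\<pi> g)" if g: "g \<in> carrier G" for g
  proof (rule bounded_linear_intro[of _ 1])
    show "norm (\<pi> g x) \<le> norm x * 1" for x using iso[OF g] by (simp add: norm_eq_sqrt_inner)
  qed (use add[OF g] scaleC[OF g] in \<open>simp_all add: scaleR_scaleC\<close>)
  note lin = bounded_linear.linear[OF bl]
  have one: "\<pi> \<one> x = x" for x
  proof -
    have "\<pi> \<one> (\<pi> \<one> x - x) = 0"
      using hom[of \<one> \<one>] lin[OF one_closed]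
      by (simp add: linear_diff fun_eq_iff)
    then have "norm (\<pi> \<one> x - x) = 0"
      using iso[OF one_closed, of "\<pi> \<one> x - x" "\<pi> \<one> x - x"] by simp
    then show ?thesis by simp
  qed
  have cancel: "\<pi> (inv g) (\<pi> g x) = x" "\<pi> g (\<pi> (inv g) x) = x" if "g \<in> carrier G" for g x
    using hom[of "inv g" g] hom[of g "inv g"] that one by (simp_all add: fun_eq_iff)
  have adj: "inner (\<pi> g x) y = inner x (\<pi> (inv g) y)" if "g \<in> carrier G" for g x y
    using iso[of g x "\<pi> (inv g) y"] cancel(2)[OF that] that by simp
  have WD: "\<pi> k w = w" if "w \<in> ?W" "k \<in> K" for w k using that by (simp add: invariants_def)
  have W: "subspace ?W"
    by (simp add: subspace_def invariants_def KG linear_0[OF lin] linear_add[OF lin] linear_cmul[OF lin])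
  have "closed (\<Inter>k\<in>K. {v. \<pi> k v = v})"
    by (intro closed_INT ballI closed_Collect_eq continuous_intros linear_continuous_on bl KG)
  moreover have "(\<Inter>k\<in>K. {v. \<pi> k v = v}) = ?W" by (auto simp: invariants_def)
  ultimately have clW: "closed ?W" by simp
  have JW: "?J w \<in> ?W" if "w \<in> ?W" for w using that scaleC[OF KG] by (simp add: invariants_def)

  have "\<forall>x. \<exists>p. p \<in> ?W \<and> (\<forall>w\<in>?W. inner (x - p) w = 0)"
    using ex_orthogonal_projection[OF W clW] by blast
  then obtain P where PW: "\<And>x. P x \<in> ?W" and Porth: "\<And>x w. w \<in> ?W \<Longrightarrow> inner (x - P x) w = 0"
    by metis
  have P_eq: "P x = p" if p: "p \<in> ?W" "\<And>w. w \<in> ?W \<Longrightarrow> inner (x - p) w = 0" for x p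
  proof -
    have d: "p - P x \<in> ?W" using p(1) PW W by (intro subspace_diff)
    have "inner (p - P x) (p - P x) = 0"
      using p(2)[OF d] Porth[OF d, of x] by (simp add: inner_diff_left)
    then show ?thesis by simp
  qed
  have P_id: "P w = w" if "w \<in> ?W" for w by (rule P_eq[OF that]) simp
  have P_inner: "inner (P x) w = inner x w" if "w \<in> ?W" for x w
    using Porth[OF that, of x] by (simp add: inner_diff_left)
  have P_sa: "inner (P x) y = inner x (P y)" for x y
    using P_inner[OF PW, of x y] P_inner[OF PW, of y x] by (simp add: inner_commute)
  have blP: "bounded_linear P"
  proof (rule bounded_linear_intro[of _ 1])
    show "P (x + y) = P x + P y" for x y
      using subspace_add[OF W PW PW] by (rule P_eq) (simp add: inner_diff_left inner_add_left P_inner)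
    show "P (r *\<^sub>R x) = r *\<^sub>R P x" for r x
      using subspace_scale[OF W PW] by (rule P_eq) (simp add: inner_diff_left P_inner)
    show "norm (P x) \<le> norm x * 1" for x
    proof -
      have "norm (P x) * norm (P x) \<le> norm x * norm (P x)"
        using P_inner[OF PW, of x x] norm_cauchy_schwarz[of x "P x"]
        by (simp add: power2_eq_square[symmetric] power2_norm_eq_inner)
      then show ?thesis by (cases "norm (P x) = 0") simp_all
    qed
  qed
  interpret P: bounded_linear P by fact
  have PJ: "P (?J x) = ?J (P x)" for x
    by (rule P_eq[OF JW[OF PW]]) (simp add: inner_scaleC_i inner_diff_left P_inner JW)

  have s': "s \<in> carrier G" using s(1) KG by blast
  have pow: "(\<pi> g ^^ L) x = \<pi> (g [^] L) x" if "g \<in> carrier G" for g x and L :: nat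
  proof (induction L arbitrary: x)
    case (Suc L)
    then show ?case using that hom[of "g [^] L" g] by (simp add: funpow_Suc_right del: funpow.simps)
  qed (simp add: one)
  have erg: "(\<lambda>N. (1 / real N) *\<^sub>R (\<Sum>L<N. \<pi> (t [^] L) x)) \<longlonglongrightarrow> P x"
    if t: "t \<in> K" "\<And>v. \<pi> t v = v \<Longrightarrow> v \<in> ?W" for t x
  proof -
    have t': "t \<in> carrier G" using t(1) KG by blast
    have "(\<lambda>N. (1 / real N) *\<^sub>R (\<Sum>L<N. (\<pi> t ^^ L) x)) \<longlonglongrightarrow> P x"
      by (rule mean_ergodic[OF lin[OF t'] iso[OF t']])
         (use PW WD t Porth in auto)
    then show ?thesis by (simp add: pow[OF t'])
  qed
  have "v \<in> ?W" if "\<pi> (inv s) v = v" for v using s(2) cancel(2)[OF s', of v] that by simp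
  note erg_s = erg[OF s] and erg_s' = erg[OF K.m_inv_closed[OF s(1)] this]

  have swap: "inner (\<pi> g (P (\<pi> h v))) w = inner (\<pi> h (P (\<pi> g v))) w"
    if g: "g \<in> carrier G" and h: "h \<in> carrier G" and v: "v \<in> ?W" and w: "w \<in> ?W" for g h v w
  proof -
    have conj: "inner (\<pi> (k1 \<otimes> g \<otimes> k2) (P (\<pi> (k3 \<otimes> h \<otimes> k4) v))) w = inner (\<pi> g (P (\<pi> h v))) w"
      if k: "k1 \<in> K" "k2 \<in> K" "k3 \<in> K" "k4 \<in> K" and g: "g \<in> carrier G" and h: "h \<in> carrier G"
      for k1 k2 k3 k4 g h
    proof -
      have "P (\<pi> k3 x) = P x" for x
        by (rule P_eq[OF PW])
           (use k KG WD K.m_inv_closed in \<open>simp add: inner_diff_left P_inner adj\<close>)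
      then show ?thesis
        using k KG g h WD[OF v] WD[OF PW] WD[OF w] K.m_inv_closed[OF k(1)]
        by (simp add: hom adj[of k1])
    qed
    obtain k1 k2 k3 k4 where k: "k1 \<in> K" "k2 \<in> K" "k3 \<in> K" "k4 \<in> K"
      and eq: "\<And>L::nat. (k1 \<otimes> g \<otimes> k2) \<otimes> (inv (s [^] L) \<otimes> (k3 \<otimes> h \<otimes> k4) \<otimes> s [^] L)
        = (inv (s [^] L) \<otimes> (k3 \<otimes> h \<otimes> k4) \<otimes> s [^] L) \<otimes> (k1 \<otimes> g \<otimes> k2)"
      using disjoint[OF g h] by blast
    define g' h' where "g' = k1 \<otimes> g \<otimes> k2" and "h' = k3 \<otimes> h \<otimes> k4"
    have gh': "g' \<in> carrier G" "h' \<in> carrier G" using g h k KG by (auto simp: g'_def h'_def)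
    have summand: "inner (\<pi> g' (\<pi> (inv s [^] L) (\<pi> h' v))) w = inner (\<pi> h' (\<pi> (s [^] L) (\<pi> g' v))) w"
      for L :: nat
    proof -
      have sL: "s [^] L \<in> K" "s [^] L \<in> carrier G"
        using s(1) KG by (induction L) (simp_all add: nat_pow_Suc)
      have "\<pi> g' (\<pi> (inv s [^] L) (\<pi> h' v)) = \<pi> (g' \<otimes> (inv (s [^] L) \<otimes> h' \<otimes> s [^] L)) v"
        using gh' sL s' WD[OF v sL(1)] by (simp add: hom nat_pow_inv)
      also have "\<dots> = \<pi> (inv (s [^] L)) (\<pi> h' (\<pi> (s [^] L) (\<pi> g' v)))"
        unfolding eq[of L, folded g'_def h'_def] using gh' sL by (simp add: hom)
      finally show ?thesis using sL adj[of "inv (s [^] L)"] WD[OF w sL(1)] by simp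
    qed
    let ?A = "\<lambda>t x N. (1 / real N) *\<^sub>R (\<Sum>L<N. \<pi> (t [^] (L::nat)) x)"
    have expand: "inner (\<pi> g (?A t x N)) w = (1 / real N) * (\<Sum>L<N. inner (\<pi> g (\<pi> (t [^] L) x)) w)"
      if g: "g \<in> carrier G" for g t x N
    proof -
      interpret pg: bounded_linear "\<pi> g" by (rule bl[OF g])
      show ?thesis by (simp add: pg.scaleR pg.sum inner_sum_left)
    qed
    have lim: "(\<lambda>N. inner (\<pi> g (?A t x N)) w) \<longlonglongrightarrow> inner (\<pi> g (P x)) w"
      if "?A t x \<longlonglongrightarrow> P x" and g: "g \<in> carrier G" for g t x
      by (intro tendsto_intros bounded_linear.tendsto[OF bl[OF g]] that(1))
    have eq': "(\<lambda>N. inner (\<pi> g' (?A (inv s) (\<pi> h' v) N)) w) = (\<lambda>N. inner (\<pi> h' (?A s (\<pi> g' v) N)) w)"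
      unfolding expand[OF gh'(1)] expand[OF gh'(2)] summand ..
    have "(\<lambda>N. inner (\<pi> h' (?A s (\<pi> g' v) N)) w) \<longlonglongrightarrow> inner (\<pi> g' (P (\<pi> h' v))) w"
      unfolding eq'[symmetric] by (rule lim[OF erg_s' gh'(1)])
    then have "inner (\<pi> g' (P (\<pi> h' v))) w = inner (\<pi> h' (P (\<pi> g' v))) w"
      by (rule LIMSEQ_unique[OF _ lim[OF erg_s gh'(2)]])
    then show ?thesis unfolding g'_def h'_def conj[OF k g h] conj[OF k(3,4,1,2) h g] .
  qed

  define M where "M g x = P (\<pi> g (P x))" for g x
  have blM: "bounded_linear (M g)" if "g \<in> carrier G" for g
    unfolding M_def
    by (intro bounded_linear_compose[OF blP] bounded_linear_compose[OF bl[OF that]] blP)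
  have MW: "M g x \<in> ?W" for g x by (simp add: M_def PW)
  have M_sa: "inner (M g x) y = inner x (M (inv g) y)" if "g \<in> carrier G" for g x y
    using that by (simp add: M_def P_sa adj)
  have MJ: "M g (?J x) = ?J (M g x)" if "g \<in> carrier G" for g x
    using that by (simp add: M_def PJ scaleC)
  have MM: "M g (M h x) = M h (M g x)" if gh: "g \<in> carrier G" "h \<in> carrier G" for g h x
  proof -
    let ?d = "M g (M h x) - M h (M g x)"
    have d: "?d \<in> ?W" using MW W by (intro subspace_diff)
    have "inner (M g (M h x)) w = inner (M h (M g x)) w" if w: "w \<in> ?W" for w
      using swap[OF gh PW w, of x] by (simp add: M_def P_id[OF PW] P_inner[OF w])
    from this[OF d] have "inner ?d ?d = 0" by (simp only: inner_diff_left right_minus_eq)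
    then show ?thesis by simp
  qed
  let ?M = "insert ?J (M ` carrier G)"
  \<comment> \<open>No closed subspace of the invariants but the trivial ones survives the operators \<open>M g\<close> and \<open>?J\<close>.\<close>
  have irrM: "Z = {0} \<or> Z = ?W"
    if Z: "subspace Z" "closed Z" "Z \<subseteq> ?W" and inv: "\<And>m. m \<in> ?M \<Longrightarrow> m ` Z \<subseteq> Z" for Z
  proof -
    let ?Y = "{x. \<forall>g\<in>carrier G. P (\<pi> g x) \<in> Z}"
    have ZC: "c *\<^sub>C z \<in> Z" if "z \<in> Z" for c z
      using that inv[of ?J] Z(1) unfolding scaleC_conv_scaleR[of c]
      by (intro subspace_add subspace_scale) auto
    have PC: "P (c *\<^sub>C x) = c *\<^sub>C P x" for c x
      unfolding scaleC_conv_scaleR[of c] by (simp add: P.add P.scaleR PJ)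
    have "complex_vector.subspace ?Y"
      unfolding complex_vector.subspace_def
    proof (intro conjI ballI allI CollectI)
      fix g assume g: "g \<in> carrier G"
      show "P (\<pi> g 0) \<in> Z"
        using linear_0[OF lin[OF g]] subspace_0[OF Z(1)] by (simp add: P.zero)
      fix x assume x: "x \<in> ?Y"
      then show "P (\<pi> g (c *\<^sub>C x)) \<in> Z" for c using g ZC by (simp add: scaleC PC)
      fix y assume "y \<in> ?Y"
      then show "P (\<pi> g (x + y)) \<in> Z" using x g subspace_add[OF Z(1)] by (simp add: add P.add)
    qed
    moreover have "closed ?Y"
    proof -
      have "closed (\<Inter>g\<in>carrier G. (\<lambda>x. P (\<pi> g x)) -` Z)"
        by (intro closed_INT ballI closed_vimage Z(2) continuous_intros linear_continuous_on
            bounded_linear_compose[OF blP] bl)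
      moreover have "(\<Inter>g\<in>carrier G. (\<lambda>x. P (\<pi> g x)) -` Z) = ?Y" by auto
      ultimately show ?thesis by simp
    qed
    moreover have "\<pi> h ` ?Y \<subseteq> ?Y" if h: "h \<in> carrier G" for h
    proof (intro image_subsetI CollectI ballI)
      fix x g assume x: "x \<in> ?Y" and g: "g \<in> carrier G"
      then have "P (\<pi> (g \<otimes> h) x) \<in> Z" using h by blast
      then show "P (\<pi> g (\<pi> h x)) \<in> Z" using hom[OF g h] by simp
    qed
    ultimately have "?Y = {0} \<or> ?Y = UNIV" using irr unfolding irreducible_rep_def by blast
    then show ?thesis
    proof
      assume Y: "?Y = {0}"
      have "z \<in> ?Y" if z: "z \<in> Z" for z
      proof (intro CollectI ballI)
        fix g assume "g \<in> carrier G"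
        then have "M g z \<in> Z" using inv[of "M g"] z by blast
        then show "P (\<pi> g z) \<in> Z" using P_id z Z(3) by (simp add: M_def subset_iff)
      qed
      then show ?thesis using Y subspace_0[OF Z(1)] by blast
    next
      assume Y: "?Y = UNIV"
      have "w \<in> Z" if w: "w \<in> ?W" for w
      proof -
        have "P (\<pi> \<one> w) \<in> Z" using Y by blast
        then show ?thesis using one P_id[OF w] by simp
      qed
      then show ?thesis using Z(3) by blast
    qed
  qed
  have blM': "bounded_linear m" "m ` ?W \<subseteq> ?W" if "m \<in> ?M" for m
    using that blM MW JW bounded_linear_scaleC_i by auto
  have scalar: "\<exists>a b. \<forall>w\<in>?W. M g w = a *\<^sub>R w + b *\<^sub>R ?J w" if g: "g \<in> carrier G" for g
  proof -
    have ig: "inv g \<in> carrier G" using g by simp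
    interpret Mg: bounded_linear "M g" by (rule blM[OF g])
    interpret Mi: bounded_linear "M (inv g)" by (rule blM[OF ig])
    \<comment> \<open>The adjoint of \<open>M g\<close> is \<open>M (inv g)\<close>: \<open>?A\<close> and \<open>?B\<close> are, up to factors, the real and the imaginary part of \<open>M g\<close>.\<close>
    let ?A = "\<lambda>x. M g x + M (inv g) x" and ?B = "\<lambda>x. ?J (M g x - M (inv g) x)"
    have "\<exists>c. \<forall>w\<in>?W. ?A w = c *\<^sub>R w"
    proof (rule selfadjoint_scalar[OF _ _ W clW _ blM' _ irrM])
      show "bounded_linear ?A" by (intro bounded_linear_add blM g ig)
      show "inner (?A x) y = inner x (?A y)" for x y
        using M_sa[OF g] M_sa[OF ig] g by (simp add: inner_add)
      show "?A ` ?W \<subseteq> ?W" using subspace_add[OF W MW MW] by blast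
      show "m (?A x) = ?A (m x)" if "m \<in> ?M" for m x
        using that MM MJ g ig linear_add[OF bounded_linear.linear[OF blM'(1)[OF that]]] by auto
    qed auto
    then obtain c where c: "\<And>w. w \<in> ?W \<Longrightarrow> ?A w = c *\<^sub>R w" by blast
    have "\<exists>d. \<forall>w\<in>?W. ?B w = d *\<^sub>R w"
    proof (rule selfadjoint_scalar[OF _ _ W clW _ blM' _ irrM])
      show "bounded_linear ?B"
        by (intro bounded_linear_compose[OF bounded_linear_scaleC_i] bounded_linear_sub blM g ig)
      show "inner (?B x) y = inner x (?B y)" for x y
        using M_sa[OF g] M_sa[OF ig] g ig
        by (simp add: inner_scaleC_i inner_diff_left inner_diff_right J.diff MJ[symmetric])
      show "?B ` ?W \<subseteq> ?W" using subspace_diff[OF W MW MW] JW by blast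
      show "m (?B x) = ?B (m x)" if "m \<in> ?M" for m x
        using that MM MJ g ig linear_diff[OF bounded_linear.linear[OF blM'(1)[OF that]]] by auto
    qed auto
    then obtain d where d: "\<And>w. w \<in> ?W \<Longrightarrow> ?B w = d *\<^sub>R w" by blast
    have "M g w = (c / 2) *\<^sub>R w + (- d / 2) *\<^sub>R ?J w" if w: "w \<in> ?W" for w
    proof -
      have "?J (?B w) = d *\<^sub>R ?J w" using d[OF w] by (simp add: J.scaleR)
      then have "M (inv g) w - M g w = d *\<^sub>R ?J w" by (simp add: scaleC_i_i)
      then have "2 *\<^sub>R M g w = c *\<^sub>R w - d *\<^sub>R ?J w"
        using c[OF w] by (simp add: scaleR_2 algebra_simps)
      then have "(1/2) *\<^sub>R (2 *\<^sub>R M g w) = (1/2) *\<^sub>R (c *\<^sub>R w - d *\<^sub>R ?J w)" by simp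
      then show ?thesis by (simp add: scaleR_diff_right)
    qed
    then show ?thesis by blast
  qed
  show ?thesis
  proof (cases "?W = {0}")
    case True
    then show ?thesis by (intro exI[of _ 0]) (simp add: complex_vector.span_zero)
  next
    case False
    then obtain v where v: "v \<in> ?W" "v \<noteq> 0" using subspace_0[OF W] by blast
    \<comment> \<open>The complex orthogonal complement of \<open>v\<close> in the invariants, which the scalar operators preserve.\<close>
    let ?Z = "{w \<in> ?W. inner w v = 0 \<and> inner w (?J v) = 0}"
    have "?Z = {0} \<or> ?Z = ?W"
    proof (rule irrM)
      show Z: "subspace ?Z" using W by (auto simp: subspace_def inner_add_left)
      have "closed (?W \<inter> ({w. inner w v = 0} \<inter> {w. inner w (?J v) = 0}))"
        by (intro closed_Int clW closed_Collect_eq continuous_intros)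
      moreover have "?W \<inter> ({w. inner w v = 0} \<inter> {w. inner w (?J v) = 0}) = ?Z" by auto
      ultimately show "closed ?Z" by simp
      have JZ: "?J w \<in> ?Z" if "w \<in> ?Z" for w
        using that JW by (simp add: inner_scaleC_i scaleC_i_i)
      fix m assume m: "m \<in> ?M"
      show "m ` ?Z \<subseteq> ?Z"
      proof (cases "m = ?J")
        case False
        then obtain g where "g \<in> carrier G" "m = M g" using m by blast
        then obtain a b where ab: "\<And>w. w \<in> ?W \<Longrightarrow> m w = a *\<^sub>R w + b *\<^sub>R ?J w" using scalar by metis
        show ?thesis
        proof
          fix y assume "y \<in> m ` ?Z"
          then obtain w where w: "w \<in> ?Z" "y = m w" by blast
          then have "y = a *\<^sub>R w + b *\<^sub>R ?J w" using ab by blast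
          then show "y \<in> ?Z"
            by (simp only: subspace_add[OF Z subspace_scale[OF Z w(1)] subspace_scale[OF Z JZ[OF w(1)]]])
        qed
      qed (use JZ in blast)
    qed auto
    moreover have "v \<notin> ?Z" using v(2) by simp
    ultimately have Z0: "?Z = {0}" using v(1) by blast
    have Jv: "inner (?J v) v = 0" "inner v (?J v) = 0" "inner (?J v) (?J v) = inner v v"
      using inner_scaleC_i[of v v] inner_scaleC_i[of v "?J v"] by (simp_all add: inner_commute scaleC_i_i)
    have "w \<in> complex_vector.span {v}" if w: "w \<in> ?W" for w
    proof -
      let ?a = "inner w v / inner v v" and ?b = "inner w (?J v) / inner v v"
      let ?u = "w - (?a *\<^sub>R v + ?b *\<^sub>R ?J v)"
      have "?u \<in> ?W" using w v(1) JW W by (intro subspace_diff subspace_add subspace_scale)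
      moreover have "inner ?u v = 0" "inner ?u (?J v) = 0"
        using v(2) Jv by (simp_all add: inner_diff_left inner_add_left)
      ultimately have "?u \<in> {0}" using Z0 by blast
      then have "w = Complex ?a ?b *\<^sub>C v" by (simp add: scaleC_conv_scaleR[of "Complex ?a ?b"])
      then show ?thesis
        using complex_vector.span_scale[OF complex_vector.span_base] by (metis insertI1)
    qed
    then show ?thesis by blast
  qed
qed

text \<open>
  Applied to the operator that represents the neutral element.
\<close>

lemma unitary_idempotent: "unitary U \<Longrightarrow> U \<circ> U = U \<Longrightarrow> U x = x"
  unfolding unitary_def by (metis comp_apply surjD)

section \<open>Branches of a regular tree\<close>

locale tree =
  fixes n :: nat and E :: "'v \<Rightarrow> 'v \<Rightarrow> bool"
  assumes regular_tree: "regular_tree n E"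
begin

lemma sym: "E x y \<Longrightarrow> E y x"
  using regular_tree by (auto simp: regular_tree_def symp_def)

lemma irrefl: "\<not> E x x"
  using regular_tree by (auto simp: regular_tree_def irreflp_def)

lemma connected: "E\<^sup>*\<^sup>* x y"
  using regular_tree by (simp add: regular_tree_def)

lemma acyclic: "length c \<ge> 3 \<Longrightarrow> distinct c \<Longrightarrow> successively E c \<Longrightarrow> \<not> E (last c) (hd c)"
  using regular_tree unfolding regular_tree_def by blast

lemma finite_nbrs: "finite {y. E x y}" and card_nbrs: "card {y. E x y} = n + 1"
  using regular_tree by (auto simp: regular_tree_def)

lemma no_closed_walk:
  assumes "m \<ge> 2" "inj_on w {..m}" "\<And>i. i < m \<Longrightarrow> E (w i) (w (Suc i))"
  shows "\<not> E (w m) (w 0)"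
proof -
  let ?c = "map w [0..<Suc m]"
  have "distinct ?c"
    using assms(2) by (simp add: distinct_map atLeast0LessThan lessThan_Suc_atMost del: upt_Suc)
  moreover have "successively E ?c"
    unfolding successively_conv_nth using assms(3) by (simp del: upt_Suc)
  moreover have "last ?c = w m" "hd ?c = w 0" by (simp_all add: hd_map del: upt_Suc) simp
  ultimately show ?thesis using acyclic[of ?c] assms(1) by simp
qed

text \<open>
  If a walk without backtracking visited a vertex twice, a shortest closed piece of it would be a
  cycle.
\<close>

lemma non_backtracking_inj:
  assumes E: "\<And>i. i < m \<Longrightarrow> E (w i) (w (Suc i))"
    and nb: "\<And>i. Suc (Suc i) \<le> m \<Longrightarrow> w i \<noteq> w (Suc (Suc i))"
  shows "inj_on w {..m}"
proof (rule ccontr)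
  assume "\<not> inj_on w {..m}"
  then have "\<exists>d i. i + d \<le> m \<and> d > 0 \<and> w i = w (i + d)"
    unfolding inj_on_def by (metis atMost_iff less_imp_add_positive nat_neq_iff)
  then obtain d where d: "\<exists>i. i + d \<le> m \<and> d > 0 \<and> w i = w (i + d)"
    and least: "\<And>d'. d' < d \<Longrightarrow> \<not> (\<exists>i. i + d' \<le> m \<and> d' > 0 \<and> w i = w (i + d'))"
    using exists_least_iff[of "\<lambda>d. \<exists>i. i + d \<le> m \<and> d > 0 \<and> w i = w (i + d)"] by blast
  then obtain i where i: "i + d \<le> m" "d > 0" "w i = w (i + d)" by blast
  have "d \<noteq> 1" using i E[of i] irrefl by auto
  moreover have "d \<noteq> 2" using i nb[of i] by (auto simp: numeral_2_eq_2)
  ultimately have d3: "d \<ge> 3" using i by linarith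
  let ?w = "\<lambda>k. w (i + k)"
  have "inj_on ?w {..d - 1}"
  proof (rule linorder_inj_onI)
    fix j k assume jk: "j < k" "j \<in> {..d - 1}" "k \<in> {..d - 1}"
    have "k - j < d" "(i + j) + (k - j) \<le> m" "k - j > 0" using jk i d3 by auto
    then have "w (i + j) \<noteq> w ((i + j) + (k - j))" using least[of "k - j"] by blast
    then show "?w j \<noteq> ?w k" using jk by simp
  qed auto
  moreover have "E (?w k) (?w (Suc k))" if "k < d - 1" for k
    using E[of "i + k"] that i by simp
  ultimately have "\<not> E (?w (d - 1)) (?w 0)"
    using no_closed_walk[of "d - 1" ?w] d3 by simp
  moreover have "E (?w (d - 1)) (?w (Suc (d - 1)))" using E[of "i + (d - 1)"] i by simp
  ultimately show False using i by simp
qed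

lemma rtranclp_simple_path:
  assumes "R\<^sup>*\<^sup>* x y"
  shows "\<exists>m w. w 0 = x \<and> w m = y \<and> (\<forall>i<m. R (w i) (w (Suc i))) \<and> inj_on w {..m}"
proof -
  obtain k where "(R ^^ k) x y" using assms rtranclp_imp_relpowp by metis
  then obtain m where m: "(R ^^ m) x y" and least: "\<And>k. k < m \<Longrightarrow> \<not> (R ^^ k) x y"
    using exists_least_iff[of "\<lambda>k. (R ^^ k) x y"] by blast
  then obtain w where w: "w 0 = x" "w m = y" "\<forall>i<m. R (w i) (w (Suc i))"
    unfolding relpowp_fun_conv by blast
  have "inj_on w {..m}"
  proof (rule linorder_inj_onI)
    fix i j assume ij: "i < j" "i \<in> {..m}" "j \<in> {..m}"
    show "w i \<noteq> w j"
    proof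
      assume eq: "w i = w j"
      let ?w = "\<lambda>k. if k \<le> i then w k else w (k + (j - i))"
      have "R (?w k) (?w (Suc k))" if "k < m - (j - i)" for k
      proof (cases "k = i")
        case True
        then have "Suc k + (j - i) = Suc j" "j < m" using ij that by auto
        then show ?thesis using w(3) eq True by auto
      qed (use w(3) that ij in auto)
      moreover have "m - (j - i) \<le> i \<Longrightarrow> m = j" using ij by auto
      then have "?w (m - (j - i)) = y" using w(2) ij eq by auto
      ultimately have "(R ^^ (m - (j - i))) x y"
        unfolding relpowp_fun_conv using w(1) by (intro exI[of _ ?w]) simp
      moreover have "m - (j - i) < m" using ij by auto
      ultimately show False using least by blast
    qed
  qed auto
  then show ?thesis using w by blast
qed

text \<open>
  The component of \<open>b\<close> that remains after removing the vertex \<open>a\<close>; for an edge \<open>a b\<close> it is the half-tree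
  behind that edge.
\<close>

definition branch :: "'v \<Rightarrow> 'v \<Rightarrow> 'v set" where
  "branch a b = {x. (\<lambda>u v. E u v \<and> v \<noteq> a)\<^sup>*\<^sup>* b x}"

lemma branch_base: "b \<in> branch a b"
  by (simp add: branch_def)

lemma branch_step: "x \<in> branch a b \<Longrightarrow> E x y \<Longrightarrow> y \<noteq> a \<Longrightarrow> y \<in> branch a b"
  unfolding branch_def by (simp add: rtranclp.rtrancl_into_rtrancl)

lemma branch_induct [consumes 1, case_names base step]:
  assumes "x \<in> branch a b" "P b"
    "\<And>x y. x \<in> branch a b \<Longrightarrow> P x \<Longrightarrow> E x y \<Longrightarrow> y \<noteq> a \<Longrightarrow> P y"
  shows "P x"
proof -
  have "(\<lambda>u v. E u v \<and> v \<noteq> a)\<^sup>*\<^sup>* b x" using assms(1) by (simp add: branch_def)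
  then show ?thesis
    by (induction rule: rtranclp_induct) (use assms(2,3) in \<open>auto simp: branch_def\<close>)
qed

lemma root_notin_branch: "a \<noteq> b \<Longrightarrow> a \<notin> branch a b"
proof
  assume "a \<noteq> b" "a \<in> branch a b"
  have "x \<noteq> a" if "x \<in> branch a b" for x
    using that by (induction rule: branch_induct) (use \<open>a \<noteq> b\<close> in auto)
  then show False using \<open>a \<in> branch a b\<close> by blast
qed

text \<open>
  Another neighbour of \<open>a\<close> in the branch would close a cycle through \<open>a\<close> and \<open>b\<close>. This is the form
  in which acyclicity is used from here on.
\<close>

lemma branch_attached:
  assumes ab: "E a b" and x: "x \<in> branch a b" "E x a"
  shows "x = b"
proof (rule ccontr)
  assume "x \<noteq> b"
  let ?R = "\<lambda>u v. E u v \<and> v \<noteq> a"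
  obtain m w where w: "w 0 = b" "w m = x" "\<forall>i<m. ?R (w i) (w (Suc i))" "inj_on w {..m}"
    using rtranclp_simple_path[of ?R b x] x(1) by (auto simp: branch_def)
  have "m \<noteq> 0" using w(1,2) \<open>x \<noteq> b\<close> by (cases m) auto
  have na: "w i \<noteq> a" if "i \<le> m" for i
    using that w(1,3) ab irrefl by (cases i) auto
  let ?w = "case_nat a w"
  have "inj_on ?w {..Suc m}"
    using w(4) na by (auto simp: inj_on_def split: nat.splits)
  moreover have "E (?w i) (?w (Suc i))" if "i < Suc m" for i
    using that w(1,3) ab by (cases i) auto
  ultimately have "\<not> E (?w (Suc m)) (?w 0)"
    using no_closed_walk[of "Suc m" ?w] \<open>m \<noteq> 0\<close> by simp
  then show False using x(2) w(2) by simp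
qed

lemma branch_cover: "x \<in> branch a b \<or> x \<in> branch b a"
  using connected[of a x]
proof (induction rule: rtranclp_induct)
  case (step y z)
  then show ?case using branch_step branch_base by metis
qed (simp add: branch_base)

lemma branch_disjoint:
  assumes ab: "E a b" and x: "x \<in> branch b a" shows "x \<notin> branch a b"
  using x
proof (induction rule: branch_induct)
  case base
  then show ?case using root_notin_branch ab irrefl by metis
next
  case (step x y)
  then show ?case using branch_step[of y a b x] branch_attached[OF ab, of y] sym by metis
qed

lemma branch_nested:
  assumes "E a b" "E b c" "c \<noteq> a" shows "branch b c \<subseteq> branch a b"
proof
  fix x assume "x \<in> branch b c"
  then show "x \<in> branch a b"
  proof (induction rule: branch_induct)
    case base
    show ?case using branch_step[OF branch_base] assms by blast
  next
    case (step x y)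
    have "a \<notin> branch b c" using branch_attached[of b c a] assms by auto
    then have "y \<noteq> a" using branch_step[OF step(1,2,3)] by blast
    then show ?case using branch_step[OF step(4,2)] by blast
  qed
qed

section \<open>Constructing automorphisms\<close>

text \<open>
  A morphism that is injective on neighbours maps walks without backtracking to such walks, so it is
  injective; by counting neighbours it is onto. Automorphisms are therefore recognized by a local
  condition, which makes it easy to define them piecewise or recursively.
\<close>

lemma mem_tree_autI:
  assumes E: "\<And>x y. E x y \<Longrightarrow> E (f x) (f y)"
    and inj: "\<And>x y z. E x y \<Longrightarrow> E x z \<Longrightarrow> f y = f z \<Longrightarrow> y = z"
  shows "f \<in> tree_aut E"
proof -
  have "inj f"
  proof (rule injI)
    fix x y assume eq: "f x = f y"
    obtain m w where w: "w 0 = x" "w m = y" "\<forall>i<m. E (w i) (w (Suc i))" "inj_on w {..m}"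
      using rtranclp_simple_path[OF connected] by blast
    have "inj_on (\<lambda>i. f (w i)) {..m}"
    proof (rule non_backtracking_inj)
      fix i assume i: "Suc (Suc i) \<le> m"
      then have "w i \<noteq> w (Suc (Suc i))" using w(4) by (auto dest: inj_onD)
      moreover have "E (w (Suc i)) (w i)" "E (w (Suc i)) (w (Suc (Suc i)))"
        using w(3) i sym by auto
      ultimately show "f (w i) \<noteq> f (w (Suc (Suc i)))" using inj by blast
    qed (use w(3) E in auto)
    then have "m = 0" using eq w(1,2) by (auto dest!: inj_onD[of _ _ 0 m])
    then show "x = y" using w by simp
  qed
  have nbrs: "f ` {y. E x y} = {z. E (f x) z}" for x
  proof (rule card_subset_eq[OF finite_nbrs])
    show "f ` {y. E x y} \<subseteq> {z. E (f x) z}" using E by auto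
    show "card (f ` {y. E x y}) = card {z. E (f x) z}"
      using \<open>inj f\<close> by (subst card_image) (auto simp: card_nbrs inj_on_def)
  qed
  have surj: "z \<in> range f" for z
    using connected[of "f undefined" z]
  proof (induction rule: rtranclp_induct)
    case (step y z)
    then obtain x where "y = f x" by blast
    then show ?case using nbrs[of x] step(2) by blast
  qed simp
  have E': "E x y" if "E (f x) (f y)" for x y
  proof -
    have "f y \<in> f ` {y. E x y}" using nbrs[of x] that by simp
    then show ?thesis using \<open>inj f\<close> by (simp add: inj_image_mem_iff)
  qed
  have "bij f" unfolding bij_def using \<open>inj f\<close> surj by blast
  then show ?thesis unfolding tree_aut_def using E E' by blast
qed

lemma tree_autD: "f \<in> tree_aut E \<Longrightarrow> E (f x) (f y) \<longleftrightarrow> E x y"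
  and tree_aut_inj: "f \<in> tree_aut E \<Longrightarrow> f x = f y \<longleftrightarrow> x = y"
  and tree_aut_inv_left: "f \<in> tree_aut E \<Longrightarrow> inv_into UNIV f (f x) = x"
  and tree_aut_inv_right: "f \<in> tree_aut E \<Longrightarrow> f (inv_into UNIV f x) = x"
  by (auto simp: tree_aut_def bij_def inj_eq surj_f_inv_f)

lemma tree_aut_branch:
  assumes f: "f \<in> tree_aut E" and x: "x \<in> branch a b" shows "f x \<in> branch (f a) (f b)"
  using x
proof (induction rule: branch_induct)
  case (step x y)
  then show ?case using branch_step[of "f x" "f a" "f b" "f y"] by (simp add: tree_autD[OF f] tree_aut_inj[OF f])
qed (rule branch_base)

text \<open>
  A branch is joined to the rest of the tree by a single edge, so a map of the branch and an
  automorphism fit together as soon as they agree on that edge.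
\<close>

lemma tree_aut_glue:
  assumes ab: "E a b" and f: "f \<in> tree_aut E" "f a = \<theta> a" "f b = \<theta> b" and \<theta>: "inj \<theta>"
    and E\<theta>: "\<And>x y. x \<in> branch a b \<Longrightarrow> E x y \<Longrightarrow> E (\<theta> x) (\<theta> y)"
  shows "(\<lambda>x. if x \<in> branch a b then \<theta> x else f x) \<in> tree_aut E" (is "?g \<in> _")
proof (rule mem_tree_autI)
  have inner: "?g y = \<theta> y" if "x \<in> branch a b" "E x y" for x y
    using that branch_step f by auto
  have outer: "?g y = f y" if "x \<notin> branch a b" "E x y" for x y
  proof (cases "y \<in> branch a b")
    case True
    then have "x = a" using branch_step[of y a b x] that sym by blast
    then have "y = b" using branch_attached[OF ab True] that sym by blast
    then show ?thesis using f by simp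
  qed simp
  fix x y assume xy: "E x y"
  show "E (?g x) (?g y)"
    using inner[OF _ xy] outer[OF _ xy] E\<theta>[OF _ xy] tree_autD[OF f(1)] xy by (cases "x \<in> branch a b") auto
  fix z assume xz: "E x z" and eq: "?g y = ?g z"
  show "y = z"
  proof (cases "x \<in> branch a b")
    case True
    then show ?thesis using inner[OF True xy] inner[OF True xz] eq \<theta> by (simp add: inj_eq)
  next
    case False
    then show ?thesis
      using outer[OF False xy] outer[OF False xz] eq tree_aut_inj[OF f(1)] by simp
  qed
qed

lemma parent_exists:
  assumes "x \<noteq> a"
  shows "\<exists>!y. E x y \<and> a \<in> branch x y"
proof -
  obtain m w where w: "w 0 = x" "w m = a" "\<forall>i<m. E (w i) (w (Suc i))" "inj_on w {..m}"
    using rtranclp_simple_path[OF connected] by blast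
  have m: "m > 0" using w(1,2) assms by (cases m) auto
  have "w (Suc i) \<in> branch x (w 1)" if "i < m" for i
    using that
  proof (induction i)
    case (Suc i)
    have "w (Suc (Suc i)) \<noteq> w 0" using w(4) Suc.prems by (auto dest!: inj_onD)
    then show ?case using branch_step Suc w by simp
  qed (simp add: branch_base)
  from this[of "m - 1"] have ex: "E x (w 1) \<and> a \<in> branch x (w 1)" using w m by auto
  moreover have "y = z" if y: "E x y" "a \<in> branch x y" and z: "E x z" "a \<in> branch x z" for y z
  proof -
    have "u \<noteq> x \<longrightarrow> u \<in> branch x z" if "(\<lambda>u v. E u v \<and> v \<noteq> x)\<^sup>*\<^sup>* u a" for u
      using that
    proof (induction rule: converse_rtranclp_induct)
      case (step u v)
      then show ?case using branch_step[of v x z u] sym[of u v] by blast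
    qed (use z in simp)
    then have "y \<in> branch x z" using y irrefl unfolding branch_def by blast
    then show "y = z" using branch_attached[OF z(1)] y(1) sym by blast
  qed
  ultimately show ?thesis by blast
qed

lemma tree_aut_id: "id \<in> tree_aut E"
  by (simp add: tree_aut_def)

text \<open>
  The tree is rooted at \<open>a\<close> and mapped generation by generation: the children of a vertex are mapped
  by an arbitrary bijection to those neighbours of the image that are still free.
\<close>

lemma ex_tree_aut_extending:
  assumes \<tau>0: "bij_betw \<tau>0 {y. E a y} {y. E a' y}"
  shows "\<exists>f\<in>tree_aut E. f a = a' \<and> (\<forall>y. E a y \<longrightarrow> f y = \<tau>0 y)"
proof -
  \<comment> \<open>The neighbour of \<open>x\<close> on the way to the root \<open>a\<close>; the value at \<open>a\<close> itself is arbitrary.\<close>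
  define par where "par x = (THE y. E x y \<and> a \<in> branch x y)" for x
  have par: "E x (par x)" "a \<in> branch x (par x)" if "x \<noteq> a" for x
    using theI'[OF parent_exists[OF that]] by (auto simp: par_def)
  have par_eq: "par x = y" if "x \<noteq> a" "E x y" "a \<in> branch x y" for x y
    unfolding par_def using that by (intro the1_equality[OF parent_exists]) auto
  have edge: "x \<noteq> a \<and> par x = y \<or> y \<noteq> a \<and> par y = x" if "E x y" for x y
  proof (cases "a \<in> branch x y")
    case True
    then have "x \<noteq> a" using root_notin_branch[of x y] that irrefl by auto
    then show ?thesis using par_eq that True by blast
  next
    case False
    then have a: "a \<in> branch y x" using branch_cover by blast
    then have "y \<noteq> a" using root_notin_branch[of y x] that irrefl by auto
    then show ?thesis using par_eq[OF _ sym[OF that] a] by blast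
  qed
  have antisym: "par (par x) \<noteq> x" if "x \<noteq> a" "par x \<noteq> a" for x
    using branch_disjoint[OF par(1)[OF that(1)]] par[OF that(1)] par(2)[OF that(2)] by auto
  define r where "r = {(par x, x) |x. x \<noteq> a}"
  have "x \<in> Wellfounded.acc r" for x
    using connected[of a x]
  proof (induction rule: rtranclp_induct)
    case base
    show ?case by (rule acc.intros) (auto simp: r_def)
  next
    case (step x y)
    show ?case
    proof (cases "y \<noteq> a \<and> par y = x")
      case True
      show ?thesis by (rule acc.intros) (use True step(3) in \<open>auto simp: r_def\<close>)
    next
      case False
      then have "(y, x) \<in> r" using edge[OF step(2)] by (auto simp: r_def)
      then show ?thesis using acc_downward[OF step(3)] by blast
    qed
  qed
  then have wf: "wf r" by (rule acc_wfI[OF allI])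
  define \<tau> where
    "\<tau> u w u' w' = (SOME \<sigma>. bij_betw \<sigma> ({y. E u y} - {w}) ({y. E u' y} - {w'}))" for u w u' w'
  have \<tau>: "bij_betw (\<tau> u w u' w') ({y. E u y} - {w}) ({y. E u' y} - {w'})"
    if "E u w" "E u' w'" for u w u' w'
  proof -
    have "\<exists>\<sigma>. bij_betw \<sigma> ({y. E u y} - {w}) ({y. E u' y} - {w'})"
      using that by (intro finite_same_card_bij) (auto simp: finite_nbrs card_nbrs)
    then show ?thesis unfolding \<tau>_def by (rule someI_ex)
  qed
  define H where "H G x = (if x = a then a' else if par x = a then \<tau>0 x
      else \<tau> (par x) (par (par x)) (G (par x)) (G (par (par x))) x)" for G :: "'v \<Rightarrow> 'v" and x
  \<comment> \<open>The recursion refers to the parent and the grandparent, hence the transitive closure.\<close>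
  define f where "f = wfrec (r\<^sup>+) H"
  have f: "f x = H f x" for x
  proof (cases "x = a \<or> par x = a")
    case True
    then show ?thesis unfolding f_def by (subst wfrec[OF wf_trancl[OF wf]]) (auto simp: H_def)
  next
    case False
    then have "(par x, x) \<in> r" "(par (par x), par x) \<in> r" by (auto simp: r_def)
    then have "(par x, x) \<in> r\<^sup>+" "(par (par x), x) \<in> r\<^sup>+" by auto
    then show ?thesis
      unfolding f_def by (subst wfrec[OF wf_trancl[OF wf]]) (auto simp: H_def cut_apply)
  qed
  have fa: "f a = a'" by (simp add: f H_def)
  have f0: "f x = \<tau>0 x" if "x \<noteq> a" "par x = a" for x using that by (subst f) (simp add: H_def)
  have f1: "f x = \<tau> (par x) (par (par x)) (f (par x)) (f (par (par x))) x"
    if "x \<noteq> a" "par x \<noteq> a" for x using that by (subst f) (simp add: H_def)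
  have nbr0: "f y = \<tau>0 y" if "E a y" for y using f0 edge[OF that] by auto
  have child: "f y = \<tau> x (par x) (f x) (f (par x)) y" "y \<noteq> a" "par y = x"
    if "x \<noteq> a" "E x y" "y \<noteq> par x" for x y
    using edge[OF that(2)] that f1[of y] by auto
  have up: "x \<noteq> a \<longrightarrow> E (f (par x)) (f x)" for x
    using wf
  proof (induction x rule: wf_induct_rule)
    case (less x)
    show ?case
    proof
      assume x: "x \<noteq> a"
      show "E (f (par x)) (f x)"
      proof (cases "par x = a")
        case True
        then have "E a x" using par(1)[OF x] sym by metis
        then show ?thesis using bij_betwE[OF \<tau>0] fa True nbr0 by auto
      next
        case False
        let ?u = "par x"
        have "E (f (par ?u)) (f ?u)" using less[of ?u] x False by (auto simp: r_def)
        then have "bij_betw (\<tau> ?u (par ?u) (f ?u) (f (par ?u)))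
            ({y. E ?u y} - {par ?u}) ({y. E (f ?u) y} - {f (par ?u)})"
          using \<tau> par(1)[OF False] sym by blast
        then have "\<forall>y\<in>{y. E ?u y} - {par ?u}. \<tau> ?u (par ?u) (f ?u) (f (par ?u)) y
            \<in> {y. E (f ?u) y} - {f (par ?u)}" by (rule bij_betwE)
        moreover have "x \<in> {y. E ?u y} - {par ?u}"
          using sym[OF par(1)[OF x]] antisym[OF x False] by auto
        ultimately have "f x \<in> {y. E (f ?u) y} - {f (par ?u)}"
          using f1[OF x False] by simp
        then show ?thesis by simp
      qed
    qed
  qed
  have "f \<in> tree_aut E"
  proof (rule mem_tree_autI)
    fix x y assume xy: "E x y"
    then show "E (f x) (f y)" using edge[OF xy] up[of x] up[of y] sym by metis
    fix z assume xz: "E x z" and eq: "f y = f z"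
    show "y = z"
    proof (cases "x = a")
      case True
      then show ?thesis using eq nbr0 xy xz bij_betw_imp_inj_on[OF \<tau>0] by (auto simp: inj_on_def)
    next
      case False
      let ?\<tau> = "\<tau> x (par x) (f x) (f (par x))"
      have "bij_betw ?\<tau> ({y. E x y} - {par x}) ({y. E (f x) y} - {f (par x)})"
        using \<tau>[OF par(1)[OF False]] up[of x] False sym by blast
      then have inj: "inj_on ?\<tau> ({y. E x y} - {par x})"
        and out: "\<And>y. E x y \<Longrightarrow> y \<noteq> par x \<Longrightarrow> ?\<tau> y \<noteq> f (par x)"
        by (auto simp: bij_betw_def)
      have ne: "f u \<noteq> f (par x)" if "E x u" "u \<noteq> par x" for u
        using out[OF that] child(1)[OF False that] by simp
      show ?thesis
      proof (cases "y = par x \<or> z = par x")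
        case True
        then show ?thesis using ne[OF xy] ne[OF xz] eq by metis
      next
        case no: False
        then have "?\<tau> y = ?\<tau> z" using child(1)[OF False xy] child(1)[OF False xz] eq by simp
        then show ?thesis using inj_onD[OF inj] no xy xz by simp
      qed
    qed
  qed
  then show ?thesis using fa nbr0 by blast
qed

lemma tree_aut_edge_transitive:
  assumes "E a b" "E a' b'"
  shows "\<exists>f\<in>tree_aut E. f a = a' \<and> f b = b'"
proof -
  obtain \<sigma> where \<sigma>: "bij_betw \<sigma> {y. E a y} {y. E a' y}"
    using finite_same_card_bij[OF finite_nbrs finite_nbrs] card_nbrs by metis
  have "bij_betw (Transposition.transpose (\<sigma> b) b' \<circ> \<sigma>) {y. E a y} {y. E a' y}"
    by (rule bij_betw_trans[OF \<sigma>], rule permutes_imp_bij, rule permutes_swap_id)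
       (use assms bij_betwE[OF \<sigma>] in auto)
  from ex_tree_aut_extending[OF this] show ?thesis using assms by auto
qed

lemma tree_aut_swap_nbrs:
  assumes "E a c" "E a d"
  shows "\<exists>f\<in>tree_aut E. f a = a \<and> f c = d \<and> (\<forall>y. E a y \<longrightarrow> y \<noteq> c \<longrightarrow> y \<noteq> d \<longrightarrow> f y = y)"
proof -
  have "bij_betw (Transposition.transpose c d) {y. E a y} {y. E a y}"
    by (rule permutes_imp_bij, rule permutes_swap_id) (use assms in auto)
  from ex_tree_aut_extending[OF this] show ?thesis using assms by auto
qed

section \<open>Translations\<close>

lemma tree_aut_funpow: "s \<in> tree_aut E \<Longrightarrow> s ^^ j \<in> tree_aut E"
proof (induction j)
  case 0
  then show ?case by (simp add: tree_aut_def id_def[symmetric])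
qed (simp add: tree_aut_comp)

lemma translation_branch:
  assumes s: "s \<in> tree_aut E" "s a = b" "s b = c" "E a b" "c \<noteq> a"
    and x: "x \<in> branch a b"
  shows "s x \<in> branch a b"
proof -
  have "E b c" using s tree_autD[OF s(1), of a b] by simp
  then show ?thesis using branch_nested[OF s(4) _ s(5)] tree_aut_branch[OF s(1) x] s by auto
qed

text \<open>
  The iterates of a translation push every vertex into the branch ahead: this holds for \<open>b\<close>, and it
  is inherited by neighbours, because a branch can be left through its root only.
\<close>

lemma translation_attracts:
  assumes s: "s \<in> tree_aut E" "s a = b" "s b = c" "E a b" "c \<noteq> a" and X: "finite X"
  shows "\<exists>j. \<forall>x\<in>X. (s ^^ j) x \<in> branch a b"
proof -
  have step: "(s ^^ (j + k)) x \<in> branch a b" if "(s ^^ j) x \<in> branch a b" for j k x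
    using that translation_branch[OF s(1-5)] by (induction k) auto
  have attracted: "\<exists>j. (s ^^ j) x \<in> branch a b" for x
    using connected[of b x]
  proof (induction rule: rtranclp_induct)
    case base
    show ?case by (rule exI[of _ 0]) (simp add: branch_base)
  next
    case (step x y)
    then obtain j where j: "(s ^^ j) x \<in> branch a b" by blast
    have "E ((s ^^ j) x) ((s ^^ j) y)" using tree_autD[OF tree_aut_funpow[OF s(1)]] step by blast
    then have "(s ^^ j) y = a \<or> (s ^^ j) y \<in> branch a b" using branch_step[OF j] by blast
    moreover have "(s ^^ Suc j) y = b" if "(s ^^ j) y = a" using that s(2) by simp
    ultimately show ?case using branch_base by metis
  qed
  show ?thesis
    using X
  proof induction
    case (insert x X)
    then obtain i where i: "\<forall>x\<in>X. (s ^^ i) x \<in> branch a b" by blast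
    obtain j where "(s ^^ j) x \<in> branch a b" using attracted by blast
    then have "(s ^^ (i + j)) x \<in> branch a b" using step[of j x i] by (simp add: add.commute)
    then show ?case using i step[of i _ j] by auto
  qed simp
qed

lemma ex_translation:
  assumes "n \<ge> 2"
  shows "\<exists>s a b c. s \<in> tree_aut E \<and> s a = b \<and> s b = c \<and> E a b \<and> c \<noteq> a"
proof -
  fix b :: 'v
  obtain a c where ac: "E b a" "E b c" "c \<noteq> a"
  proof -
    have "\<not> card {y. E b y} \<le> 1" using card_nbrs[of b] assms by simp
    then show ?thesis using that card_le_Suc0_iff_eq[OF finite_nbrs[of b]] by auto
  qed
  then show ?thesis using tree_aut_edge_transitive[of a b b c] sym by metis
qed

text \<open>
  Conjugation by \<open>s\<close> brings the stabilizer of the edge \<open>b c\<close> into \<open>\<Gamma>\<close>, too. The stabilizer of \<open>a b\<close>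
  permutes all neighbours of \<open>b\<close> except \<open>a\<close>, that of \<open>b c\<close> all except \<open>c\<close>. As \<open>b\<close> has a third
  neighbour, the two together are transitive on the neighbours of \<open>b\<close>, so \<open>\<Gamma>\<close> contains the
  stabilizer of \<open>b\<close>. With \<open>s\<close> it is then transitive on vertices, hence everything.
\<close>

lemma tree_aut_generated:
  assumes "n \<ge> 2" and s: "s \<in> tree_aut E" "s a = b" "s b = c" "E a b" "c \<noteq> a"
    and \<Gamma>: "s \<in> \<Gamma>" "\<And>f g. f \<in> \<Gamma> \<Longrightarrow> g \<in> \<Gamma> \<Longrightarrow> f \<circ> g \<in> \<Gamma>"
      "\<And>f. f \<in> \<Gamma> \<Longrightarrow> inv_into UNIV f \<in> \<Gamma>" "\<Gamma> \<subseteq> tree_aut E"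
    and edge: "\<And>f. f \<in> tree_aut E \<Longrightarrow> f a = a \<Longrightarrow> f b = b \<Longrightarrow> f \<in> \<Gamma>"
  shows "f \<in> tree_aut E \<Longrightarrow> f \<in> \<Gamma>"
proof -
  have bc: "E b c" using s tree_autD[OF s(1), of a b] by simp
  note inv = tree_aut_inv_left tree_aut_inv_right
  have edge': "f \<in> \<Gamma>" if f: "f \<in> tree_aut E" "f b = b" "f c = c" for f
  proof -
    let ?i = "inv_into UNIV s"
    have i: "?i b = a" "?i c = b" using inv(1)[OF s(1)] s(2,3) by metis+
    have "?i \<circ> f \<circ> s \<in> \<Gamma>"
      using i f(2,3) s(2,3) tree_aut_comp[OF tree_aut_comp[OF tree_aut_inv[OF s(1)] f(1)] s(1)]
      by (intro edge) simp_all
    then have "s \<circ> (?i \<circ> f \<circ> s) \<circ> ?i \<in> \<Gamma>" using \<Gamma> by blast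
    moreover have "s \<circ> (?i \<circ> f \<circ> s) \<circ> ?i = f" using inv[OF s(1)] by (auto simp: fun_eq_iff)
    ultimately show ?thesis by simp
  qed
  have move: "\<exists>\<gamma>\<in>\<Gamma>. \<gamma> b = b \<and> \<gamma> a = x" if x: "E b x" for x
  proof -
    have ba: "E b a" using sym s(4) .
    have id: "id \<in> \<Gamma>" by (rule edge) (auto simp: tree_aut_def)
    have away: "\<exists>\<gamma>\<in>\<Gamma>. \<gamma> b = b \<and> \<gamma> a = x" if x: "E b x" "x \<noteq> c" for x
      using tree_aut_swap_nbrs[OF ba x(1)] edge' bc s(5) x(2) by metis
    show ?thesis
    proof (cases "x = c")
      case True
      obtain d where d: "E b d" "d \<noteq> a" "d \<noteq> c"
      proof -
        have "\<not> {y. E b y} \<subseteq> {a, c}"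
          using card_mono[of "{a, c}" "{y. E b y}"] card_nbrs[of b] \<open>n \<ge> 2\<close> s(5) by auto
        then show ?thesis using that by auto
      qed
      obtain \<gamma> where \<gamma>: "\<gamma> \<in> \<Gamma>" "\<gamma> b = b" "\<gamma> a = d" using away d by blast
      obtain \<delta> where \<delta>: "\<delta> \<in> tree_aut E" "\<delta> b = b" "\<delta> d = c" "\<delta> a = a"
        using tree_aut_swap_nbrs[OF d(1) bc] ba d(2) s(5) by metis
      then have "\<delta> \<in> \<Gamma>" using edge by blast
      then show ?thesis using \<gamma> \<delta> \<Gamma>(2)[of \<delta> \<gamma>] True by (intro bexI[of _ "\<delta> \<circ> \<gamma>"]) auto
    qed (use away x in blast)
  qed
  have stab: "f \<in> \<Gamma>" if f: "f \<in> tree_aut E" "f b = b" for f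
  proof -
    have "E b (f a)" using tree_autD[OF f(1), of b a] f(2) s(4) sym by simp
    then obtain \<gamma> where \<gamma>: "\<gamma> \<in> \<Gamma>" "\<gamma> b = b" "\<gamma> a = f a" using move by blast
    then have \<gamma>t: "\<gamma> \<in> tree_aut E" using \<Gamma> by blast
    let ?i = "inv_into UNIV \<gamma>"
    have "?i b = b" "?i (f a) = a" using inv(1)[OF \<gamma>t] \<gamma> by metis+
    then have "?i \<circ> f \<in> \<Gamma>" using f tree_aut_comp[OF tree_aut_inv[OF \<gamma>t] f(1)] by (intro edge) simp_all
    then have "\<gamma> \<circ> (?i \<circ> f) \<in> \<Gamma>" using \<Gamma> \<gamma> by blast
    moreover have "\<gamma> \<circ> (?i \<circ> f) = f" using inv[OF \<gamma>t] by (auto simp: fun_eq_iff)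
    ultimately show ?thesis by simp
  qed
  have orbit: "\<exists>\<gamma>\<in>\<Gamma>. \<gamma> b = x" for x
    using connected[of b x]
  proof (induction rule: rtranclp_induct)
    case base
    have "id \<in> \<Gamma>" by (rule edge) (auto simp: tree_aut_def)
    then show ?case by (intro bexI[of _ id]) auto
  next
    case (step x y)
    then obtain \<gamma> where \<gamma>: "\<gamma> \<in> \<Gamma>" "\<gamma> b = x" by blast
    then have \<gamma>t: "\<gamma> \<in> tree_aut E" using \<Gamma> by blast
    let ?z = "inv_into UNIV \<gamma> y"
    have "E b ?z" using step(2) \<gamma>(2) inv(2)[OF \<gamma>t, of y] tree_autD[OF \<gamma>t] by metis
    then obtain \<delta> where \<delta>: "\<delta> \<in> tree_aut E" "\<delta> b = b" "\<delta> c = ?z"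
      using tree_aut_edge_transitive[OF bc] by blast
    then have "\<gamma> \<circ> (\<delta> \<circ> s) \<in> \<Gamma>" by (intro \<Gamma>(1,2) stab \<delta>(1,2) \<gamma>(1))
    moreover have "(\<gamma> \<circ> (\<delta> \<circ> s)) b = y" using s \<delta> inv(2)[OF \<gamma>t] by simp
    ultimately show ?case by blast
  qed
  assume f: "f \<in> tree_aut E"
  obtain \<gamma> where \<gamma>: "\<gamma> \<in> \<Gamma>" "\<gamma> b = f b" using orbit by blast
  then have \<gamma>t: "\<gamma> \<in> tree_aut E" using \<Gamma> by blast
  let ?i = "inv_into UNIV \<gamma>"
  have "?i (f b) = b" using inv(1)[OF \<gamma>t] \<gamma>(2) by metis
  then have "?i \<circ> f \<in> \<Gamma>" using f tree_aut_comp[OF tree_aut_inv[OF \<gamma>t] f] by (intro stab) simp_all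
  then have "\<gamma> \<circ> (?i \<circ> f) \<in> \<Gamma>" using \<Gamma> \<gamma> by blast
  moreover have "\<gamma> \<circ> (?i \<circ> f) = f" using inv[OF \<gamma>t] by (auto simp: fun_eq_iff)
  ultimately show "f \<in> \<Gamma>" by simp
qed

lemma tree_aut_fix_edge_decompose:
  assumes ab: "E a b" and f: "f \<in> tree_aut E" "f a = a" "f b = b"
  shows "\<exists>g\<in>tree_aut E. \<exists>h\<in>tree_aut E. f = g \<circ> h \<and> (\<forall>x\<in>branch b a. g x = x) \<and> (\<forall>x\<in>branch a b. h x = x)"
proof -
  define g where "g = (\<lambda>x. if x \<in> branch a b then f x else id x)"
  have inj: "inj f" using f(1) by (simp add: tree_aut_def bij_def)
  have g: "g \<in> tree_aut E"
    unfolding g_def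
    by (rule tree_aut_glue[OF ab tree_aut_id _ _ inj]) (use f(2,3) tree_autD[OF f(1)] in auto)
  let ?h = "inv_into UNIV g \<circ> f"
  have h: "?h \<in> tree_aut E" using tree_aut_comp[OF tree_aut_inv[OF g] f(1)] .
  have "f = g \<circ> ?h" using tree_aut_inv_right[OF g] by (simp add: fun_eq_iff)
  moreover have "\<forall>x\<in>branch b a. g x = x" using branch_disjoint[OF ab] by (auto simp: g_def)
  moreover have "\<forall>x\<in>branch a b. ?h x = x"
  proof
    fix x assume "x \<in> branch a b"
    then have "f x = g x" by (simp add: g_def)
    then show "?h x = x" using tree_aut_inv_left[OF g, of x] by simp
  qed
  ultimately show ?thesis using g h by blast
qed

section \<open>Almost automorphisms near infinity\<close>

text \<open>
  A translation moves the finitely many vertices at which \<open>\<theta>\<close> fails to preserve adjacency into one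
  branch; moved back, the opposite branch avoids them all.
\<close>

lemma ex_undisturbed_branch:
  assumes "n \<ge> 2" and \<theta>: "\<theta> \<in> almost_aut E"
  shows "\<exists>a b. E a b \<and> (\<forall>x\<in>branch a b. \<forall>y. E x y \<longrightarrow> E (\<theta> x) (\<theta> y))"
proof -
  let ?X = "fst ` {(a, b). E a b \<and> \<not> E (\<theta> a) (\<theta> b)}"
  have fin: "finite ?X" using \<theta> by (simp add: almost_aut_def)
  obtain s a b c where s: "s \<in> tree_aut E" "s a = b" "s b = c" "E a b" "c \<noteq> a"
    using ex_translation[OF assms(1)] by blast
  obtain j where j: "\<And>x. x \<in> ?X \<Longrightarrow> (s ^^ j) x \<in> branch a b"
    using translation_attracts[OF s fin] by blast
  let ?t = "s ^^ j"
  have t: "?t \<in> tree_aut E" using tree_aut_funpow[OF s(1)] .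
  let ?a = "inv_into UNIV ?t a" and ?b = "inv_into UNIV ?t b"
  have ab: "E ?a ?b" using tree_autD[OF tree_aut_inv[OF t]] s(4) by blast
  have "E (\<theta> x) (\<theta> y)" if x: "x \<in> branch ?b ?a" and xy: "E x y" for x y
  proof (rule ccontr)
    assume "\<not> ?thesis"
    then have "x \<in> ?X" using xy by force
    then have "?t x \<in> branch a b" by (rule j)
    moreover have "?t x \<in> branch b a"
      using tree_aut_branch[OF t x] by (simp add: tree_aut_inv_right[OF t])
    ultimately show False using branch_disjoint[OF s(4)] by blast
  qed
  then show ?thesis using sym[OF ab] by blast
qed

lemma almost_aut_extends:
  assumes "n \<ge> 2" and \<theta>: "\<theta> \<in> almost_aut E"
  shows "\<exists>a b. E a b \<and> (\<exists>f\<in>tree_aut E. f a = \<theta> a \<and> (\<forall>x\<in>branch a b. f x = \<theta> x))"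
proof -
  obtain a b where ab: "E a b" and good: "\<And>x y. x \<in> branch a b \<Longrightarrow> E x y \<Longrightarrow> E (\<theta> x) (\<theta> y)"
    using ex_undisturbed_branch[OF assms] by blast
  have "E (\<theta> a) (\<theta> b)" using good[OF branch_base sym[OF ab]] sym by blast
  then obtain f0 where f0: "f0 \<in> tree_aut E" "f0 a = \<theta> a" "f0 b = \<theta> b"
    using tree_aut_edge_transitive[OF ab] by blast
  have inj: "inj \<theta>" using \<theta> by (simp add: almost_aut_def bij_def)
  have "a \<notin> branch a b" using root_notin_branch[of a b] ab irrefl by auto
  then show ?thesis
    using tree_aut_glue[OF ab f0 inj good] f0(2) ab by (intro exI conjI bexI) auto
qed

section \<open>Ends and shadows\<close>

lemma ray_prepend:
  assumes r: "ray E r" and x: "E x (r 0)" "x \<noteq> r 1"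
  shows "ray E (case_nat x r)"
proof -
  have E: "E (r k) (r (Suc k))" for k using r by (simp add: ray_def)
  have inj: "inj r" using r by (simp add: ray_def)
  have "r k \<noteq> x" for k
  proof
    assume k: "r k = x"
    have "k \<noteq> 0" "k \<noteq> 1" using k x irrefl by (auto intro: ccontr)
    then have "\<not> E (r k) (r 0)"
      by (intro no_closed_walk) (use E inj in \<open>auto intro: inj_on_subset\<close>)
    then show False using k x by simp
  qed
  then have "inj (case_nat x r)" using inj by (auto simp: inj_on_def split: nat.splits)
  moreover have "E (case_nat x r k) (case_nat x r (Suc k))" for k
    using E x by (cases k) auto
  ultimately show ?thesis by (simp add: ray_def)
qed

lemma end_of_prepend:
  assumes "ray E (case_nat x r)" shows "end_of E (case_nat x r) = end_of E r"
  using end_of_shift[OF assms, of 1] by simp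

text \<open>
  A ray can be rerouted to start at a neighbour of its first vertex, by dropping or by prepending a
  vertex.
\<close>

lemma ends_from:
  assumes e: "e \<in> ends E"
  shows "\<exists>r. ray E r \<and> r 0 = a \<and> e = end_of E r"
proof -
  obtain r where r: "ray E r" "e = end_of E r" using e by (auto simp: ends_eq)
  show ?thesis
    using connected[of "r 0" a]
  proof (induction rule: rtranclp_induct)
    case (step x y)
    then obtain q where q: "ray E q" "q 0 = x" "e = end_of E q" by blast
    show ?case
    proof (cases "y = q 1")
      case True
      then show ?thesis using ray_shift[OF q(1), of 1] end_of_shift[OF q(1), of 1] q
        by (intro exI[of _ "\<lambda>k. q (1 + k)"]) auto
    next
      case False
      then have "ray E (case_nat y q)" using ray_prepend q step(2) sym by blast
      then show ?thesis using end_of_prepend q by (intro exI[of _ "case_nat y q"]) auto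
    qed
  qed (use r in blast)
qed

lemma shadow_cover:
  assumes ab: "E a b" and e: "e \<in> ends E"
  shows "e \<in> shadow E a b \<or> e \<in> shadow E b a"
proof -
  obtain r where r: "ray E r" "r 0 = a" "e = end_of E r" using ends_from[OF e] by blast
  show ?thesis
  proof (cases "r 1 = b")
    case True
    then show ?thesis using r by (auto simp: shadow_def)
  next
    case False
    then have "ray E (case_nat b r)" using ray_prepend[OF r(1)] r(2) sym[OF ab] by auto
    then have "e \<in> shadow E b a"
      unfolding shadow_def using r end_of_prepend by (intro CollectI exI[of _ "case_nat b r"]) auto
    then show ?thesis by blast
  qed
qed

lemma shadow_nested:
  assumes "E a b" "c \<noteq> a" shows "shadow E b c \<subseteq> shadow E a b"
proof
  fix e assume "e \<in> shadow E b c"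
  then obtain r where r: "ray E r" "r 0 = b" "r 1 = c" "e = end_of E r" by (auto simp: shadow_def)
  then have "ray E (case_nat a r)" using ray_prepend[OF r(1)] assms by auto
  then show "e \<in> shadow E a b"
    unfolding shadow_def using r end_of_prepend by (intro CollectI exI[of _ "case_nat a r"]) auto
qed

lemma ray_in_branch:
  assumes r: "ray E r" shows "r (Suc k) \<in> branch (r 0) (r 1)"
proof (induction k)
  case (Suc k)
  have "r (Suc (Suc k)) \<noteq> r 0" using r by (auto simp: ray_def inj_eq)
  then show ?case using branch_step[OF Suc] r by (auto simp: ray_def)
qed (simp add: branch_base)

section \<open>Hierarchomorphisms with disjoint supports\<close>

abbreviation \<H> where "\<H> \<equiv> hier_group E"

text \<open>
  The homeomorphism of the space of ends induced by an automorphism; any ray may represent an end.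
\<close>

definition boundary :: "('v \<Rightarrow> 'v) \<Rightarrow> (nat \<Rightarrow> 'v) set \<Rightarrow> (nat \<Rightarrow> 'v) set" where
  "boundary f = (\<lambda>e\<in>ends E. end_of E (\<lambda>k. f ((SOME r. ray E r \<and> e = end_of E r) k)))"

lemma boundary_induces:
  assumes f: "f \<in> tree_aut E" shows "induces E f (boundary f)"
  unfolding induces_def
proof (intro conjI allI impI exI[of _ 0])
  show "boundary f \<in> extensional (ends E)" by (simp add: boundary_def)
  fix r assume r: "ray E r"
  then show "ray E (\<lambda>k. f (r (0 + k)))" using tree_aut_ray[OF f] by simp
  define q where "q = (SOME q. ray E q \<and> end_of E r = end_of E q)"
  have q: "ray E q \<and> end_of E r = end_of E q"
    using someI[of "\<lambda>q. ray E q \<and> end_of E r = end_of E q" r] r by (simp add: q_def)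
  then obtain i j where "\<forall>k. r (i + k) = q (j + k)" using end_of_eq[OF r] by blast
  then have "\<forall>k. f (r (i + k)) = f (q (j + k))" by simp
  then have "end_of E (\<lambda>k. f (r k)) = end_of E (\<lambda>k. f (q k))"
    using end_of_eq[OF tree_aut_ray[OF f r] tree_aut_ray[OF f]] q by blast
  then show "boundary f (end_of E r) = end_of E (\<lambda>k. f (r (0 + k)))"
    using end_of_in[OF r] by (simp add: boundary_def q_def)
qed

lemma boundary_end_of:
  "f \<in> tree_aut E \<Longrightarrow> ray E r \<Longrightarrow> boundary f (end_of E r) = end_of E (\<lambda>k. f (r k))"
  using tree_aut_induces_ray[OF _ boundary_induces] .

lemma aut_fixing_eq: "aut_fixing E S = boundary ` {f \<in> tree_aut E. \<forall>v\<in>S. f v = v}"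
  unfolding aut_fixing_def using boundary_induces induces_unique by blast

lemma aut_eq: "aut E = boundary ` tree_aut E"
  unfolding aut_def using boundary_induces induces_unique by blast

lemma boundary_hier: "f \<in> tree_aut E \<Longrightarrow> boundary f \<in> hier E"
  using aut_fixing_eq[of "{}"] aut_fixing_subset_hier[of E "{}"] by auto

lemma boundary_comp:
  assumes "f \<in> tree_aut E" "g \<in> tree_aut E"
  shows "boundary (f \<circ> g) = boundary f \<otimes>\<^bsub>\<H>\<^esub> boundary g"
proof -
  have "induces E (f \<circ> g) (compose (ends E) (boundary f) (boundary g))"
    by (intro induces_compose boundary_induces assms)
  then show ?thesis
    using induces_unique[OF boundary_induces[OF tree_aut_comp[OF assms]]]
    by (simp add: mult_hier_group boundary_hier assms)
qed

lemma boundary_id: "boundary id = \<one>\<^bsub>\<H>\<^esub>"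
  unfolding one_hier_group by (rule induces_unique[OF boundary_induces[OF tree_aut_id] induces_id])

lemma boundary_shadow:
  "f \<in> tree_aut E \<Longrightarrow> e \<in> shadow E a b \<Longrightarrow> boundary f e \<in> shadow E (f a) (f b)"
  using tree_aut_image_shadow[OF _ boundary_induces] by blast

lemma mult_hier_apply:
  "g \<in> hier E \<Longrightarrow> h \<in> hier E \<Longrightarrow> e \<in> ends E \<Longrightarrow> (g \<otimes>\<^bsub>\<H>\<^esub> h) e = g (h e)"
  by (simp add: mult_hier_group compose_def)

lemma shadow_ends: "e \<in> shadow E a b \<Longrightarrow> e \<in> ends E"
  by (auto simp: shadow_def end_of_in)

text \<open>
  On some branch the map \<open>\<theta>\<close> underlying \<open>g\<close> agrees with an automorphism \<open>f\<close>. Then \<open>f\<^sup>-\<^sup>1 g\<close> is trivial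
  on the ends of that branch, and a further conjugation carries this branch to the prescribed one.
\<close>

lemma hier_trivial_on_shadow:
  assumes n: "n \<ge> 2" and g: "g \<in> hier E" and ab: "E a b"
  shows "\<exists>k1\<in>aut E. \<exists>k2\<in>aut E. \<forall>e\<in>shadow E a b.
    (k1 \<otimes>\<^bsub>\<H>\<^esub> g \<otimes>\<^bsub>\<H>\<^esub> k2) e = e"
proof -
  interpret group "\<H>" by (rule group_hier[OF regular_tree])
  obtain \<theta> where \<theta>: "\<theta> \<in> almost_aut E" "induces E \<theta> g" using g by (auto simp: hier_def)
  obtain c d f where cd: "E c d" and f: "f \<in> tree_aut E" "f c = \<theta> c" "\<And>x. x \<in> branch c d \<Longrightarrow> f x = \<theta> x"
    using almost_aut_extends[OF n \<theta>(1)] by blast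
  obtain q where q: "q \<in> tree_aut E" "q a = c" "q b = d" using tree_aut_edge_transitive[OF ab cd] by blast
  let ?i = "inv_into UNIV (f \<circ> q)"
  have fq: "f \<circ> q \<in> tree_aut E" by (rule tree_aut_comp[OF f(1) q(1)])
  have "(boundary ?i \<otimes>\<^bsub>\<H>\<^esub> g \<otimes>\<^bsub>\<H>\<^esub> boundary q) e = e"
    if e: "e \<in> shadow E a b" for e
  proof -
    obtain r where r: "ray E r" "r 0 = a" "r 1 = b" "e = end_of E r" using e by (auto simp: shadow_def)
    have qr: "ray E (\<lambda>k. q (r k))" by (rule tree_aut_ray[OF q(1) r(1)])
    have "\<theta> (q (r k)) = (f \<circ> q) (r k)" for k
    proof (cases k)
      case (Suc m)
      then show ?thesis using f(3)[OF ray_in_branch[OF qr, of m, unfolded r q]] by simp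
    qed (use r q f in simp)
    moreover have fqr: "ray E (\<lambda>k. (f \<circ> q) (r k))" by (rule tree_aut_ray[OF fq r(1)])
    ultimately have "g (end_of E (\<lambda>k. q (r k))) = end_of E (\<lambda>k. (f \<circ> q) (r k))"
      using inducesD[OF \<theta>(2) qr, of 0] by simp
    moreover have "boundary ?i (end_of E (\<lambda>k. (f \<circ> q) (r k))) = e"
      using boundary_end_of[OF tree_aut_inv[OF fq] fqr] tree_aut_inv_left[OF fq] r(4) by simp
    moreover have "boundary ?i \<otimes>\<^bsub>\<H>\<^esub> g \<in> hier E"
      using m_closed boundary_hier[OF tree_aut_inv[OF fq]] g by (simp add: carrier_hier_group)
    ultimately show ?thesis
      using boundary_end_of[OF q(1) r(1)] boundary_hier[OF q(1)] boundary_hier[OF tree_aut_inv[OF fq]]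
        g end_of_in[OF r(1)] end_of_in[OF qr] r(4)
      by (simp add: mult_hier_apply)
  qed
  then show ?thesis using aut_eq q(1) tree_aut_inv[OF fq] by blast
qed

text \<open>
  A bijection that fixes a set pointwise cannot move another point into it.
\<close>

lemma hier_commute_of_disjoint_supports:
  assumes g: "g \<in> hier E" "\<And>e. e \<in> X \<Longrightarrow> g e = e" and h: "h \<in> hier E" "\<And>e. e \<in> Y \<Longrightarrow> h e = e"
    and cover: "ends E \<subseteq> X \<union> Y"
  shows "g \<otimes>\<^bsub>\<H>\<^esub> h = h \<otimes>\<^bsub>\<H>\<^esub> g"
proof -
  have bij: "bij_betw k (ends E) (ends E)" if "k \<in> hier E" for k
    using that hier_subset_Bij by (auto simp: Bij_def)
  have inj: "k e = e" if "k \<in> hier E" "k (k e) = k e" "e \<in> ends E" for k e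
    using bij[OF that(1)] that(2,3) by (auto simp: bij_betw_def dest: inj_onD)
  have "g (h e) = h (g e)" if e: "e \<in> ends E" for e
  proof -
    have "g e \<in> ends E" "h e \<in> ends E" using bij[OF g(1)] bij[OF h(1)] e by (auto simp: bij_betw_def)
    then have "e \<in> X \<or> e \<in> Y" "g e \<in> X \<or> g e \<in> Y" "h e \<in> X \<or> h e \<in> Y" using cover e by blast+
    then show ?thesis using g(2) h(2) inj[OF g(1) _ e] inj[OF h(1) _ e] by metis
  qed
  then have "compose (ends E) g h = compose (ends E) h g" by (simp add: compose_def fun_eq_iff)
  then show ?thesis using g(1) h(1) by (simp add: mult_hier_group)
qed

text \<open>
  After multiplication by automorphisms \<open>g\<close> is trivial on the ends behind \<open>b a\<close> and \<open>h\<close> on those behind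
  \<open>a b\<close>. The powers of \<open>s\<close> map the latter set into itself, so that the conjugates of \<open>h\<close> remain trivial
  on it and commute with \<open>g\<close>.
\<close>

lemma hier_disjoint_supports:
  assumes n: "n \<ge> 2" and s: "s \<in> tree_aut E" "s a = b" "s b = c" "E a b" "c \<noteq> a"
    and g: "g \<in> hier E" and h: "h \<in> hier E"
  shows "\<exists>k1\<in>aut E. \<exists>k2\<in>aut E. \<exists>k3\<in>aut E. \<exists>k4\<in>aut E. \<forall>L::nat.
    (k1 \<otimes>\<^bsub>\<H>\<^esub> g \<otimes>\<^bsub>\<H>\<^esub> k2) \<otimes>\<^bsub>\<H>\<^esub>
      (inv\<^bsub>\<H>\<^esub> (boundary s [^]\<^bsub>\<H>\<^esub> L) \<otimes>\<^bsub>\<H>\<^esub>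
        (k3 \<otimes>\<^bsub>\<H>\<^esub> h \<otimes>\<^bsub>\<H>\<^esub> k4) \<otimes>\<^bsub>\<H>\<^esub> boundary s [^]\<^bsub>\<H>\<^esub> L)
    = (inv\<^bsub>\<H>\<^esub> (boundary s [^]\<^bsub>\<H>\<^esub> L) \<otimes>\<^bsub>\<H>\<^esub>
        (k3 \<otimes>\<^bsub>\<H>\<^esub> h \<otimes>\<^bsub>\<H>\<^esub> k4) \<otimes>\<^bsub>\<H>\<^esub> boundary s [^]\<^bsub>\<H>\<^esub> L)
      \<otimes>\<^bsub>\<H>\<^esub> (k1 \<otimes>\<^bsub>\<H>\<^esub> g \<otimes>\<^bsub>\<H>\<^esub> k2)"
proof -
  let ?G = "\<H>"
  interpret group ?G by (rule group_hier[OF regular_tree])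
  have bc: "E b c" using s tree_autD[OF s(1), of a b] by simp
  have autG: "k \<in> carrier ?G" if "k \<in> aut E" for k
    using that boundary_hier by (auto simp: aut_eq carrier_hier_group)
  obtain k1 k2 where k12: "k1 \<in> aut E" "k2 \<in> aut E"
    and fix_g: "\<And>e. e \<in> shadow E b a \<Longrightarrow> (k1 \<otimes>\<^bsub>?G\<^esub> g \<otimes>\<^bsub>?G\<^esub> k2) e = e"
    using hier_trivial_on_shadow[OF n g sym[OF s(4)]] by blast
  obtain k3 k4 where k34: "k3 \<in> aut E" "k4 \<in> aut E"
    and fix_h: "\<And>e. e \<in> shadow E a b \<Longrightarrow> (k3 \<otimes>\<^bsub>?G\<^esub> h \<otimes>\<^bsub>?G\<^esub> k4) e = e"
    using hier_trivial_on_shadow[OF n h s(4)] by blast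
  define g' h' where "g' = k1 \<otimes>\<^bsub>?G\<^esub> g \<otimes>\<^bsub>?G\<^esub> k2" and "h' = k3 \<otimes>\<^bsub>?G\<^esub> h \<otimes>\<^bsub>?G\<^esub> k4"
  have gh': "g' \<in> carrier ?G" "h' \<in> carrier ?G"
    using g h k12 k34 autG by (auto simp: g'_def h'_def carrier_hier_group[symmetric])
  note hierI = carrier_hier_group[of E, THEN equalityD1, THEN subsetD]
  have sG: "boundary s \<in> carrier ?G" using boundary_hier[OF s(1)] by (simp add: carrier_hier_group)
  have "g' \<otimes>\<^bsub>?G\<^esub> (inv\<^bsub>?G\<^esub> (boundary s [^]\<^bsub>?G\<^esub> L) \<otimes>\<^bsub>?G\<^esub> h' \<otimes>\<^bsub>?G\<^esub> boundary s [^]\<^bsub>?G\<^esub> L)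
      = (inv\<^bsub>?G\<^esub> (boundary s [^]\<^bsub>?G\<^esub> L) \<otimes>\<^bsub>?G\<^esub> h' \<otimes>\<^bsub>?G\<^esub> boundary s [^]\<^bsub>?G\<^esub> L) \<otimes>\<^bsub>?G\<^esub> g'" for L :: nat
  proof -
    let ?t = "boundary s [^]\<^bsub>?G\<^esub> L"
    have t: "?t \<in> carrier ?G" using sG by simp
    have t_shadow: "?t e \<in> shadow E a b" if "e \<in> shadow E a b" for e
      using that
    proof (induction L arbitrary: e)
      case 0
      then show ?case using shadow_ends by (simp add: one_hier_group)
    next
      case (Suc L)
      have "boundary s e \<in> shadow E a b"
        using boundary_shadow[OF s(1) Suc.prems] shadow_nested[OF s(4,5)] s(2,3) by auto
      then show ?case
        using Suc.IH mult_hier_apply[OF hierI hierI shadow_ends[OF Suc.prems], of "boundary s [^]\<^bsub>?G\<^esub> L" "boundary s"] sG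
        by simp
    qed
    have "(inv\<^bsub>?G\<^esub> ?t \<otimes>\<^bsub>?G\<^esub> h' \<otimes>\<^bsub>?G\<^esub> ?t) e = e" if e: "e \<in> shadow E a b" for e
    proof -
      have te: "?t e \<in> ends E" and ee: "e \<in> ends E" using t_shadow[OF e] e shadow_ends by blast+
      have "(inv\<^bsub>?G\<^esub> ?t \<otimes>\<^bsub>?G\<^esub> h' \<otimes>\<^bsub>?G\<^esub> ?t) e = (inv\<^bsub>?G\<^esub> ?t \<otimes>\<^bsub>?G\<^esub> h') (?t e)"
        by (rule mult_hier_apply) (use t gh' ee in \<open>simp_all add: hierI\<close>)
      also have "\<dots> = (inv\<^bsub>?G\<^esub> ?t) (h' (?t e))"
        by (rule mult_hier_apply) (use t gh' te in \<open>simp_all add: hierI\<close>)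
      also have "\<dots> = (inv\<^bsub>?G\<^esub> ?t) (?t e)" using fix_h[OF t_shadow[OF e]] by (simp add: h'_def)
      also have "\<dots> = (inv\<^bsub>?G\<^esub> ?t \<otimes>\<^bsub>?G\<^esub> ?t) e"
        by (rule mult_hier_apply[symmetric]) (use t ee in \<open>simp_all add: hierI\<close>)
      also have "\<dots> = e" using t ee by (simp add: one_hier_group)
      finally show ?thesis .
    qed
    moreover have "ends E \<subseteq> shadow E b a \<union> shadow E a b" using shadow_cover[OF s(4)] by blast
    ultimately show ?thesis
      using t gh' fix_g by (intro hier_commute_of_disjoint_supports) (auto simp: hierI g'_def)
  qed
  then show ?thesis using k12 k34 unfolding g'_def h'_def by blast
qed

section \<open>The Mautner phenomenon\<close>

text \<open>
  The generating cosets are in fact a base: two cosets of the same subgroup that meet coincide.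
\<close>

lemma aut_topology_nhd:
  assumes U: "openin (aut_topology E) U" and g: "g \<in> U"
  shows "\<exists>S. finite S \<and> g <#\<^bsub>\<H>\<^esub> aut_fixing E S \<subseteq> U"
proof -
  interpret group "\<H>" by (rule group_hier[OF regular_tree])
  have "generate_topology_on {g <#\<^bsub>\<H>\<^esub> aut_fixing E S | g S. g \<in> aut E \<and> finite_subtree E S} U"
    using U unfolding aut_topology_def by (rule openin_topology_generated_by)
  then show ?thesis using g
  proof (induction arbitrary: g)
    case (Int U V)
    then obtain S S' where S: "finite S" "g <#\<^bsub>\<H>\<^esub> aut_fixing E S \<subseteq> U"
      "finite S'" "g <#\<^bsub>\<H>\<^esub> aut_fixing E S' \<subseteq> V" by blast
    moreover have "g <#\<^bsub>\<H>\<^esub> aut_fixing E (S \<union> S') \<subseteq> g <#\<^bsub>\<H>\<^esub> aut_fixing E R"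
      if "R \<in> {S, S'}" for R
      using that by (auto simp: aut_fixing_def l_coset_def)
    ultimately have "g <#\<^bsub>\<H>\<^esub> aut_fixing E (S \<union> S') \<subseteq> U \<inter> V" by blast
    then show ?case using S(1,3) by blast
  next
    case (UN \<U>)
    then show ?case by (meson Sup_upper UnionE subset_trans)
  next
    case (Basis U)
    then obtain h S where S: "U = h <#\<^bsub>\<H>\<^esub> aut_fixing E S" "h \<in> aut E" "finite S"
      by (auto simp: finite_subtree_def)
    interpret H: subgroup "aut_fixing E S" "\<H>" by (rule subgroup_aut_fixing[OF regular_tree])
    have h: "h \<in> carrier (\<H>)" using S(2) boundary_hier by (auto simp: aut_eq carrier_hier_group)
    obtain k where k: "k \<in> aut_fixing E S" "g = h \<otimes>\<^bsub>\<H>\<^esub> k" using Basis.prems S(1) by (auto simp: l_coset_def)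
    have "g <#\<^bsub>\<H>\<^esub> aut_fixing E S \<subseteq> U"
    proof
      fix x assume "x \<in> g <#\<^bsub>\<H>\<^esub> aut_fixing E S"
      then obtain k' where k': "k' \<in> aut_fixing E S" "x = g \<otimes>\<^bsub>\<H>\<^esub> k'" by (auto simp: l_coset_def)
      then have "x = h \<otimes>\<^bsub>\<H>\<^esub> (k \<otimes>\<^bsub>\<H>\<^esub> k')" using k h H.mem_carrier by (simp add: m_assoc)
      then show "x \<in> U" using S(1) H.m_closed[OF k(1) k'(1)] by (auto simp: l_coset_def)
    qed
    then show ?case using S(3) by blast
  qed simp
qed

text \<open>
  Continuity at the identity, expressed in terms of automorphisms of the tree.
\<close>

lemma unitary_rep_small:
  assumes rep: "unitary_rep (\<H>) (hier_topology E) \<pi>" and e: "e > 0"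
  shows "\<exists>S. finite S \<and> (\<forall>f\<in>tree_aut E. (\<forall>v\<in>S. f v = v) \<longrightarrow> norm (\<pi> (boundary f) y - y) < e)"
proof -
  interpret group "\<H>" by (rule group_hier[OF regular_tree])
  let ?T = "hier_topology E"
  have T: "openin ?T (aut E)" "subtopology ?T (aut E) = aut_topology E" "topspace ?T = hier E"
    using is_hier_topology_hier_topology[OF regular_tree]
    by (auto simp: is_hier_topology_def topological_group_def carrier_hier_group)
  have one: "\<pi> \<one>\<^bsub>\<H>\<^esub> y = y"
    using rep one_closed l_one[OF one_closed] unfolding unitary_rep_def by (metis unitary_idempotent)
  let ?U = "{g \<in> topspace ?T. \<pi> g y \<in> ball y e}"
  have "openin ?T ?U"
    using rep by (intro openin_continuous_map_preimage[of _ euclidean]) (auto simp: unitary_rep_def)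
  then have "openin (aut_topology E) (?U \<inter> aut E)"
    unfolding T(2)[symmetric] openin_open_subtopology[OF T(1)] using T(1) by blast
  moreover have "\<one>\<^bsub>\<H>\<^esub> \<in> aut E"
    unfolding aut_eq boundary_id[symmetric] by (rule imageI[OF tree_aut_id])
  then have "\<one>\<^bsub>\<H>\<^esub> \<in> ?U \<inter> aut E"
    using one_closed one e T(3) by (simp add: carrier_hier_group)
  ultimately obtain S where S: "finite S" "\<one>\<^bsub>\<H>\<^esub> <#\<^bsub>\<H>\<^esub> aut_fixing E S \<subseteq> ?U \<inter> aut E"
    using aut_topology_nhd by blast
  have "norm (\<pi> (boundary f) y - y) < e" if f: "f \<in> tree_aut E" "\<forall>v\<in>S. f v = v" for f
  proof -
    have "boundary f \<in> aut_fixing E S" using f aut_fixing_eq by blast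
    moreover have "boundary f = \<one>\<^bsub>\<H>\<^esub> \<otimes>\<^bsub>\<H>\<^esub> boundary f"
      using boundary_hier[OF f(1)] by (simp add: carrier_hier_group)
    ultimately have "boundary f \<in> ?U" using S(2) by (auto simp: l_coset_def)
    then show ?thesis by (simp add: dist_norm norm_minus_commute)
  qed
  then show ?thesis using S(1) by blast
qed

text \<open>
  If \<open>\<pi>(s) y = y\<close> then \<open>\<pi>(u) y - y\<close> has the same norm as \<open>\<pi>(s\<^sup>-\<^sup>j u s\<^sup>j) y - y\<close>. For \<open>u\<close> trivial on the
  branch ahead of \<open>s\<close>, the conjugate \<open>s\<^sup>-\<^sup>j u s\<^sup>j\<close> is trivial on any given finite set for large \<open>j\<close>, so
  this norm is arbitrarily small and \<open>\<pi>(u)\<close> fixes \<open>y\<close>. Applied to \<open>s\<close> and its inverse, this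
  covers the stabilizer of an edge, which with \<open>s\<close> generates all automorphisms.
\<close>

lemma translation_invariant_imp_aut_invariant:
  assumes n: "n \<ge> 2" and s: "s \<in> tree_aut E" "s a = b" "s b = c" "E a b" "c \<noteq> a"
    and rep: "unitary_rep (\<H>) (hier_topology E) \<pi>" and y: "\<pi> (boundary s) y = y"
  shows "y \<in> invariants (aut E) \<pi>"
proof -
  interpret group "\<H>" by (rule group_hier[OF regular_tree])
  define \<rho> where "\<rho> f = \<pi> (boundary f)" for f
  have bG: "boundary f \<in> carrier (\<H>)" if "f \<in> tree_aut E" for f
    using boundary_hier[OF that] by (simp add: carrier_hier_group)
  have comp: "\<rho> (f \<circ> g) x = \<rho> f (\<rho> g x)" if "f \<in> tree_aut E" "g \<in> tree_aut E" for f g x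
    using rep bG that by (simp add: \<rho>_def boundary_comp unitary_rep_def)
  have unit: "unitary (\<rho> f)" if "f \<in> tree_aut E" for f
    using rep bG[OF that] by (simp add: \<rho>_def unitary_rep_def)
  have isom: "norm (\<rho> f x - \<rho> f z) = norm (x - z)" if "f \<in> tree_aut E" for f x z
  proof -
    have "\<rho> f x - \<rho> f z = \<rho> f (x - z)"
      using unit[OF that] module_hom.diff[of scaleC scaleC "\<rho> f"]
      by (simp add: unitary_def linear_iff_module_hom)
    moreover have "inner (\<rho> f u) (\<rho> f u) = inner u u" for u
      using unit[OF that] by (simp add: unitary_def flip: Re_cinner)
    ultimately show ?thesis by (simp add: norm_eq_sqrt_inner)
  qed
  have id: "\<rho> id x = x" for x
    by (rule unitary_idempotent[OF unit[OF tree_aut_id]]) (use comp[OF tree_aut_id tree_aut_id] in auto)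
  define \<Gamma> where "\<Gamma> = {f \<in> tree_aut E. \<rho> f y = y}"
  have \<Gamma>_comp: "f \<circ> g \<in> \<Gamma>" if "f \<in> \<Gamma>" "g \<in> \<Gamma>" for f g
    using that by (simp add: \<Gamma>_def tree_aut_comp comp)
  have inv_comp: "\<rho> (inv_into UNIV f) (\<rho> f x) = x" if f: "f \<in> tree_aut E" for f x
  proof -
    have "inv_into UNIV f \<circ> f = id" using tree_aut_inv_left[OF f] by (simp add: fun_eq_iff)
    then show ?thesis using comp[OF tree_aut_inv[OF f] f, of x] id by simp
  qed
  have \<Gamma>_inv: "inv_into UNIV f \<in> \<Gamma>" if "f \<in> \<Gamma>" for f
    using that inv_comp[of f y] tree_aut_inv by (auto simp: \<Gamma>_def)
  have \<Gamma>_pow: "f ^^ j \<in> \<Gamma>" if "f \<in> \<Gamma>" for f and j :: nat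
  proof (induction j)
    case 0
    then show ?case using id tree_aut_id by (simp add: \<Gamma>_def id_def)
  next
    case (Suc j)
    then show ?case using \<Gamma>_comp[OF that Suc] by (simp add: o_def)
  qed
  have sG: "s \<in> \<Gamma>" using s(1) y by (simp add: \<Gamma>_def \<rho>_def)
  have mautner: "u \<in> \<Gamma>"
    if s: "s \<in> \<Gamma>" "s a = b" "s b = c" "E a b" "c \<noteq> a" and u: "u \<in> tree_aut E" "\<forall>x\<in>branch a b. u x = x"
    for s u a b c
  proof -
    have "norm (\<rho> u y - y) < e" if "e > 0" for e
    proof -
      obtain S where S: "finite S"
        "\<And>f. f \<in> tree_aut E \<Longrightarrow> \<forall>v\<in>S. f v = v \<Longrightarrow> norm (\<rho> f y - y) < e"
        using unitary_rep_small[OF rep \<open>e > 0\<close>, of y] unfolding \<rho>_def by metis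
      have "s \<in> tree_aut E" using s(1) by (simp add: \<Gamma>_def)
      then obtain j where j: "\<forall>x\<in>S. (s ^^ j) x \<in> branch a b"
        using translation_attracts[OF _ s(2-5) S(1)] by blast
      \<comment> \<open>Conjugation by a large power of \<open>s\<close> brings \<open>u\<close> close to the identity.\<close>
      let ?t = "s ^^ j"
      have tG: "?t \<in> \<Gamma>" using \<Gamma>_pow s(1) .
      then have t: "?t \<in> tree_aut E" "\<rho> ?t y = y" by (auto simp: \<Gamma>_def)
      let ?i = "inv_into UNIV ?t"
      have i: "?i \<in> tree_aut E" "\<rho> ?i y = y" using \<Gamma>_inv[OF tG] by (auto simp: \<Gamma>_def)
      have w: "?i \<circ> u \<circ> ?t \<in> tree_aut E" by (intro tree_aut_comp i(1) u(1) t(1))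
      have "\<forall>v\<in>S. (?i \<circ> u \<circ> ?t) v = v" using j u(2) tree_aut_inv_left[OF t(1)] by simp
      then have "norm (\<rho> (?i \<circ> u \<circ> ?t) y - y) < e" by (rule S(2)[OF w])
      moreover have "\<rho> (?i \<circ> u \<circ> ?t) y = \<rho> ?i (\<rho> u y)"
        using comp[OF tree_aut_comp[OF i(1) u(1)] t(1)] comp[OF i(1) u(1)] t(2) by simp
      ultimately show ?thesis using isom[OF i(1), of "\<rho> u y" y] i(2) by simp
    qed
    then have "norm (\<rho> u y - y) \<le> 0" using less_irrefl not_le by blast
    then show ?thesis using u(1) by (simp add: \<Gamma>_def)
  qed
  have bc: "E b c" using s tree_autD[OF s(1), of a b] by simp
  have edge: "f \<in> \<Gamma>" if f: "f \<in> tree_aut E" "f a = a" "f b = b" for f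
  proof -
    obtain g h where gh: "g \<in> tree_aut E" "h \<in> tree_aut E" "f = g \<circ> h"
      "\<forall>x\<in>branch b a. g x = x" "\<forall>x\<in>branch a b. h x = x"
      using tree_aut_fix_edge_decompose[OF s(4) f] by blast
    let ?i = "inv_into UNIV s"
    have i: "?i c = b" "?i b = a" "?i \<in> tree_aut E"
      using tree_aut_inv_left[OF s(1)] tree_aut_inv[OF s(1)] s(2,3) by metis+
    \<comment> \<open>The inverse of \<open>s\<close> is a translation along \<open>c\<close>, \<open>b\<close>, \<open>a\<close>, so the factor trivial behind \<open>b a\<close> is first shifted behind \<open>c b\<close>.\<close>
    have "s \<circ> g \<circ> ?i \<in> \<Gamma>"
    proof (rule mautner[OF \<Gamma>_inv[OF sG] i(1,2) sym[OF bc] s(5)[symmetric]])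
      show "s \<circ> g \<circ> ?i \<in> tree_aut E" by (intro tree_aut_comp s(1) gh(1) i(3))
      show "\<forall>x\<in>branch c b. (s \<circ> g \<circ> ?i) x = x"
        using tree_aut_branch[OF i(3), of _ c b] gh(4) i tree_aut_inv_right[OF s(1)] by simp
    qed
    from \<Gamma>_comp[OF \<Gamma>_comp[OF \<Gamma>_inv[OF sG] this] sG]
    have "?i \<circ> (s \<circ> g \<circ> ?i) \<circ> s \<in> \<Gamma>" .
    moreover have "?i \<circ> (s \<circ> g \<circ> ?i) \<circ> s = g"
      using tree_aut_inv_left[OF s(1)] by (simp add: fun_eq_iff)
    ultimately have "g \<in> \<Gamma>" by simp
    moreover have "h \<in> \<Gamma>" by (rule mautner[OF sG s(2-5) gh(2,5)])
    ultimately show ?thesis using gh(3) \<Gamma>_comp by simp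
  qed
  have "f \<in> \<Gamma>" if "f \<in> tree_aut E" for f
    by (rule tree_aut_generated[OF n s sG \<Gamma>_comp \<Gamma>_inv _ edge that]) (simp_all add: \<Gamma>_def)
  then show ?thesis by (auto simp: invariants_def aut_eq \<Gamma>_def \<rho>_def)
qed

end

section \<open>Sphericity\<close>

theorem theorem3:
  fixes E :: "'v \<Rightarrow> 'v \<Rightarrow> bool" and n :: nat
  assumes "n \<ge> 2" and "regular_tree n E"
  shows "spherical TYPE('h::chilbert_space) (hier_group E) (hier_topology E) (aut E)"
proof -
  interpret tree n E by unfold_locales (rule assms(2))
  obtain s a b c where s: "s \<in> tree_aut E" "s a = b" "s b = c" "E a b" "c \<noteq> a"
    using ex_translation[OF assms(1)] by blast
  have sub: "subgroup (aut E) (hier_group E)"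
    using subgroup_aut_fixing[OF assms(2), of "{}"] by (simp add: aut_fixing_def aut_def)
  have "\<exists>v. invariants (aut E) \<pi> \<subseteq> complex_vector.span {v}"
    if \<pi>: "unitary_rep (hier_group E) (hier_topology E) \<pi>" "irreducible_rep (hier_group E) \<pi>"
    for \<pi> :: "_ \<Rightarrow> 'h \<Rightarrow> 'h"
  proof (rule spherical_criterion[OF group_hier[OF assms(2)] sub _ _ \<pi>(2)])
    show "boundary s \<in> aut E" using aut_eq s(1) by blast
    show "v \<in> invariants (aut E) \<pi>" if "\<pi> (boundary s) v = v" for v
      by (rule translation_invariant_imp_aut_invariant[OF assms(1) s \<pi>(1) that])
  qed (use \<pi>(1) hier_disjoint_supports[OF assms(1) s] in
      \<open>auto simp: unitary_rep_def carrier_hier_group\<close>)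
  then have "(\<exists>B. finite B \<and> invariants (aut E) \<pi> \<subseteq> complex_vector.span B) \<and>
      complex_vector.dim (invariants (aut E) \<pi>) \<le> 1"
    if "unitary_rep (hier_group E) (hier_topology E) \<pi>" "irreducible_rep (hier_group E) \<pi>"
    for \<pi> :: "_ \<Rightarrow> 'h \<Rightarrow> 'h"
    using that complex_vector.dim_le_card by (metis card.empty card_insert_if empty_iff finite.emptyI finite_insert One_nat_def)
  moreover have "topological_group (hier_group E) (hier_topology E)"
    using is_hier_topology_hier_topology[OF assms(2)] by (simp add: is_hier_topology_def)
  ultimately show ?thesis unfolding spherical_def using sub by blast
qed

end
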